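(* Let $\Pi$ be a finitely generated commutative monoid and $S$ a finitely generated $\Pi$-set, and let $\mu$ be a monoid partree for $(\Pi,S)$, but with, for every vertex $x$, the preorder $\leq_x$ on $S_x$ replaced by a corresponding preotree $\tau_x$ for the $\mathrm{Gr}(\Pi_x)$-set $\mathrm{Gr}(S_x)$. Let $\Sigma_x$ be the space of numerical data for $\tau_x$ and set $\Sigma:=\prod_x\Sigma_x$. Then the locus \[ \Gamma:=\{p\in\Sigma\mid\mu^p\text{ is a monoid partree and }{\leq^p}\text{ is compatible with }\Pi\} \] is a countable union of $\mathbb{Q}$-semi-algebraic sets.
   Context: $\Pi$-sets and preorders. A $\Pi$-set is a set with an action of the monoid $\Pi$; it is finitely generated if $S=\Pi s_1\cup\cdots\cup\Pi s_k$ for some $s_i\in S$. A preorder on a set is a reflexive, transitive, total relation; it is compatible with an action of $\Pi$ on $S$ (a preorder on the $\Pi$-set $S$) if $r\leq s\Rightarrow ur\leq us$ for all $r,s\in S$, $u\in\Pi$. Write $s\approx t$ if $s\leq t$ and $t\leq s$, and $s<t$ if $s\leq t$ and not $t\leq s$. Partree. A partree on a set $S$ is a finite rooted tree in which each vertex $x$ is labelled by a subset $S_x\subseteq S$, a partial order $\preceq_x$ on the children of $x$, and a preorder $\leq_x$ on the set $S_x$, such that: (1) for the root $r$, $S_r=S$; (2) if $y_1,\ldots,y_k$ are the children of a non-leaf $x$, then $S_x$ is the disjoint union of the $S_{y_i}$; (3) if $s,t\in S_x$ satisfy $s\approx_x t$, then either $x$ is a leaf, or any children $y,z$ of $x$ with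 $s\in S_y$, $t\in S_z$ satisfy $y\preceq_x z$ or $z\preceq_x y$. The preorder on the set $S$ determined by the partree: for $s,t\in S$ let $x_0=r,x_1,\ldots,x_k$ be the maximal path from the root with $s,t\in S_{x_k}$; then $s\leq t$ iff (i) either $s\approx_{x_i}t$ for all $i=0,\ldots,k$, and then either $x_k$ is a leaf or $s\in S_y$, $t\in S_z$ for children $y,z$ of $x_k$ with $y\prec_{x_k}z$; (ii) or the minimal $i$ with $s\not\approx_{x_i}t$ satisfies $s<_{x_i}t$. Groups from monoids. $\mathrm{Gr}(\Pi)$ is the group completion of the commutative monoid $\Pi$, with $[\underline{u}]$ the image of $u\in\Pi$. For a $\Pi$-set $S$, $\mathrm{Gr}(S)$ is the quotient of $\mathrm{Gr}(\Pi)\times S$ by the relations $(a[\underline{u}],s)=(a,us)$; it is a $\mathrm{Gr}(\Pi)$-set via $b[a,s]=[ba,s]$, with canonical map $S\to\mathrm{Gr}(S)$, $s\mapsto[1,s]$. Pull-back of a preorder along a map $\phi$: $s\leq t:\Leftrightarrow\phi(s)\leq\phi(t)$. Monoid partree. An action of a commutative monoid on a set is good if $uvx=x$ implies $ux=vx=x$. A monoid partree $\mu$ for $(\Pi,S)$ is a partree on $S$ such that each vertex $x$ is further equipped with a finitely generated submonoid $\Pi_x\subseteq\Pi$ with a good action $(u,y)\mapsto uy$ on the children of $x$, such that: (1) for the root $r$, $\Pi_r=\Pi$, and for any child $y$ of $x$, the stabiliser of $y$ in $\Pi_x$ is $\Pi_y$; (2) $S_x$ is a finitely generated $\Pi_x$-set,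 and $uS_y\subseteq S_{uy}$ for each child $y$ of $x$ and $u\in\Pi_x$; (3) $\leq_x$ is the pull-back along $S_x\to\mathrm{Gr}(S_x)$ of a preorder on the $\mathrm{Gr}(\Pi_x)$-set $\mathrm{Gr}(S_x)$; (4) for children $y,z$ of $x$ and $u\in\Pi_x$, $y\preceq_x z\Rightarrow uy\preceq_x uz$; (5) for any child $y$ of $x$ and $s,t\in S_y$, $s\leq_y t\Rightarrow s\leq_x t$. Preotrees (for a finitely generated abelian group $G$ and a finitely generated $G$-set $M$). A preotree $\tau$ for $(G,M)$ is a finite rooted tree in which each vertex $v$ is labelled by a pair $(G_v,M_v)$ of a saturated subgroup $G_v$ of $G$ (quotient free abelian) and a $G_v$-stable subset $M_v$ of $M$, such that: (1) for the root $\rho$, $G_\rho=G$ and $M_\rho=M$; (2) for a child $w$ of $v$, $M_w\subseteq M_v$ and $G_w$ is a saturated subgroup of $G_v$ containing all stabilisers of elements in $M_v$; (3) if the set $W$ of children of $v$ is nonempty, then $G_w$ is the same for all $w\in W$, the $M_w$ are disjoint, and $\bigsqcup_{w\in W}M_w$ intersects each $G_v$-orbit in $M_v$ in precisely one $G_w$-orbit. Numerical data for $\tau$ consists of, for each non-leaf $v$, a homomorphism $f_v:G_v\to\mathbb{R}$ and a map $g_v:M_v\to\mathbb{R}$ such that: (1) $g_v(us)=f_v(u)+g_v(s)$ for $u\in G_v,s\in M_v$; (2) for each child $w$ of $v$, $G_w=\ker(f_v)$ and $g_v$ is constant on $M_w$, with value $g_v(M_w)$; (3) for distinct children $w,w'$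 of $v$ and $s\in M_w$, $t\in M_{w'}$, $g_v(s)$ and $g_v(t)$ are in distinct cosets of $\mathrm{im}(f_v)$; (4) if $G_v/\ker(f_v)$ has rank $1$ and is generated by $u_0+\ker(f_v)$, then $g_v(M_w)\in(0,|f_v(u_0)|)$ for every child $w$. It determines a preorder on the $G$-set $M$ recursively: if the root $\rho$ is a leaf, $s\leq t$ for all $s,t$; otherwise $s\leq t$ if $g_\rho(s)<g_\rho(t)$, or $g_\rho(s)=g_\rho(t)$ and, picking $u\in G$ with $us\in M_w$ for some child $w$ of $\rho$ (then also $ut\in M_w$), one has $us\leq ut$ in the preorder on $M_w$ determined by the sub-preotree rooted at $w$ with the inherited numerical data (this is independent of $u$). Every preorder on the $G$-set $M$ arises this way from some preotree with numerical data. Space of numerical data. For $n,m\geq0$, the irrational space $\Xi(n,m)$ is the set of $(a,b)\in\mathbb{R}^n\times\mathbb{R}^m$ such that $a_1,\ldots,a_n$ are linearly independent over $\mathbb{Q}$; $b_j-b_l\notin\bigoplus_i\mathbb{Z}a_i$ for all $j\neq l$; and, if $n=1$, $b_j\in(0,|a_1|)$ for all $j$. For a non-leaf $v$ with $m$ children $w$ and $n=\mathrm{rk}(G_v/G_w)$, after fixing free generators of $G_v/G_w$ and an ordering of the children, $(f_v,g_v)$ is encoded by the values of $f_v$ on the generators and the values $g_v(M_w)$, a point of $\Xi(n,m)$. The space of numerical data of $\tau$ is the product of these irrational spaces over all non-leaves $v$. A subset of a finite product of irrational spaces, contained in $\mathbb{R}^N$, is called $\mathbb{Q}$-semi-algebraic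 if it is the intersection of that product with a semi-algebraic subset of $\mathbb{R}^N$ defined by polynomials with rational coefficients. $\mu^p$ and $\leq^p$. In the theorem, for each vertex $x$ one takes a preotree $\tau_x$ for $(\mathrm{Gr}(\Pi_x),\mathrm{Gr}(S_x))$ which, with suitable numerical data, determines a preorder whose pull-back to $S_x$ is $\leq_x$; only the tree, the $S_x$, $\Pi_x$, the actions, the $\preceq_x$ and the $\tau_x$ are retained. For $p=(p_x)_x\in\Sigma$, $\mu^p$ is obtained by letting $\leq_x$ be the pull-back to $S_x$ of the preorder on $\mathrm{Gr}(S_x)$ determined by $(\tau_x,p_x)$; $\mu^p$ is a partree on $S$, and $\leq^p$ is the (not necessarily $\Pi$-compatible) preorder on $S$ it determines. *)

theory Defs
  imports Complex_Main
    "HOL-Library.Countable_Set"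
    "HOL-Library.FuncSet"
    "HOL-Library.Disjoint_Sets"
    "HOL-Library.Poly_Mapping"
    "HOL-Algebra.Group_Action"
    "HOL-Algebra.Free_Abelian_Groups"
begin

section \<open>Sets with a monoid action, preorders\<close>

definition restr :: "('u, 'c) monoid_scheme \<Rightarrow> 'u set \<Rightarrow> ('u, 'c) monoid_scheme" where
  "restr P H = P\<lparr>carrier := H\<rparr>"

definition fg_monoid :: "('u, 'c) monoid_scheme \<Rightarrow> bool" where
  "fg_monoid P \<longleftrightarrow> (\<exists>A. finite A \<and> A \<subseteq> carrier P \<and>
     (\<forall>K. submonoid K P \<and> A \<subseteq> K \<longrightarrow> carrier P \<subseteq> K))"

definition monoid_action :: "('u, 'c) monoid_scheme \<Rightarrow> ('u \<Rightarrow> 's \<Rightarrow> 's) \<Rightarrow> 's set \<Rightarrow> bool" where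
  "monoid_action P act S \<longleftrightarrow>
     (\<forall>u\<in>carrier P. \<forall>s\<in>S. act u s \<in> S) \<and>
     (\<forall>s\<in>S. act \<one>\<^bsub>P\<^esub> s = s) \<and>
     (\<forall>u\<in>carrier P. \<forall>v\<in>carrier P. \<forall>s\<in>S. act (u \<otimes>\<^bsub>P\<^esub> v) s = act u (act v s))"

definition fg_action :: "('u, 'c) monoid_scheme \<Rightarrow> ('u \<Rightarrow> 's \<Rightarrow> 's) \<Rightarrow> 's set \<Rightarrow> bool" where
  "fg_action P act S \<longleftrightarrow> monoid_action P act S \<and>
     (\<exists>A. finite A \<and> A \<subseteq> S \<and> S = (\<Union>s\<in>A. orbit P act s))"

definition good_action :: "('u, 'c) monoid_scheme \<Rightarrow> ('u \<Rightarrow> 's \<Rightarrow> 's) \<Rightarrow> 's set \<Rightarrow> bool" where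
  "good_action P act S \<longleftrightarrow> monoid_action P act S \<and>
     (\<forall>u\<in>carrier P. \<forall>v\<in>carrier P. \<forall>y\<in>S.
        act (u \<otimes>\<^bsub>P\<^esub> v) y = y \<longrightarrow> act u y = y \<and> act v y = y)"

text \<open>All preorders here are total; \<^const>\<open>total_on\<close> only concerns pairs of distinct
  elements, the remaining pairs being covered by reflexivity.\<close>

definition total_preorder_on :: "'s set \<Rightarrow> 's rel \<Rightarrow> bool" where
  "total_preorder_on S r \<longleftrightarrow> preorder_on S r \<and> total_on S r"

definition compatible_rel :: "('u, 'c) monoid_scheme \<Rightarrow> ('u \<Rightarrow> 's \<Rightarrow> 's) \<Rightarrow> 's rel \<Rightarrow> bool" where
  "compatible_rel P act r \<longleftrightarrow>
     (\<forall>u\<in>carrier P. \<forall>s t. (s, t) \<in> r \<longrightarrow> (act u s, act u t) \<in> r)"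

definition pullback_rel :: "('s \<Rightarrow> 'm) \<Rightarrow> 's set \<Rightarrow> 'm rel \<Rightarrow> 's rel" where
  "pullback_rel \<phi> S r = {(s, t). s \<in> S \<and> t \<in> S \<and> (\<phi> s, \<phi> t) \<in> r}"

definition rel_equiv :: "'s rel \<Rightarrow> 's \<Rightarrow> 's \<Rightarrow> bool" where
  "rel_equiv r s t \<longleftrightarrow> (s, t) \<in> r \<and> (t, s) \<in> r"

definition rel_strict :: "'s rel \<Rightarrow> 's \<Rightarrow> 's \<Rightarrow> bool" where
  "rel_strict r s t \<longleftrightarrow> (s, t) \<in> r \<and> (t, s) \<notin> r"

section \<open>Group completion of a monoid and of a set with an action\<close>

text \<open>The pair \<open>(a, b)\<close> stands for the formal quotient of \<open>a\<close> by \<open>b\<close>.\<close>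

definition gr_rel :: "('u, 'c) monoid_scheme \<Rightarrow> ('u \<times> 'u) rel" where
  "gr_rel P = {((a, b), (c, d)). a \<in> carrier P \<and> b \<in> carrier P \<and> c \<in> carrier P \<and> d \<in> carrier P \<and>
     (\<exists>e\<in>carrier P. a \<otimes>\<^bsub>P\<^esub> d \<otimes>\<^bsub>P\<^esub> e = c \<otimes>\<^bsub>P\<^esub> b \<otimes>\<^bsub>P\<^esub> e)}"

definition Gr :: "('u, 'c) monoid_scheme \<Rightarrow> ('u \<times> 'u) set monoid" where
  "Gr P = \<lparr>carrier = (carrier P \<times> carrier P) // gr_rel P,
     monoid.mult = (\<lambda>X Y. \<Union>(a, b)\<in>X. \<Union>(c, d)\<in>Y. gr_rel P `` {(a \<otimes>\<^bsub>P\<^esub> c, b \<otimes>\<^bsub>P\<^esub> d)}),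
     one = gr_rel P `` {(\<one>\<^bsub>P\<^esub>, \<one>\<^bsub>P\<^esub>)}\<rparr>"

lemma equiv_gr_rel:
  fixes P (structure)
  assumes "comm_monoid P"
  shows "equiv (carrier P \<times> carrier P) (gr_rel P)"
proof -
  interpret comm_monoid P by fact
  show ?thesis
  proof (rule equivI)
    show "gr_rel P \<subseteq> (carrier P \<times> carrier P) \<times> (carrier P \<times> carrier P)" unfolding gr_rel_def by auto
    show "refl_on (carrier P \<times> carrier P) (gr_rel P)" unfolding gr_rel_def refl_on_def by auto
    show "sym (gr_rel P)" unfolding gr_rel_def sym_def by clarsimp metis
    show "trans (gr_rel P)"
    proof (rule transI, clarsimp simp: gr_rel_def)
      fix a b c d e f x y
      assume *: "a \<in> carrier P" "b \<in> carrier P" "c \<in> carrier P" "d \<in> carrier P"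
        "e \<in> carrier P" "f \<in> carrier P" "x \<in> carrier P" "y \<in> carrier P"
        and 1: "a \<otimes> d \<otimes> x = c \<otimes> b \<otimes> x"
        and 2: "c \<otimes> f \<otimes> y = e \<otimes> d \<otimes> y"
      have "a \<otimes> f \<otimes> (d \<otimes> x \<otimes> y) = (a \<otimes> d \<otimes> x) \<otimes> (f \<otimes> y)"
        using * by (simp add: m_ac)
      also have "\<dots> = (c \<otimes> f \<otimes> y) \<otimes> (b \<otimes> x)"
        unfolding 1 using * by (simp add: m_ac)
      also have "\<dots> = e \<otimes> b \<otimes> (d \<otimes> x \<otimes> y)"
        unfolding 2 using * by (simp add: m_ac)
      finally show "\<exists>z\<in>carrier P. a \<otimes> f \<otimes> z = e \<otimes> b \<otimes> z"
        using * by (intro bexI[of _ "d \<otimes> x \<otimes> y"]) auto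
    qed
  qed
qed

lemma gr_rel_cong:
  fixes P (structure)
  assumes "comm_monoid P"
    and "((a,b),(a',b')) \<in> gr_rel P" "((c,d),(c',d')) \<in> gr_rel P"
  shows "((a \<otimes> c, b \<otimes> d),(a' \<otimes> c', b' \<otimes> d')) \<in> gr_rel P"
proof -
  interpret comm_monoid P by fact
  obtain x y where *:
    "a\<in>carrier P" "b\<in>carrier P" "a'\<in>carrier P" "b'\<in>carrier P" "c\<in>carrier P" "d\<in>carrier P"
    "c'\<in>carrier P" "d'\<in>carrier P" "x\<in>carrier P" "y\<in>carrier P"
    "a \<otimes> b' \<otimes> x = a' \<otimes> b \<otimes> x" "c \<otimes> d' \<otimes> y = c' \<otimes> d \<otimes> y"
    using assms(2,3) unfolding gr_rel_def by auto
  have "(a \<otimes> c) \<otimes> (b' \<otimes> d') \<otimes> (x \<otimes> y) = (a \<otimes> b' \<otimes> x) \<otimes> (c \<otimes> d' \<otimes> y)"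
    using *(1-10) by (simp add: m_ac)
  also have "\<dots> = (a' \<otimes> c') \<otimes> (b \<otimes> d) \<otimes> (x \<otimes> y)"
    unfolding *(11,12) using *(1-10) by (simp add: m_ac)
  finally show ?thesis using *(1-10) unfolding gr_rel_def by auto
qed

lemma Gr_mult:
  fixes P (structure)
  assumes "comm_monoid P"
    and "a\<in>carrier P" "b\<in>carrier P" "c\<in>carrier P" "d\<in>carrier P"
  shows "(gr_rel P `` {(a,b)}) \<otimes>\<^bsub>Gr P\<^esub> (gr_rel P `` {(c,d)}) = gr_rel P `` {(a \<otimes> c, b \<otimes> d)}"
proof -
  have E: "equiv (carrier P \<times> carrier P) (gr_rel P)" by (rule equiv_gr_rel[OF assms(1)])
  have A: "(a,b) \<in> gr_rel P `` {(a,b)}" "(c,d) \<in> gr_rel P `` {(c,d)}"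
    using equiv_class_self[OF E] assms by auto
  let ?X = "gr_rel P `` {(a, b)}" and ?Y = "gr_rel P `` {(c, d)}"
    and ?D = "gr_rel P `` {(a \<otimes> c, b \<otimes> d)}"
  have D: "gr_rel P `` {(fst p \<otimes> fst q, snd p \<otimes> snd q)} = ?D"
    if "p \<in> ?X" "q \<in> ?Y" for p q
    using equiv_class_eq[OF E gr_rel_cong[OF assms(1), of a b "fst p" "snd p" c d "fst q" "snd q"]] that
    by simp
  have "?X \<otimes>\<^bsub>Gr P\<^esub> ?Y =
      (\<Union>p\<in>?X. \<Union>q\<in>?Y. gr_rel P `` {(fst p \<otimes> fst q, snd p \<otimes> snd q)})"
    by (simp add: Gr_def case_prod_beta)
  also have "\<dots> = (\<Union>p\<in>?X. \<Union>q\<in>?Y. ?D)"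
    by (intro SUP_cong refl D)
  also have "\<dots> = ?D"
    using A by (simp only: UN_constant) auto
  finally show ?thesis .
qed

lemma comm_group_Gr:
  fixes P (structure)
  assumes C: "comm_monoid P"
  shows "comm_group (Gr P)"
proof -
  interpret comm_monoid P by fact
  have carr: "X \<in> carrier (Gr P) \<longleftrightarrow> (\<exists>a\<in>carrier P. \<exists>b\<in>carrier P. X = gr_rel P `` {(a,b)})" for X
    by (auto simp: Gr_def quotient_def)
  have o: "\<one>\<^bsub>Gr P\<^esub> = gr_rel P `` {(\<one>,\<one>)}" by (simp add: Gr_def)
  show ?thesis
  proof (rule comm_groupI, goal_cases)
    case (1 x y) then show ?case unfolding carr by (auto simp: Gr_mult[OF C] intro!: bexI)
  next case 2 then show ?case unfolding carr o by blast
  next case (3 x y z) then show ?case unfolding carr by (auto simp: Gr_mult[OF C] m_ac)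
  next case (4 x y) then show ?case unfolding carr by (auto simp: Gr_mult[OF C] m_ac)
  next case (5 x) then show ?case unfolding carr o by (auto simp: Gr_mult[OF C])
  next case (6 x)
    then obtain a b where x: "a\<in>carrier P" "b\<in>carrier P" "x = gr_rel P `` {(a,b)}" unfolding carr by auto
    have "gr_rel P `` {(b \<otimes> a, a \<otimes> b)} = gr_rel P `` {(\<one>,\<one>)}"
      by (rule equiv_class_eq[OF equiv_gr_rel[OF C]]) (use x in \<open>auto simp: gr_rel_def m_ac\<close>)
    then show ?case using x by (intro bexI[of _ "gr_rel P `` {(b,a)}"]) (auto simp: carr o Gr_mult[OF C])
  qed
qed

definition gr_of :: "('u, 'c) monoid_scheme \<Rightarrow> 'u \<Rightarrow> ('u \<times> 'u) set" where
  "gr_of P u = gr_rel P `` {(u, \<one>\<^bsub>P\<^esub>)}"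

definition gr_set_step ::
  "('u, 'c) monoid_scheme \<Rightarrow> ('u \<Rightarrow> 's \<Rightarrow> 's) \<Rightarrow> 's set \<Rightarrow> (('u \<times> 'u) set \<times> 's) rel" where
  "gr_set_step P act S = {((a \<otimes>\<^bsub>Gr P\<^esub> gr_of P u, s), (a, act u s)) | a u s.
     a \<in> carrier (Gr P) \<and> u \<in> carrier P \<and> s \<in> S}"

definition gr_set_rel ::
  "('u, 'c) monoid_scheme \<Rightarrow> ('u \<Rightarrow> 's \<Rightarrow> 's) \<Rightarrow> 's set \<Rightarrow> (('u \<times> 'u) set \<times> 's) rel" where
  "gr_set_rel P act S = (gr_set_step P act S \<union> (gr_set_step P act S)\<inverse>)\<^sup>*"

definition gr_set ::
  "('u, 'c) monoid_scheme \<Rightarrow> ('u \<Rightarrow> 's \<Rightarrow> 's) \<Rightarrow> 's set \<Rightarrow> (('u \<times> 'u) set \<times> 's) set set" where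
  "gr_set P act S = (carrier (Gr P) \<times> S) // gr_set_rel P act S"

definition gr_act ::
  "('u, 'c) monoid_scheme \<Rightarrow> ('u \<Rightarrow> 's \<Rightarrow> 's) \<Rightarrow> 's set \<Rightarrow>
   ('u \<times> 'u) set \<Rightarrow> (('u \<times> 'u) set \<times> 's) set \<Rightarrow> (('u \<times> 'u) set \<times> 's) set" where
  "gr_act P act S b X = (\<Union>(a, s)\<in>X. gr_set_rel P act S `` {(b \<otimes>\<^bsub>Gr P\<^esub> a, s)})"

definition gr_set_of ::
  "('u, 'c) monoid_scheme \<Rightarrow> ('u \<Rightarrow> 's \<Rightarrow> 's) \<Rightarrow> 's set \<Rightarrow> 's \<Rightarrow> (('u \<times> 'u) set \<times> 's) set" where
  "gr_set_of P act S s = gr_set_rel P act S `` {(\<one>\<^bsub>Gr P\<^esub>, s)}"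

section \<open>Partrees\<close>

definition finite_rooted_tree :: "'v set \<Rightarrow> 'v \<Rightarrow> ('v \<Rightarrow> 'v set) \<Rightarrow> bool" where
  "finite_rooted_tree V r ch \<longleftrightarrow> finite V \<and> r \<in> V \<and>
     (\<forall>x\<in>V. ch x \<subseteq> V - {r}) \<and>
     (\<forall>y\<in>V - {r}. \<exists>!x. x \<in> V \<and> y \<in> ch x) \<and>
     (\<forall>y\<in>V. (r, y) \<in> {(x, z). x \<in> V \<and> z \<in> ch x}\<^sup>*)"

record ('v, 's) partree =
  pt_verts :: "'v set"
  pt_root :: 'v
  pt_children :: "'v \<Rightarrow> 'v set"
  pt_label :: "'v \<Rightarrow> 's set"
  pt_chord :: "'v \<Rightarrow> 'v rel" \<comment> \<open>the partial order \<open>\<preceq>\<^sub>x\<close> on the children of \<open>x\<close>\<close>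
  pt_leq :: "'v \<Rightarrow> 's rel" \<comment> \<open>the preorder \<open>\<le>\<^sub>x\<close> on \<open>S\<^sub>x\<close>\<close>

definition partree_on :: "'s set \<Rightarrow> ('v, 's, 'z) partree_scheme \<Rightarrow> bool" where
  "partree_on S \<mu> \<longleftrightarrow>
     finite_rooted_tree (pt_verts \<mu>) (pt_root \<mu>) (pt_children \<mu>) \<and>
     (\<forall>x\<in>pt_verts \<mu>. partial_order_on (pt_children \<mu> x) (pt_chord \<mu> x)) \<and>
     (\<forall>x\<in>pt_verts \<mu>. total_preorder_on (pt_label \<mu> x) (pt_leq \<mu> x)) \<and>
     pt_label \<mu> (pt_root \<mu>) = S \<and>
     (\<forall>x\<in>pt_verts \<mu>. pt_children \<mu> x \<noteq> {} \<longrightarrow>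
        pt_label \<mu> x = (\<Union>y\<in>pt_children \<mu> x. pt_label \<mu> y) \<and>
        disjoint_family_on (pt_label \<mu>) (pt_children \<mu> x)) \<and>
     (\<forall>x\<in>pt_verts \<mu>. \<forall>s\<in>pt_label \<mu> x. \<forall>t\<in>pt_label \<mu> x.
        rel_equiv (pt_leq \<mu> x) s t \<longrightarrow>
        pt_children \<mu> x = {} \<or>
        (\<forall>y\<in>pt_children \<mu> x. \<forall>z\<in>pt_children \<mu> x. s \<in> pt_label \<mu> y \<and> t \<in> pt_label \<mu> z \<longrightarrow>
           (y, z) \<in> pt_chord \<mu> x \<or> (z, y) \<in> pt_chord \<mu> x))"

text \<open>\<open>xs = [x\<^sub>0, \<dots>, x\<^sub>k]\<close> is the maximal path from the root all of whose labels contain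
  both \<open>s\<close> and \<open>t\<close>.\<close>

definition common_path :: "('v, 's, 'z) partree_scheme \<Rightarrow> 's \<Rightarrow> 's \<Rightarrow> 'v list \<Rightarrow> bool" where
  "common_path \<mu> s t xs \<longleftrightarrow> xs \<noteq> [] \<and> hd xs = pt_root \<mu> \<and>
     (\<forall>i. Suc i < length xs \<longrightarrow> xs ! Suc i \<in> pt_children \<mu> (xs ! i)) \<and>
     (\<forall>x\<in>set xs. s \<in> pt_label \<mu> x \<and> t \<in> pt_label \<mu> x) \<and>
     (\<forall>y\<in>pt_children \<mu> (last xs). \<not> (s \<in> pt_label \<mu> y \<and> t \<in> pt_label \<mu> y))"

definition partree_preorder :: "('v, 's, 'z) partree_scheme \<Rightarrow> 's rel" where
  "partree_preorder \<mu> = {(s, t). \<exists>xs. common_path \<mu> s t xs \<and>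
     ((\<forall>x\<in>set xs. rel_equiv (pt_leq \<mu> x) s t) \<and>
        (pt_children \<mu> (last xs) = {} \<or>
         (\<exists>y\<in>pt_children \<mu> (last xs). \<exists>z\<in>pt_children \<mu> (last xs).
            s \<in> pt_label \<mu> y \<and> t \<in> pt_label \<mu> z \<and> rel_strict (pt_chord \<mu> (last xs)) y z))
      \<or> (\<exists>i<length xs. (\<forall>j<i. rel_equiv (pt_leq \<mu> (xs ! j)) s t) \<and>
            rel_strict (pt_leq \<mu> (xs ! i)) s t))}"

record ('v, 's, 'u) mpartree = "('v, 's) partree" +
  mp_mon :: "'v \<Rightarrow> 'u set" \<comment> \<open>the submonoid \<open>\<Pi>\<^sub>x\<close>\<close>
  mp_act :: "'v \<Rightarrow> 'u \<Rightarrow> 'v \<Rightarrow> 'v" \<comment> \<open>the action of \<open>\<Pi>\<^sub>x\<close> on the children of \<open>x\<close>\<close>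

abbreviation mon_at ::
  "('u, 'c) monoid_scheme \<Rightarrow> ('v, 's, 'u) mpartree \<Rightarrow> 'v \<Rightarrow> ('u, 'c) monoid_scheme" where
  "mon_at P \<mu> x \<equiv> restr P (mp_mon \<mu> x)"

definition monoid_partree ::
  "('u, 'c) monoid_scheme \<Rightarrow> ('u \<Rightarrow> 's \<Rightarrow> 's) \<Rightarrow> 's set \<Rightarrow> ('v, 's, 'u) mpartree \<Rightarrow> bool" where
  "monoid_partree P act S \<mu> \<longleftrightarrow>
     partree_on S \<mu> \<and>
     (\<forall>x\<in>pt_verts \<mu>. submonoid (mp_mon \<mu> x) P \<and> fg_monoid (mon_at P \<mu> x) \<and>
        good_action (mon_at P \<mu> x) (mp_act \<mu> x) (pt_children \<mu> x)) \<and>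
     mp_mon \<mu> (pt_root \<mu>) = carrier P \<and>
     (\<forall>x\<in>pt_verts \<mu>. \<forall>y\<in>pt_children \<mu> x.
        stabilizer (mon_at P \<mu> x) (mp_act \<mu> x) y = mp_mon \<mu> y) \<and>
     (\<forall>x\<in>pt_verts \<mu>. fg_action (mon_at P \<mu> x) act (pt_label \<mu> x) \<and>
        (\<forall>y\<in>pt_children \<mu> x. \<forall>u\<in>mp_mon \<mu> x.
           act u ` pt_label \<mu> y \<subseteq> pt_label \<mu> (mp_act \<mu> x u y))) \<and>
     (\<forall>x\<in>pt_verts \<mu>. \<exists>r.
        total_preorder_on (gr_set (mon_at P \<mu> x) act (pt_label \<mu> x)) r \<and>
        compatible_rel (Gr (mon_at P \<mu> x)) (gr_act (mon_at P \<mu> x) act (pt_label \<mu> x)) r \<and>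
        pt_leq \<mu> x =
          pullback_rel (gr_set_of (mon_at P \<mu> x) act (pt_label \<mu> x)) (pt_label \<mu> x) r) \<and>
     (\<forall>x\<in>pt_verts \<mu>. \<forall>y\<in>pt_children \<mu> x. \<forall>z\<in>pt_children \<mu> x. \<forall>u\<in>mp_mon \<mu> x.
        (y, z) \<in> pt_chord \<mu> x \<longrightarrow> (mp_act \<mu> x u y, mp_act \<mu> x u z) \<in> pt_chord \<mu> x) \<and>
     (\<forall>x\<in>pt_verts \<mu>. \<forall>y\<in>pt_children \<mu> x. \<forall>s\<in>pt_label \<mu> y. \<forall>t\<in>pt_label \<mu> y.
        (s, t) \<in> pt_leq \<mu> y \<longrightarrow> (s, t) \<in> pt_leq \<mu> x)"

section \<open>Preotrees and numerical data\<close>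

definition saturated :: "'g set \<Rightarrow> ('g, 'c) monoid_scheme \<Rightarrow> bool" where
  "saturated H G \<longleftrightarrow> subgroup H G \<and> (\<exists>X :: 'g set set. (G Mod H) \<cong> free_Abelian_group X)"

record ('w, 'g, 'm) preotree =
  po_verts :: "'w set"
  po_root :: 'w
  po_children :: "'w \<Rightarrow> 'w set"
  po_grp :: "'w \<Rightarrow> 'g set"
  po_set :: "'w \<Rightarrow> 'm set"

abbreviation grp_at ::
  "('g, 'c) monoid_scheme \<Rightarrow> ('w, 'g, 'm) preotree \<Rightarrow> 'w \<Rightarrow> ('g, 'c) monoid_scheme" where
  "grp_at G \<tau> v \<equiv> restr G (po_grp \<tau> v)"

definition preotree_on ::
  "('g, 'c) monoid_scheme \<Rightarrow> ('g \<Rightarrow> 'm \<Rightarrow> 'm) \<Rightarrow> 'm set \<Rightarrow> ('w, 'g, 'm) preotree \<Rightarrow> bool" where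
  "preotree_on G act M \<tau> \<longleftrightarrow>
     comm_group G \<and> (\<exists>A. finite A \<and> A \<subseteq> carrier G \<and> generate G A = carrier G) \<and>
     fg_action G act M \<and>
     finite_rooted_tree (po_verts \<tau>) (po_root \<tau>) (po_children \<tau>) \<and>
     (\<forall>v\<in>po_verts \<tau>. saturated (po_grp \<tau> v) G \<and> po_set \<tau> v \<subseteq> M \<and>
        (\<forall>u\<in>po_grp \<tau> v. act u ` po_set \<tau> v \<subseteq> po_set \<tau> v)) \<and>
     po_grp \<tau> (po_root \<tau>) = carrier G \<and> po_set \<tau> (po_root \<tau>) = M \<and>
     (\<forall>v\<in>po_verts \<tau>. \<forall>w\<in>po_children \<tau> v.
        po_set \<tau> w \<subseteq> po_set \<tau> v \<and> saturated (po_grp \<tau> w) (grp_at G \<tau> v) \<and>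
        (\<forall>s\<in>po_set \<tau> v. stabilizer (grp_at G \<tau> v) act s \<subseteq> po_grp \<tau> w)) \<and>
     (\<forall>v\<in>po_verts \<tau>. po_children \<tau> v \<noteq> {} \<longrightarrow>
        (\<exists>H. (\<forall>w\<in>po_children \<tau> v. po_grp \<tau> w = H) \<and>
           (\<forall>s\<in>po_set \<tau> v. \<exists>t\<in>po_set \<tau> v.
              (\<Union>w\<in>po_children \<tau> v. po_set \<tau> w) \<inter> orbit (grp_at G \<tau> v) act s =
              orbit (restr G H) act t)) \<and>
        disjoint_family_on (po_set \<tau>) (po_children \<tau> v))"

definition po_nonleaves :: "('w, 'g, 'm) preotree \<Rightarrow> 'w set" where
  "po_nonleaves \<tau> = {v \<in> po_verts \<tau>. po_children \<tau> v \<noteq> {}}"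

definition free_generators :: "('q, 'c) monoid_scheme \<Rightarrow> nat \<Rightarrow> (nat \<Rightarrow> 'q) \<Rightarrow> bool" where
  "free_generators Q n e \<longleftrightarrow> e ` {..<n} \<subseteq> carrier Q \<and>
     bij_betw (\<lambda>k :: nat \<Rightarrow> int. finprod Q (\<lambda>i. e i [^]\<^bsub>Q\<^esub> k i) {..<n})
       ({..<n} \<rightarrow>\<^sub>E UNIV) (carrier Q)"

definition free_rank :: "('q, 'c) monoid_scheme \<Rightarrow> nat" where
  "free_rank Q = (LEAST n. \<exists>e. free_generators Q n e)"

definition real_add_group :: "real monoid" where
  "real_add_group = \<lparr>carrier = UNIV, monoid.mult = (+), one = 0\<rparr>"

definition numerical_data ::
  "('g, 'c) monoid_scheme \<Rightarrow> ('g \<Rightarrow> 'm \<Rightarrow> 'm) \<Rightarrow> ('w, 'g, 'm) preotree \<Rightarrow>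
   ('w \<Rightarrow> 'g \<Rightarrow> real) \<Rightarrow> ('w \<Rightarrow> 'm \<Rightarrow> real) \<Rightarrow> bool" where
  "numerical_data G act \<tau> f g \<longleftrightarrow> (\<forall>v\<in>po_nonleaves \<tau>.
     f v \<in> hom (grp_at G \<tau> v) real_add_group \<and>
     (\<forall>u\<in>po_grp \<tau> v. \<forall>s\<in>po_set \<tau> v. g v (act u s) = f v u + g v s) \<and>
     (\<forall>w\<in>po_children \<tau> v. po_grp \<tau> w = kernel (grp_at G \<tau> v) real_add_group (f v) \<and>
        (\<exists>c. \<forall>s\<in>po_set \<tau> w. g v s = c)) \<and>
     (\<forall>w\<in>po_children \<tau> v. \<forall>w'\<in>po_children \<tau> v. w \<noteq> w' \<longrightarrow>
        (\<forall>s\<in>po_set \<tau> w. \<forall>t\<in>po_set \<tau> w'. g v s - g v t \<notin> f v ` po_grp \<tau> v)) \<and>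
     (\<forall>u0\<in>po_grp \<tau> v.
        (let K = kernel (grp_at G \<tau> v) real_add_group (f v) in
           free_generators (grp_at G \<tau> v Mod K) 1 (\<lambda>_. K #>\<^bsub>grp_at G \<tau> v\<^esub> u0)) \<longrightarrow>
        (\<forall>w\<in>po_children \<tau> v. \<forall>s\<in>po_set \<tau> w. g v s \<in> {0<..<\<bar>f v u0\<bar>})))"

text \<open>\<open>preotree_le \<tau> act f g v\<close> is the preorder on \<open>M\<^sub>v\<close> determined by the subtree rooted at \<open>v\<close>.
  Membership of both arguments in \<open>M\<^sub>w\<close> is implied by the recursive premise, and the choice of
  \<open>u\<close> does not matter.\<close>

inductive preotree_le ::
  "('w, 'g, 'm) preotree \<Rightarrow> ('g \<Rightarrow> 'm \<Rightarrow> 'm) \<Rightarrow> ('w \<Rightarrow> 'g \<Rightarrow> real) \<Rightarrow> ('w \<Rightarrow> 'm \<Rightarrow> real) \<Rightarrow>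
   'w \<Rightarrow> 'm \<Rightarrow> 'm \<Rightarrow> bool"
  for \<tau> act f g where
  leaf: "\<lbrakk>po_children \<tau> v = {}; s \<in> po_set \<tau> v; t \<in> po_set \<tau> v\<rbrakk> \<Longrightarrow> preotree_le \<tau> act f g v s t"
| less: "\<lbrakk>po_children \<tau> v \<noteq> {}; s \<in> po_set \<tau> v; t \<in> po_set \<tau> v; g v s < g v t\<rbrakk>
    \<Longrightarrow> preotree_le \<tau> act f g v s t"
| step: "\<lbrakk>s \<in> po_set \<tau> v; t \<in> po_set \<tau> v; g v s = g v t;
     u \<in> po_grp \<tau> v; w \<in> po_children \<tau> v; preotree_le \<tau> act f g w (act u s) (act u t)\<rbrakk>
    \<Longrightarrow> preotree_le \<tau> act f g v s t"

definition preotree_preorder ::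
  "('w, 'g, 'm) preotree \<Rightarrow> ('g \<Rightarrow> 'm \<Rightarrow> 'm) \<Rightarrow> ('w \<Rightarrow> 'g \<Rightarrow> real) \<Rightarrow> ('w \<Rightarrow> 'm \<Rightarrow> real) \<Rightarrow> 'm rel"
  where "preotree_preorder \<tau> act f g = {(s, t). preotree_le \<tau> act f g (po_root \<tau>) s t}"

section \<open>Irrational spaces and the space of numerical data\<close>

text \<open>Points of \<open>\<real>\<^sup>n\<close> are extensional functions on \<open>{..<n}\<close>.\<close>

definition irrational_space :: "nat \<Rightarrow> nat \<Rightarrow> ((nat \<Rightarrow> real) \<times> (nat \<Rightarrow> real)) set" where
  "irrational_space n m = {(a, b). a \<in> {..<n} \<rightarrow>\<^sub>E UNIV \<and> b \<in> {..<m} \<rightarrow>\<^sub>E UNIV \<and>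
     (\<forall>q :: nat \<Rightarrow> rat. (\<Sum>i<n. of_rat (q i) * a i) = 0 \<longrightarrow> (\<forall>i<n. q i = 0)) \<and>
     (\<forall>j<m. \<forall>l<m. j \<noteq> l \<longrightarrow> b j - b l \<notin> range (\<lambda>k :: nat \<Rightarrow> int. \<Sum>i<n. of_int (k i) * a i)) \<and>
     (n = 1 \<longrightarrow> (\<forall>j<m. b j \<in> {0<..<\<bar>a 0\<bar>}))}"

text \<open>The union is the common value of \<open>G\<^sub>w\<close> for the children \<open>w\<close> of \<open>v\<close>.\<close>

definition po_quotient ::
  "('g, 'c) monoid_scheme \<Rightarrow> ('w, 'g, 'm) preotree \<Rightarrow> 'w \<Rightarrow> 'g set monoid" where
  "po_quotient G \<tau> v = grp_at G \<tau> v Mod (\<Union>w\<in>po_children \<tau> v. po_grp \<tau> w)"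

definition po_dims :: "('g, 'c) monoid_scheme \<Rightarrow> ('w, 'g, 'm) preotree \<Rightarrow> 'w \<Rightarrow> nat \<times> nat" where
  "po_dims G \<tau> v = (free_rank (po_quotient G \<tau> v), card (po_children \<tau> v))"

definition data_space ::
  "('g, 'c) monoid_scheme \<Rightarrow> ('w, 'g, 'm) preotree \<Rightarrow>
   ('w \<Rightarrow> (nat \<Rightarrow> real) \<times> (nat \<Rightarrow> real)) set" where
  "data_space G \<tau> = (\<Pi>\<^sub>E v\<in>po_nonleaves \<tau>. case_prod irrational_space (po_dims G \<tau> v))"

text \<open>A choice of free generators \<open>gen v 0, gen v 1, \<dots>\<close> of \<open>G\<^sub>v/G\<^sub>w\<close> (they are cosets) and
  of an enumeration \<open>enum v 0, enum v 1, \<dots>\<close> of the children, for every non-leaf \<open>v\<close>.\<close>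

definition data_frame ::
  "('g, 'c) monoid_scheme \<Rightarrow> ('w, 'g, 'm) preotree \<Rightarrow>
   ('w \<Rightarrow> nat \<Rightarrow> 'g set) \<Rightarrow> ('w \<Rightarrow> nat \<Rightarrow> 'w) \<Rightarrow> bool" where
  "data_frame G \<tau> gen enum \<longleftrightarrow> (\<forall>v\<in>po_nonleaves \<tau>.
     free_generators (po_quotient G \<tau> v) (fst (po_dims G \<tau> v)) (gen v) \<and>
     bij_betw (enum v) {..<snd (po_dims G \<tau> v)} (po_children \<tau> v))"

text \<open>\<open>(f, g)\<close> is the numerical data encoded by the point \<open>q\<close>; for \<open>q\<close> in the data space it exists
  and is unique where it matters, that is, on the \<open>G\<^sub>v\<close> and, as every \<open>G\<^sub>v\<close>-orbit in
  \<open>M\<^sub>v\<close> meets some \<open>M\<^sub>w\<close>, on the \<open>M\<^sub>v\<close>.\<close>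

definition encoded_by ::
  "('g, 'c) monoid_scheme \<Rightarrow> ('g \<Rightarrow> 'm \<Rightarrow> 'm) \<Rightarrow> ('w, 'g, 'm) preotree \<Rightarrow>
   ('w \<Rightarrow> nat \<Rightarrow> 'g set) \<Rightarrow> ('w \<Rightarrow> nat \<Rightarrow> 'w) \<Rightarrow>
   ('w \<Rightarrow> (nat \<Rightarrow> real) \<times> (nat \<Rightarrow> real)) \<Rightarrow>
   ('w \<Rightarrow> 'g \<Rightarrow> real) \<Rightarrow> ('w \<Rightarrow> 'm \<Rightarrow> real) \<Rightarrow> bool" where
  "encoded_by G act \<tau> gen enum q f g \<longleftrightarrow> numerical_data G act \<tau> f g \<and>
     (\<forall>v\<in>po_nonleaves \<tau>.
        (\<forall>i<fst (po_dims G \<tau> v). \<forall>u\<in>gen v i. f v u = fst (q v) i) \<and>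
        (\<forall>j<snd (po_dims G \<tau> v). \<forall>s\<in>po_set \<tau> (enum v j). g v s = snd (q v) j))"

definition point_preorder ::
  "('g, 'c) monoid_scheme \<Rightarrow> ('g \<Rightarrow> 'm \<Rightarrow> 'm) \<Rightarrow> ('w, 'g, 'm) preotree \<Rightarrow>
   ('w \<Rightarrow> nat \<Rightarrow> 'g set) \<Rightarrow> ('w \<Rightarrow> nat \<Rightarrow> 'w) \<Rightarrow>
   ('w \<Rightarrow> (nat \<Rightarrow> real) \<times> (nat \<Rightarrow> real)) \<Rightarrow> 'm rel" where
  "point_preorder G act \<tau> gen enum q =
     {(s, t). \<exists>f g. encoded_by G act \<tau> gen enum q f g \<and> (s, t) \<in> preotree_preorder \<tau> act f g}"

section \<open>Semi-algebraic sets over the rationals\<close>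

text \<open>Real affine space with a finite set \<open>I\<close> of coordinates is \<open>I \<rightarrow>\<^sub>E UNIV\<close>, and
  polynomials in several variables are finitely supported maps from monomials to coefficients.\<close>

definition eval_mpoly :: "(('i \<Rightarrow>\<^sub>0 nat) \<Rightarrow>\<^sub>0 rat) \<Rightarrow> ('i \<Rightarrow> real) \<Rightarrow> real" where
  "eval_mpoly h x = (\<Sum>m\<in>Poly_Mapping.keys h. of_rat (Poly_Mapping.lookup h m) *
     (\<Prod>i\<in>Poly_Mapping.keys m. x i ^ Poly_Mapping.lookup m i))"

definition mpolys_in :: "'i set \<Rightarrow> (('i \<Rightarrow>\<^sub>0 nat) \<Rightarrow>\<^sub>0 rat) set" where
  "mpolys_in I = {h. \<forall>m\<in>Poly_Mapping.keys h. Poly_Mapping.keys m \<subseteq> I}"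

inductive_set semialgebraic_Q :: "'i set \<Rightarrow> ('i \<Rightarrow> real) set set" for I :: "'i set" where
  pos: "h \<in> mpolys_in I \<Longrightarrow> {x \<in> I \<rightarrow>\<^sub>E UNIV. eval_mpoly h x > 0} \<in> semialgebraic_Q I"
| zero: "h \<in> mpolys_in I \<Longrightarrow> {x \<in> I \<rightarrow>\<^sub>E UNIV. eval_mpoly h x = 0} \<in> semialgebraic_Q I"
| compl: "A \<in> semialgebraic_Q I \<Longrightarrow> (I \<rightarrow>\<^sub>E UNIV) - A \<in> semialgebraic_Q I"
| union: "\<lbrakk>A \<in> semialgebraic_Q I; B \<in> semialgebraic_Q I\<rbrakk> \<Longrightarrow> A \<union> B \<in> semialgebraic_Q I"

section \<open>The monoid partrees with varying numerical data\<close>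

text \<open>The preotree \<open>\<tau> x\<close> sits at the vertex \<open>x\<close> of the monoid partree \<open>\<mu>\<close>.\<close>

definition Gr_at :: "('u, 'c) monoid_scheme \<Rightarrow> ('v, 's, 'u) mpartree \<Rightarrow> 'v \<Rightarrow> ('u \<times> 'u) set monoid"
  where "Gr_at P \<mu> x = Gr (mon_at P \<mu> x)"

definition gr_set_at ::
  "('u, 'c) monoid_scheme \<Rightarrow> ('u \<Rightarrow> 's \<Rightarrow> 's) \<Rightarrow> ('v, 's, 'u) mpartree \<Rightarrow> 'v \<Rightarrow>
   (('u \<times> 'u) set \<times> 's) set set"
  where "gr_set_at P act \<mu> x = gr_set (mon_at P \<mu> x) act (pt_label \<mu> x)"

definition gr_act_at ::
  "('u, 'c) monoid_scheme \<Rightarrow> ('u \<Rightarrow> 's \<Rightarrow> 's) \<Rightarrow> ('v, 's, 'u) mpartree \<Rightarrow> 'v \<Rightarrow>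
   ('u \<times> 'u) set \<Rightarrow> (('u \<times> 'u) set \<times> 's) set \<Rightarrow> (('u \<times> 'u) set \<times> 's) set"
  where "gr_act_at P act \<mu> x = gr_act (mon_at P \<mu> x) act (pt_label \<mu> x)"

definition pullback_at ::
  "('u, 'c) monoid_scheme \<Rightarrow> ('u \<Rightarrow> 's \<Rightarrow> 's) \<Rightarrow> ('v, 's, 'u) mpartree \<Rightarrow> 'v \<Rightarrow>
   (('u \<times> 'u) set \<times> 's) set rel \<Rightarrow> 's rel"
  where "pullback_at P act \<mu> x r =
    pullback_rel (gr_set_of (mon_at P \<mu> x) act (pt_label \<mu> x)) (pt_label \<mu> x) r"

text \<open>\<open>\<tau> x\<close> is a preotree from which \<open>\<le>\<^sub>x\<close> arises for suitable numerical data.\<close>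

definition corresponding_preotree ::
  "('u, 'c) monoid_scheme \<Rightarrow> ('u \<Rightarrow> 's \<Rightarrow> 's) \<Rightarrow> ('v, 's, 'u) mpartree \<Rightarrow> 'v \<Rightarrow>
   ('w, ('u \<times> 'u) set, (('u \<times> 'u) set \<times> 's) set) preotree \<Rightarrow> bool" where
  "corresponding_preotree P act \<mu> x \<tau> \<longleftrightarrow>
     preotree_on (Gr_at P \<mu> x) (gr_act_at P act \<mu> x) (gr_set_at P act \<mu> x) \<tau> \<and>
     (\<exists>f g. numerical_data (Gr_at P \<mu> x) (gr_act_at P act \<mu> x) \<tau> f g \<and>
        pt_leq \<mu> x = pullback_at P act \<mu> x (preotree_preorder \<tau> (gr_act_at P act \<mu> x) f g))"

type_synonym ('v, 'w) data_point = "'v \<Rightarrow> 'w \<Rightarrow> (nat \<Rightarrow> real) \<times> (nat \<Rightarrow> real)"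

definition total_data_space ::
  "('u, 'c) monoid_scheme \<Rightarrow> ('v, 's, 'u) mpartree \<Rightarrow>
   ('v \<Rightarrow> ('w, ('u \<times> 'u) set, (('u \<times> 'u) set \<times> 's) set) preotree) \<Rightarrow> ('v, 'w) data_point set" where
  "total_data_space P \<mu> \<tau> = (\<Pi>\<^sub>E x\<in>pt_verts \<mu>. data_space (Gr_at P \<mu> x) (\<tau> x))"

definition partree_at_point ::
  "('u, 'c) monoid_scheme \<Rightarrow> ('u \<Rightarrow> 's \<Rightarrow> 's) \<Rightarrow> ('v, 's, 'u) mpartree \<Rightarrow>
   ('v \<Rightarrow> ('w, ('u \<times> 'u) set, (('u \<times> 'u) set \<times> 's) set) preotree) \<Rightarrow>
   ('v \<Rightarrow> 'w \<Rightarrow> nat \<Rightarrow> ('u \<times> 'u) set set) \<Rightarrow> ('v \<Rightarrow> 'w \<Rightarrow> nat \<Rightarrow> 'w) \<Rightarrow>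
   ('v, 'w) data_point \<Rightarrow> ('v, 's, 'u) mpartree" where
  "partree_at_point P act \<mu> \<tau> gen enum p = \<mu>\<lparr>pt_leq := (\<lambda>x. pullback_at P act \<mu> x
     (point_preorder (Gr_at P \<mu> x) (gr_act_at P act \<mu> x) (\<tau> x) (gen x) (enum x) (p x)))\<rparr>"

text \<open>The coordinates of the real affine space containing the total space of numerical data:
  \<open>(x, v, Inl i)\<close> for \<open>a\<^sub>i\<close> and \<open>(x, v, Inr j)\<close> for \<open>b\<^sub>j\<close> at the non-leaf \<open>v\<close> of \<open>\<tau> x\<close>.\<close>

definition data_coords ::
  "('u, 'c) monoid_scheme \<Rightarrow> ('v, 's, 'u) mpartree \<Rightarrow>
   ('v \<Rightarrow> ('w, ('u \<times> 'u) set, (('u \<times> 'u) set \<times> 's) set) preotree) \<Rightarrow>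
   ('v \<times> 'w \<times> (nat + nat)) set" where
  "data_coords P \<mu> \<tau> = (SIGMA x : pt_verts \<mu>. SIGMA v : po_nonleaves (\<tau> x).
     {..<fst (po_dims (Gr_at P \<mu> x) (\<tau> x) v)} <+> {..<snd (po_dims (Gr_at P \<mu> x) (\<tau> x) v)})"

definition flatten_point :: "('v, 'w) data_point \<Rightarrow> 'v \<times> 'w \<times> (nat + nat) \<Rightarrow> real" where
  "flatten_point p = (\<lambda>(x, v, c). case c of Inl i \<Rightarrow> fst (p x v) i | Inr j \<Rightarrow> snd (p x v) j)"

definition semialgebraic_Q_in_data_space ::
  "('u, 'c) monoid_scheme \<Rightarrow> ('v, 's, 'u) mpartree \<Rightarrow>
   ('v \<Rightarrow> ('w, ('u \<times> 'u) set, (('u \<times> 'u) set \<times> 's) set) preotree) \<Rightarrow>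
   ('v, 'w) data_point set \<Rightarrow> bool" where
  "semialgebraic_Q_in_data_space P \<mu> \<tau> Z \<longleftrightarrow>
     (\<exists>A\<in>semialgebraic_Q (data_coords P \<mu> \<tau>).
        Z = {p \<in> total_data_space P \<mu> \<tau>. restrict (flatten_point p) (data_coords P \<mu> \<tau>) \<in> A})"

end

theory Submission
  imports Defs "HOL-Analysis.Kronecker_Approximation_Theorem"
begin

text \<open>
  Since every \<open>\<Pi>\<^sub>x\<close> is a face of \<open>\<Pi>\<close> (the actions on children are good), Dickson's lemma
  parametrises pairs of elements of \<open>S\<close> by finitely many families indexed by tuples \<open>N\<close> of natural
  numbers, in such a way that the position of the elements in the tree is constant along each family.
  A comparison of two members of a family for a preorder given by a preotree is a Boolean combination
  of signs of real forms that are affine in \<open>N\<close> with coefficients depending polynomially on the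
  point \<open>p\<close>, and by the irrationality conditions the zero set of each form is cut out by integer
  equations independent of \<open>p\<close>. So \<open>\<Gamma>\<close> is a finite intersection of loci where a system of strict
  inequalities, affine in \<open>N\<close>, has no integer solution.

  Such a locus is a countable union of semi-algebraic sets. If the open polyhedron of real solutions
  is bounded, being contained in a fixed box and missing its integer points is a semi-algebraic
  condition by Fourier-Motzkin elimination. Otherwise there is a recession direction \<open>r\<close>; after an
  integral change of coordinates its nonzero entries are linearly independent over the rationals, and
  Kronecker's theorem shows that the polyhedron stays free of integer points when it is extended along
  a coordinate axis. Eliminating that coordinate reduces the number of variables.
\<close>

section \<open>Countable unions of semi-algebraic sets and Fourier-Motzkin elimination\<close>

text \<open>The Kronecker step perturbs a real solution slightly before it becomes integral, so it
  tolerates open conditions only. Every comparison and its negation must therefore be unions of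
  strict systems, and this is why the zero sets of the forms have to be described by integer
  equations. Countability comes from two choices that depend on the point without a bound: the size
  of the box, and the list of elementary integer operations that makes the nonzero entries of a
  recession direction independent. Everything else is a finite case distinction. The position of two
  elements in the tree decides which preorders enter their comparison. Since acting by
  \<open>u\<close> may change the position, the families fix the positions of \<open>s\<close> and
  of \<open>act u s\<close> at once; as they depend on \<open>u\<close>, compatibility is tested on
  finitely many generators. At an arbitrary point of the data space, the only axiom of a monoid
  partree that can fail is the implication from the preorder at a child to the preorder at its
  parent: the equivalence attached to a preotree does not change with the numerical data, so the
  condition on comparable children persists.\<close>

definition poly_fun :: "'i set \<Rightarrow> (('i \<Rightarrow> real) \<Rightarrow> real) \<Rightarrow> bool" where
  "poly_fun I f \<longleftrightarrow> (\<exists>h\<in>mpolys_in I. \<forall>x. f x = eval_mpoly h x)"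

definition monom_val :: "('i \<Rightarrow>\<^sub>0 nat) \<Rightarrow> ('i \<Rightarrow> real) \<Rightarrow> real" where
  "monom_val m x = (\<Prod>i\<in>Poly_Mapping.keys m. x i ^ Poly_Mapping.lookup m i)"

text \<open>Indices outside the support contribute a factor one, so two monomials can be evaluated
  over a common index set without comparing their supports.\<close>

lemma monom_val_superset:
  assumes "finite A" "Poly_Mapping.keys m \<subseteq> A"
  shows "monom_val m x = (\<Prod>i\<in>A. x i ^ Poly_Mapping.lookup m i)"
  unfolding monom_val_def
  by (rule prod.mono_neutral_left[OF assms]) (auto simp: in_keys_iff)

lemma monom_val_add: "monom_val (m + m') x = monom_val m x * monom_val m' x"
proof -
  let ?A = "Poly_Mapping.keys m \<union> Poly_Mapping.keys m'"
  have "Poly_Mapping.keys (m + m') \<subseteq> ?A" by (rule keys_add)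
  then show ?thesis
    by (simp add: monom_val_superset[of ?A] lookup_add power_add prod.distrib)
qed

lemma eval_mpoly_superset:
  assumes "finite A" "Poly_Mapping.keys h \<subseteq> A"
  shows "eval_mpoly h x = (\<Sum>m\<in>A. of_rat (Poly_Mapping.lookup h m) * monom_val m x)"
  unfolding eval_mpoly_def monom_val_def
  by (rule sum.mono_neutral_left[OF assms]) (auto simp: in_keys_iff)

lemma eval_mpoly_add: "eval_mpoly (h + h') x = eval_mpoly h x + eval_mpoly h' x"
proof -
  let ?A = "Poly_Mapping.keys h \<union> Poly_Mapping.keys h'"
  have "Poly_Mapping.keys (h + h') \<subseteq> ?A" by (rule keys_add)
  then show ?thesis
    by (simp add: eval_mpoly_superset[of ?A] lookup_add of_rat_add distrib_right sum.distrib)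
qed

lemma poly_fun_monom:
  assumes "Poly_Mapping.keys m \<subseteq> I"
  shows "poly_fun I (\<lambda>x. of_rat q * monom_val m x)"
proof -
  have "eval_mpoly (Poly_Mapping.single m q) x = of_rat q * monom_val m x" for x
    by (subst eval_mpoly_superset[of "{m}"]) auto
  moreover have "Poly_Mapping.single m q \<in> mpolys_in I"
    using assms by (auto simp: mpolys_in_def split: if_splits)
  ultimately show ?thesis unfolding poly_fun_def by metis
qed

lemma poly_fun_of_rat: "poly_fun I (\<lambda>x. of_rat q)"
  using poly_fun_monom[of 0 I q] by (simp add: monom_val_def)

lemma poly_fun_of_int: "poly_fun I (\<lambda>x. of_int q)"
  using poly_fun_of_rat[of I "of_int q"] by simp

lemma poly_fun_coord:
  assumes "i \<in> I" shows "poly_fun I (\<lambda>x. x i)"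
  using poly_fun_monom[of "Poly_Mapping.single i 1" I 1] assms by (simp add: monom_val_def)

lemma poly_fun_add:
  assumes "poly_fun I f" "poly_fun I g"
  shows "poly_fun I (\<lambda>x. f x + g x)"
proof -
  obtain h h' where "h \<in> mpolys_in I" "h' \<in> mpolys_in I"
    "\<And>x. f x = eval_mpoly h x" "\<And>x. g x = eval_mpoly h' x"
    using assms unfolding poly_fun_def by blast
  moreover have "h + h' \<in> mpolys_in I"
    using calculation(1,2) keys_add[of h h'] unfolding mpolys_in_def by blast
  ultimately show ?thesis unfolding poly_fun_def by (metis eval_mpoly_add)
qed

lemma poly_fun_sum:
  assumes "\<And>a. a \<in> A \<Longrightarrow> poly_fun I (f a)"
  shows "poly_fun I (\<lambda>x. \<Sum>a\<in>A. f a x)"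
  using assms
proof (induction A rule: infinite_finite_induct)
  case (insert a A)
  then show ?case using poly_fun_add[of I "f a"] by simp
qed (use poly_fun_of_rat[of I 0] in auto)

text \<open>The product of the values is expanded over pairs of monomials, each pair being a
  monomial again; the product of the representing finitely supported maps is never formed.\<close>

lemma poly_fun_mult:
  assumes "poly_fun I f" "poly_fun I g"
  shows "poly_fun I (\<lambda>x. f x * g x)"
proof -
  obtain h h' where h: "h \<in> mpolys_in I" "h' \<in> mpolys_in I"
    "\<And>x. f x = eval_mpoly h x" "\<And>x. g x = eval_mpoly h' x"
    using assms unfolding poly_fun_def by blast
  have "f x * g x = (\<Sum>m\<in>Poly_Mapping.keys h. \<Sum>m'\<in>Poly_Mapping.keys h'.
      of_rat (Poly_Mapping.lookup h m * Poly_Mapping.lookup h' m') * monom_val (m + m') x)" for x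
    unfolding h(3,4) eval_mpoly_def monom_val_def[symmetric] sum_product
    by (simp add: monom_val_add of_rat_mult mult_ac)
  moreover have "poly_fun I (\<lambda>x. \<Sum>m\<in>Poly_Mapping.keys h. \<Sum>m'\<in>Poly_Mapping.keys h'.
      of_rat (Poly_Mapping.lookup h m * Poly_Mapping.lookup h' m') * monom_val (m + m') x)"
  proof (intro poly_fun_sum poly_fun_monom)
    fix m m' assume "m \<in> Poly_Mapping.keys h" "m' \<in> Poly_Mapping.keys h'"
    then have "Poly_Mapping.keys m \<subseteq> I" "Poly_Mapping.keys m' \<subseteq> I"
      using h(1,2) unfolding mpolys_in_def by simp_all
    then show "Poly_Mapping.keys (m + m') \<subseteq> I" using keys_add[of m m'] by (meson Un_least order_trans)
  qed
  ultimately show ?thesis by presburger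
qed

lemma poly_fun_uminus:
  assumes "poly_fun I f" shows "poly_fun I (\<lambda>x. - f x)"
  using poly_fun_mult[OF poly_fun_of_int[of I "-1"] assms] by simp

lemma poly_fun_diff:
  assumes "poly_fun I f" "poly_fun I g" shows "poly_fun I (\<lambda>x. f x - g x)"
  using poly_fun_add[OF assms(1) poly_fun_uminus[OF assms(2)]] by simp

lemmas poly_fun_intros = poly_fun_of_int poly_fun_coord poly_fun_add poly_fun_mult poly_fun_uminus
  poly_fun_diff poly_fun_sum

section \<open>Boolean operations on semi-algebraic sets\<close>

abbreviation aff_space :: "'i set \<Rightarrow> ('i \<Rightarrow> real) set" where
  "aff_space I \<equiv> I \<rightarrow>\<^sub>E UNIV"

lemma semialgebraic_Q_subset: "A \<in> semialgebraic_Q I \<Longrightarrow> A \<subseteq> aff_space I"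
  by (induction rule: semialgebraic_Q.induct) auto

lemma semialgebraic_Q_pos:
  assumes "poly_fun I f" shows "{x \<in> aff_space I. f x > 0} \<in> semialgebraic_Q I"
  using assms semialgebraic_Q.pos[of _ I] unfolding poly_fun_def by auto

lemma semialgebraic_Q_zero:
  assumes "poly_fun I f" shows "{x \<in> aff_space I. f x = 0} \<in> semialgebraic_Q I"
  using assms semialgebraic_Q.zero[of _ I] unfolding poly_fun_def by auto

lemma semialgebraic_Q_space: "aff_space I \<in> semialgebraic_Q I"
  using semialgebraic_Q_zero[OF poly_fun_of_int[of I 0]] by simp

lemma semialgebraic_Q_empty: "{} \<in> semialgebraic_Q I"
  using semialgebraic_Q.compl[OF semialgebraic_Q_space[of I]] by simp

lemma semialgebraic_Q_Int:
  assumes "A \<in> semialgebraic_Q I" "B \<in> semialgebraic_Q I"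
  shows "A \<inter> B \<in> semialgebraic_Q I"
proof -
  have "A \<inter> B = aff_space I - ((aff_space I - A) \<union> (aff_space I - B))"
    using assms[THEN semialgebraic_Q_subset] by blast
  then show ?thesis
    using assms by (simp add: semialgebraic_Q.compl semialgebraic_Q.union)
qed

lemma semialgebraic_Q_UN:
  assumes "finite A" "\<And>a. a \<in> A \<Longrightarrow> B a \<in> semialgebraic_Q I"
  shows "(\<Union>a\<in>A. B a) \<in> semialgebraic_Q I"
  using assms by (induction A) (auto simp: semialgebraic_Q_empty semialgebraic_Q.union)

lemma semialgebraic_Q_ball:
  assumes "finite A" "\<And>a. a \<in> A \<Longrightarrow> {x \<in> aff_space I. Q a x} \<in> semialgebraic_Q I"
  shows "{x \<in> aff_space I. \<forall>a\<in>A. Q a x} \<in> semialgebraic_Q I"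
  using assms
proof (induction A)
  case empty
  then show ?case by (simp add: semialgebraic_Q_space)
next
  case (insert a A)
  have "{x \<in> aff_space I. \<forall>a\<in>insert a A. Q a x} =
      {x \<in> aff_space I. Q a x} \<inter> {x \<in> aff_space I. \<forall>a\<in>A. Q a x}" by auto
  then show ?case using insert by (simp add: semialgebraic_Q_Int)
qed

lemma semialgebraic_Q_conj:
  assumes "{x \<in> aff_space I. Q x} \<in> semialgebraic_Q I" "{x \<in> aff_space I. R x} \<in> semialgebraic_Q I"
  shows "{x \<in> aff_space I. Q x \<and> R x} \<in> semialgebraic_Q I"
proof -
  have "{x \<in> aff_space I. Q x \<and> R x} = {x \<in> aff_space I. Q x} \<inter> {x \<in> aff_space I. R x}" by auto
  then show ?thesis using semialgebraic_Q_Int[OF assms] by simp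
qed

lemma semialgebraic_Q_not:
  assumes "{x \<in> aff_space I. Q x} \<in> semialgebraic_Q I"
  shows "{x \<in> aff_space I. \<not> Q x} \<in> semialgebraic_Q I"
proof -
  have "{x \<in> aff_space I. \<not> Q x} = aff_space I - {x \<in> aff_space I. Q x}" by auto
  then show ?thesis using semialgebraic_Q.compl[OF assms] by simp
qed

section \<open>Countable unions of semi-algebraic sets\<close>

definition sigma_semialg :: "'i set \<Rightarrow> ('i \<Rightarrow> real) set \<Rightarrow> bool" where
  "sigma_semialg I A \<longleftrightarrow> (\<exists>F. countable F \<and> F \<subseteq> semialgebraic_Q I \<and> A = \<Union>F)"

lemma sigma_semialg_base: "A \<in> semialgebraic_Q I \<Longrightarrow> sigma_semialg I A"
  unfolding sigma_semialg_def by (intro exI[of _ "{A}"]) auto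

lemma sigma_semialg_UN:
  assumes "countable A" "\<And>a. a \<in> A \<Longrightarrow> sigma_semialg I (B a)"
  shows "sigma_semialg I (\<Union>a\<in>A. B a)"
proof -
  obtain F where F: "\<And>a. a \<in> A \<Longrightarrow> countable (F a) \<and> F a \<subseteq> semialgebraic_Q I \<and> B a = \<Union>(F a)"
    using assms(2) unfolding sigma_semialg_def by metis
  show ?thesis
    unfolding sigma_semialg_def
    by (rule exI[of _ "\<Union>a\<in>A. F a"]) (use F assms(1) in auto)
qed

lemma sigma_semialg_Un:
  assumes "sigma_semialg I A" "sigma_semialg I B"
  shows "sigma_semialg I (A \<union> B)"
  using sigma_semialg_UN[of "UNIV :: bool set" I "\<lambda>b. if b then A else B"] assms
  by (simp add: UNIV_bool Un_commute)

lemma sigma_semialg_Int: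
  assumes "sigma_semialg I A" "sigma_semialg I B"
  shows "sigma_semialg I (A \<inter> B)"
proof -
  obtain F G where FG: "countable F" "F \<subseteq> semialgebraic_Q I" "A = \<Union>F"
    "countable G" "G \<subseteq> semialgebraic_Q I" "B = \<Union>G"
    using assms unfolding sigma_semialg_def by blast
  have "A \<inter> B = (\<Union>X\<in>F. \<Union>Y\<in>G. X \<inter> Y)" unfolding FG by blast
  moreover have "sigma_semialg I \<dots>"
    using FG by (intro sigma_semialg_UN sigma_semialg_base semialgebraic_Q_Int) auto
  ultimately show ?thesis by simp
qed

lemma sigma_semialg_ball:
  assumes "finite A" "\<And>a. a \<in> A \<Longrightarrow> sigma_semialg I {x \<in> aff_space I. Q a x}"
  shows "sigma_semialg I {x \<in> aff_space I. \<forall>a\<in>A. Q a x}"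
  using assms
proof (induction A)
  case empty
  then show ?case by (simp add: sigma_semialg_base semialgebraic_Q_space)
next
  case (insert a A)
  have "{x \<in> aff_space I. \<forall>a\<in>insert a A. Q a x} =
      {x \<in> aff_space I. Q a x} \<inter> {x \<in> aff_space I. \<forall>a\<in>A. Q a x}" by auto
  then show ?case using insert by (simp add: sigma_semialg_Int)
qed

section \<open>Strict affine systems with parameters, and the elimination of one variable\<close>

type_synonym 'p pform = "(nat \<Rightarrow> 'p \<Rightarrow> real) \<times> ('p \<Rightarrow> real)"

definition pf_val :: "nat set \<Rightarrow> 'p pform \<Rightarrow> 'p \<Rightarrow> (nat \<Rightarrow> real) \<Rightarrow> real" where
  "pf_val V \<phi> p y = (\<Sum>k\<in>V. fst \<phi> k p * y k) + snd \<phi> p"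

definition sat :: "nat set \<Rightarrow> 'p pform set \<Rightarrow> 'p \<Rightarrow> (nat \<Rightarrow> real) \<Rightarrow> bool" where
  "sat V F p y \<longleftrightarrow> (\<forall>\<phi>\<in>F. pf_val V \<phi> p y > 0)"

definition int_free :: "nat set \<Rightarrow> 'p pform set \<Rightarrow> 'p \<Rightarrow> bool" where
  "int_free V F p \<longleftrightarrow> (\<forall>N :: nat \<Rightarrow> int. \<not> sat V F p (\<lambda>k. of_int (N k)))"

definition poly_form :: "'i set \<Rightarrow> nat set \<Rightarrow> ('i \<Rightarrow> real) pform \<Rightarrow> bool" where
  "poly_form I V \<phi> \<longleftrightarrow> (\<forall>k\<in>V. poly_fun I (fst \<phi> k)) \<and> poly_fun I (snd \<phi>)"

text \<open>The combination of the two forms in which the variable \<open>j\<close> cancels. It is a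
  positive combination when the coefficient of \<open>j\<close> is positive in \<open>f\<close> and
  negative in \<open>g\<close>.\<close>

definition fm_comb :: "nat \<Rightarrow> 'p pform \<Rightarrow> 'p pform \<Rightarrow> 'p pform" where
  "fm_comb j f g = (\<lambda>k p. fst f j p * fst g k p - fst g j p * fst f k p,
     \<lambda>p. fst f j p * snd g p - fst g j p * snd f p)"

text \<open>\<open>Z\<close> and \<open>Q\<close> are meant to be the forms whose coefficient at
  \<open>j\<close> is zero or positive. They are separate arguments because the sign pattern depends
  on the point, whereas the eliminated system has to be one fixed set of coefficient
  functions.\<close>

definition fm_elim :: "nat \<Rightarrow> 'p pform set \<Rightarrow> 'p pform set \<Rightarrow> 'p pform set \<Rightarrow> 'p pform set" where
  "fm_elim j F Z Q = Z \<union> case_prod (fm_comb j) ` (Q \<times> (F - Z - Q))"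

lemma pf_val_cong: "(\<And>k. k \<in> V \<Longrightarrow> y k = y' k) \<Longrightarrow> pf_val V \<phi> p y = pf_val V \<phi> p y'"
  unfolding pf_val_def by simp

lemma sat_cong: "(\<And>k. k \<in> V \<Longrightarrow> y k = y' k) \<Longrightarrow> sat V F p y \<longleftrightarrow> sat V F p y'"
  unfolding sat_def by (simp add: pf_val_cong[of V y y'])

lemma pf_val_upd:
  assumes "finite V" "j \<in> V"
  shows "pf_val V \<phi> p (y(j := x)) = fst \<phi> j p * x + pf_val (V - {j}) \<phi> p y"
proof -
  have "(\<Sum>k\<in>V - {j}. fst \<phi> k p * (y(j := x)) k) = (\<Sum>k\<in>V - {j}. fst \<phi> k p * y k)"
    by (intro sum.cong) auto
  then show ?thesis unfolding pf_val_def using assms by (simp add: sum.remove)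
qed

lemma pf_val_fm_comb:
  "pf_val V (fm_comb j f g) p y = fst f j p * pf_val V g p y - fst g j p * pf_val V f p y"
  unfolding pf_val_def fm_comb_def
  by (simp add: algebra_simps sum_subtractf sum_distrib_left)

text \<open>The interval of admissible \<open>x\<close> is bounded by the quotients \<open>- b \<phi> / a \<phi>\<close>.\<close>

lemma strict_system_one_variable:
  fixes a b :: "'f \<Rightarrow> real"
  assumes "finite F"
  shows "(\<exists>x. \<forall>\<phi>\<in>F. a \<phi> * x + b \<phi> > 0) \<longleftrightarrow>
    (\<forall>\<phi>\<in>F. a \<phi> = 0 \<longrightarrow> b \<phi> > 0) \<and>
    (\<forall>\<phi>\<in>F. \<forall>\<psi>\<in>F. a \<phi> > 0 \<and> a \<psi> < 0 \<longrightarrow> a \<phi> * b \<psi> - a \<psi> * b \<phi> > 0)" (is "?L \<longleftrightarrow> ?R")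
proof
  assume ?L
  then obtain x where x: "\<And>\<phi>. \<phi> \<in> F \<Longrightarrow> a \<phi> * x + b \<phi> > 0" by blast
  have "a \<phi> * b \<psi> - a \<psi> * b \<phi> > 0" if "\<phi> \<in> F" "\<psi> \<in> F" "a \<phi> > 0" "a \<psi> < 0" for \<phi> \<psi>
  proof -
    have "a \<phi> * (a \<psi> * x + b \<psi>) > 0" "a \<psi> * (a \<phi> * x + b \<phi>) < 0"
      using x that by (auto simp: mult_neg_pos)
    then show ?thesis by (simp add: algebra_simps)
  qed
  moreover have "b \<phi> > 0" if "\<phi> \<in> F" "a \<phi> = 0" for \<phi> using x[OF that(1)] that(2) by simp
  ultimately show ?R by blast
next
  assume R: ?R
  let ?L = "(\<lambda>\<phi>. - b \<phi> / a \<phi>) ` {\<phi>\<in>F. a \<phi> > 0}" and ?U = "(\<lambda>\<phi>. - b \<phi> / a \<phi>) ` {\<phi>\<in>F. a \<phi> < 0}"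
  have fin: "finite ?L" "finite ?U" using assms by auto
  have lu: "l < u" if "l \<in> ?L" "u \<in> ?U" for l u
    using that R by (auto simp: field_simps)
  have "\<exists>x. (\<forall>l\<in>?L. l < x) \<and> (\<forall>u\<in>?U. x < u)"
  proof (cases "?L = {}")
    case L0: True
    show ?thesis
    proof (cases "?U = {}")
      case False
      have "\<forall>u\<in>?U. Min ?U - 1 < u"
      proof
        fix u assume "u \<in> ?U"
        then show "Min ?U - 1 < u" using Min_le[OF fin(2)] by fastforce
      qed
      then show ?thesis unfolding L0 by (intro exI[of _ "Min ?U - 1"]) simp
    next
      case True
      show ?thesis unfolding L0 True by simp
    qed
  next
    case L: False
    show ?thesis
    proof (cases "?U = {}")
      case True
      have "\<forall>l\<in>?L. l < Max ?L + 1"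
      proof
        fix l assume "l \<in> ?L"
        then show "l < Max ?L + 1" using Max_ge[OF fin(1)] by fastforce
      qed
      then show ?thesis unfolding True by (intro exI[of _ "Max ?L + 1"]) simp
    next
      case False
      have "Max ?L < Min ?U" using lu Max_in[OF fin(1) L] Min_in[OF fin(2) False] by blast
      then obtain x where x: "Max ?L < x" "x < Min ?U" using dense by blast
      show ?thesis
      proof (intro exI[of _ x] conjI ballI)
        show "l < x" if "l \<in> ?L" for l using Max_ge[OF fin(1) that] x(1) by linarith
        show "x < u" if "u \<in> ?U" for u using Min_le[OF fin(2) that] x(2) by linarith
      qed
    qed
  qed
  then obtain x where "(\<forall>l\<in>?L. l < x) \<and> (\<forall>u\<in>?U. x < u)" ..
  note x = conjunct1[OF this] conjunct2[OF this]
  have "a \<phi> * x + b \<phi> > 0" if "\<phi> \<in> F" for \<phi>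
  proof -
    consider "a \<phi> = 0" | "a \<phi> > 0" | "a \<phi> < 0" by linarith
    then show ?thesis
    proof cases
      case 1 then show ?thesis using R that by simp
    next
      case 2
      then have "- b \<phi> / a \<phi> < x" using x(1) that by simp
      then show ?thesis using 2 by (simp add: field_simps)
    next
      case 3
      then have "x < - b \<phi> / a \<phi>" using x(2) that by simp
      then show ?thesis using 3 by (simp add: field_simps)
    qed
  qed
  then show "\<exists>x. \<forall>\<phi>\<in>F. a \<phi> * x + b \<phi> > 0" by blast
qed

text \<open>With the remaining coordinates frozen in \<open>y\<close>, this is the criterion for one
  real variable.\<close>

lemma fm_elim_correct:
  assumes "finite V" "j \<in> V" "finite F"
    and "Z = {\<phi>\<in>F. fst \<phi> j p = 0}" "Q = {\<phi>\<in>F. fst \<phi> j p > 0}"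
  shows "(\<exists>x. sat V F p (y(j := x))) \<longleftrightarrow> sat (V - {j}) (fm_elim j F Z Q) p y"
proof -
  have "F - Z - Q = {\<phi>\<in>F. fst \<phi> j p < 0}" unfolding assms(4,5) by auto
  moreover have "sat (V - {j}) (fm_elim j F Z Q) p y \<longleftrightarrow> (\<forall>\<phi>\<in>Z. 0 < pf_val (V - {j}) \<phi> p y) \<and>
      (\<forall>\<phi>\<in>Q. \<forall>\<psi>\<in>F - Z - Q. 0 < pf_val (V - {j}) (fm_comb j \<phi> \<psi>) p y)"
    unfolding sat_def fm_elim_def ball_Un ball_simps(9) split_paired_Ball_Sigma prod.case ..
  ultimately have "sat (V - {j}) (fm_elim j F Z Q) p y \<longleftrightarrow>
      (\<forall>\<phi>\<in>F. fst \<phi> j p = 0 \<longrightarrow> 0 < pf_val (V - {j}) \<phi> p y) \<and>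
      (\<forall>\<phi>\<in>F. \<forall>\<psi>\<in>F. fst \<phi> j p > 0 \<and> fst \<psi> j p < 0 \<longrightarrow> 0 < pf_val (V - {j}) (fm_comb j \<phi> \<psi>) p y)"
    unfolding assms(4,5) by (simp only: mem_Collect_eq Ball_def) (iprover)
  then show ?thesis
    unfolding sat_def pf_val_upd[OF assms(1,2)] strict_system_one_variable[OF assms(3)] pf_val_fm_comb
    by simp
qed

definition fm_cond :: "'i set \<Rightarrow> nat \<Rightarrow> ('i \<Rightarrow> real) pform set \<Rightarrow> ('i \<Rightarrow> real) pform set \<Rightarrow>
    ('i \<Rightarrow> real) pform set \<Rightarrow> ('i \<Rightarrow> real) set" where
  "fm_cond I j F Z Q = {p \<in> aff_space I. Z = {\<phi>\<in>F. fst \<phi> j p = 0} \<and> Q = {\<phi>\<in>F. fst \<phi> j p > 0}}"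

lemma semialgebraic_fm_cond:
  assumes F: "finite F" "\<And>\<phi>. \<phi> \<in> F \<Longrightarrow> poly_fun I (fst \<phi> j)" and ZQ: "Z \<subseteq> F" "Q \<subseteq> F"
  shows "fm_cond I j F Z Q \<in> semialgebraic_Q I"
proof -
  have "fm_cond I j F Z Q = {p \<in> aff_space I. \<forall>\<phi>\<in>F. (if \<phi> \<in> Z then fst \<phi> j p = 0 else \<not> fst \<phi> j p = 0) \<and>
      (if \<phi> \<in> Q then fst \<phi> j p > 0 else \<not> fst \<phi> j p > 0)}"
    unfolding fm_cond_def using ZQ by (auto split: if_splits)
  moreover have "\<dots> \<in> semialgebraic_Q I"
  proof (intro semialgebraic_Q_ball semialgebraic_Q_conj F(1))
    fix \<phi> assume "\<phi> \<in> F"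
    note * = semialgebraic_Q_zero[OF F(2)[OF this]] semialgebraic_Q_pos[OF F(2)[OF this]]
    show "{x \<in> aff_space I. if \<phi> \<in> Z then fst \<phi> j x = 0 else fst \<phi> j x \<noteq> 0} \<in> semialgebraic_Q I"
      using * semialgebraic_Q_not by (cases "\<phi> \<in> Z") auto
    show "{x \<in> aff_space I. if \<phi> \<in> Q then fst \<phi> j x > 0 else \<not> fst \<phi> j x > 0} \<in> semialgebraic_Q I"
      using *(2) semialgebraic_Q_not[OF *(2)] by (cases "\<phi> \<in> Q") auto
  qed
  ultimately show ?thesis by simp
qed

lemma poly_form_fm_elim:
  assumes "\<And>\<phi>. \<phi> \<in> F \<Longrightarrow> poly_form I V \<phi>" "j \<in> V" "Z \<subseteq> F" "Q \<subseteq> F" "\<phi> \<in> fm_elim j F Z Q"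
  shows "poly_form I (V - {j}) \<phi>"
proof -
  consider "\<phi> \<in> Z" | f g where "f \<in> F" "g \<in> F" "\<phi> = fm_comb j f g"
    using assms unfolding fm_elim_def by auto
  then show ?thesis
  proof cases
    case 1
    then have "poly_form I V \<phi>" using assms(1,3) by blast
    then show ?thesis unfolding poly_form_def by simp
  next
    case 2
    then have "poly_form I V f" "poly_form I V g" using assms(1) by auto
    then show ?thesis unfolding 2(3) poly_form_def fm_comb_def using \<open>j \<in> V\<close>
      by (auto intro!: poly_fun_intros)
  qed
qed

text \<open>Trades a sign pattern that varies with \<open>p\<close> for a finite union over all
  conceivable patterns; on each piece the eliminated system is constant.\<close>

lemma elim_cases:
  "{p \<in> aff_space I. R p {\<phi>\<in>F. fst \<phi> j p = 0} {\<phi>\<in>F. fst \<phi> j p > 0}} =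
   (\<Union>(Z, Q)\<in>Pow F \<times> Pow F. fm_cond I j F Z Q \<inter> {p \<in> aff_space I. R p Z Q})"
  unfolding fm_cond_def by auto

lemma finite_fm_elim: "finite F \<Longrightarrow> Z \<subseteq> F \<Longrightarrow> Q \<subseteq> F \<Longrightarrow> finite (fm_elim j F Z Q)"
  unfolding fm_elim_def by (auto intro: finite_subset)

text \<open>Quantifier elimination for existential variables that occur linearly: they are removed
  one at a time, and each removal splits the parameter space by the signs of the coefficients, which
  are polynomials in the point.\<close>

lemma semialgebraic_real_feasible:
  assumes "finite V" "finite F" "\<And>\<phi>. \<phi> \<in> F \<Longrightarrow> poly_form I V \<phi>"
  shows "{p \<in> aff_space I. \<exists>y. sat V F p y} \<in> semialgebraic_Q I"
  using assms
proof (induction V arbitrary: F rule: finite_induct)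
  case empty
  have "{p \<in> aff_space I. \<exists>y. sat {} F p y} = {p \<in> aff_space I. \<forall>\<phi>\<in>F. snd \<phi> p > 0}"
    by (auto simp: sat_def pf_val_def)
  then show ?case using empty by (auto intro!: semialgebraic_Q_ball semialgebraic_Q_pos simp: poly_form_def)
next
  case (insert j V)
  have *: "(\<exists>y. sat (insert j V) F p y) \<longleftrightarrow>
      (\<exists>y. sat V (fm_elim j F {\<phi>\<in>F. fst \<phi> j p = 0} {\<phi>\<in>F. fst \<phi> j p > 0}) p y)" for p
  proof -
    have "(\<exists>y. sat (insert j V) F p y) \<longleftrightarrow> (\<exists>y x. sat (insert j V) F p (y(j := x)))"
      by (metis fun_upd_triv)
    also have "\<dots> \<longleftrightarrow> (\<exists>y. sat (insert j V - {j}) (fm_elim j F {\<phi>\<in>F. fst \<phi> j p = 0} {\<phi>\<in>F. fst \<phi> j p > 0}) p y)"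
      by (intro ex_cong1 fm_elim_correct) (use insert in auto)
    finally show ?thesis using insert.hyps by simp
  qed
  show ?case
    unfolding * elim_cases[where R = "\<lambda>p Z Q. \<exists>y. sat V (fm_elim j F Z Q) p y"]
  proof (intro semialgebraic_Q_UN)
    show "finite (Pow F \<times> Pow F)" using insert by auto
    fix ZQ assume ZQ: "ZQ \<in> Pow F \<times> Pow F"
    then obtain Z Q where [simp]: "ZQ = (Z, Q)" and *: "Z \<subseteq> F" "Q \<subseteq> F" by auto
    have "poly_form I V \<phi>" if "\<phi> \<in> fm_elim j F Z Q" for \<phi>
      using poly_form_fm_elim[of F I "insert j V" j Z Q \<phi>] insert.prems(2) insert.hyps * that by simp
    then have "{p \<in> aff_space I. \<exists>y. sat V (fm_elim j F Z Q) p y} \<in> semialgebraic_Q I"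
      by (rule insert.IH[OF finite_fm_elim[OF insert.prems(1) *]])
    moreover have "fm_cond I j F Z Q \<in> semialgebraic_Q I"
      using semialgebraic_fm_cond[OF insert.prems(1) _ *] insert.prems(2) unfolding poly_form_def by blast
    ultimately show "(case ZQ of (Z, Q) \<Rightarrow> fm_cond I j F Z Q \<inter>
        {p \<in> aff_space I. \<exists>y. sat V (fm_elim j F Z Q) p y}) \<in> semialgebraic_Q I"
      by (simp add: semialgebraic_Q_Int)
  qed
qed

section \<open>Systems of strict inequalities without integer solutions\<close>

definition pf_lin :: "nat set \<Rightarrow> 'p pform \<Rightarrow> 'p \<Rightarrow> (nat \<Rightarrow> real) \<Rightarrow> real" where
  "pf_lin V \<phi> p y = (\<Sum>k\<in>V. fst \<phi> k p * y k)"

lemma pf_val_lin: "pf_val V \<phi> p y = pf_lin V \<phi> p y + snd \<phi> p"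
  by (simp add: pf_val_def pf_lin_def)

lemma pf_val_add: "pf_val V \<phi> p (\<lambda>k. y k + z k) = pf_val V \<phi> p y + pf_lin V \<phi> p z"
  by (simp add: pf_val_def pf_lin_def algebra_simps sum.distrib)

lemma pf_lin_scale: "pf_lin V \<phi> p (\<lambda>k. c * y k) = c * pf_lin V \<phi> p y"
  by (simp add: pf_lin_def algebra_simps sum_distrib_left)

lemma pf_lin_abs_le:
  assumes "\<And>k. k \<in> V \<Longrightarrow> \<bar>y k\<bar> \<le> e"
  shows "\<bar>pf_lin V \<phi> p y\<bar> \<le> (\<Sum>k\<in>V. \<bar>fst \<phi> k p\<bar>) * e"
proof -
  have "\<bar>pf_lin V \<phi> p y\<bar> \<le> (\<Sum>k\<in>V. \<bar>fst \<phi> k p * y k\<bar>)"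
    unfolding pf_lin_def by (rule sum_abs)
  also have "\<dots> \<le> (\<Sum>k\<in>V. \<bar>fst \<phi> k p\<bar> * e)"
    by (intro sum_mono) (simp add: abs_mult assms mult_left_mono)
  finally show ?thesis by (simp add: sum_distrib_right)
qed

text \<open>Unbounded solutions are scaled to have \<open>\<ell>\<close>-one norm \<open>1\<close>.
  A limit of the scaled vectors still has norm \<open>1\<close>, and no form decreases along it
  because the constant terms, divided by norms tending to infinity, disappear.\<close>

lemma bounded_or_recession:
  assumes V: "finite V"
    and rec: "\<And>r. (\<And>\<phi>. \<phi> \<in> F \<Longrightarrow> pf_lin V \<phi> p r \<ge> 0) \<Longrightarrow> \<forall>k\<in>V. r k = 0"
  shows "\<exists>B :: nat. \<forall>y. sat V F p y \<longrightarrow> (\<forall>k\<in>V. \<bar>y k\<bar> \<le> B)"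
proof (rule ccontr)
  assume "\<not> ?thesis"
  then have "\<forall>n :: nat. \<exists>y. sat V F p y \<and> (\<exists>k\<in>V. real n < \<bar>y k\<bar>)"
    by (meson not_le)
  then obtain y where y: "\<And>n. sat V F p (y n)" "\<And>n :: nat. \<exists>k\<in>V. real n < \<bar>y n k\<bar>" by metis
  define M where "M n = (\<Sum>k\<in>V. \<bar>y n k\<bar>)" for n
  have M: "M n > real n" for n
  proof -
    obtain k where "k \<in> V" "real n < \<bar>y n k\<bar>" using y(2) by blast
    moreover have "\<bar>y n k\<bar> \<le> M n" unfolding M_def using V \<open>k \<in> V\<close> by (intro member_le_sum) auto
    ultimately show ?thesis by linarith
  qed
  have M0: "M n > 0" for n using M[of n] by linarith
  define z where "z n k = y n k / M n" for n k
  have z1: "(\<Sum>k\<in>V. \<bar>z n k\<bar>) = 1" for n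
    using M0[of n] by (simp add: z_def sum_divide_distrib[symmetric] M_def[symmetric])
  have "bounded (range (\<lambda>n. z n k))" if "k \<in> V" for k
  proof -
    have "\<bar>z n k\<bar> \<le> 1" for n unfolding z1[of n, symmetric] using V that by (intro member_le_sum) auto
    then show ?thesis unfolding bounded_iff by auto
  qed
  \<comment> \<open>One subsequence has to converge in all coordinates of \<open>V\<close>
    simultaneously.\<close>
  then have "\<forall>d\<subseteq>V. \<exists>l. \<exists>\<rho> :: nat \<Rightarrow> nat. strict_mono \<rho> \<and>
      (\<forall>\<epsilon>>0. \<forall>\<^sub>F n in sequentially. \<forall>i\<in>d. dist (z (\<rho> n) i) (l i) < \<epsilon>)"
    by (intro compact_lemma_general[where unproj = "\<lambda>f. f"]) (auto simp: V image_comp comp_def)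
  then obtain l and \<rho> :: "nat \<Rightarrow> nat" where \<rho>: "strict_mono \<rho>"
    "\<And>\<epsilon>. \<epsilon> > 0 \<Longrightarrow> \<forall>\<^sub>F n in sequentially. \<forall>i\<in>V. dist (z (\<rho> n) i) (l i) < \<epsilon>" by blast
  have l: "(\<lambda>n. z (\<rho> n) k) \<longlonglongrightarrow> l k" if "k \<in> V" for k
  proof (rule tendstoI)
    fix e :: real assume "e > 0"
    from \<rho>(2)[OF this] show "\<forall>\<^sub>F n in sequentially. dist (z (\<rho> n) k) (l k) < e"
      by (rule eventually_mono) (use that in simp)
  qed
  have "(\<lambda>n. \<Sum>k\<in>V. \<bar>z (\<rho> n) k\<bar>) \<longlonglongrightarrow> (\<Sum>k\<in>V. \<bar>l k\<bar>)"
    by (intro tendsto_sum tendsto_rabs l)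
  then have l1: "(\<Sum>k\<in>V. \<bar>l k\<bar>) = 1" unfolding z1 using LIMSEQ_unique tendsto_const by blast
  have "pf_lin V \<phi> p l \<ge> 0" if \<phi>: "\<phi> \<in> F" for \<phi>
  proof -
    have Mr: "real n < M (\<rho> n)" for n using M[of "\<rho> n"] seq_suble[OF \<rho>(1), of n] by linarith
    have "filterlim (\<lambda>n. M (\<rho> n)) at_top sequentially"
      by (rule filterlim_at_top_mono[OF filterlim_real_sequentially]) (simp add: less_imp_le[OF Mr])
    then have "(\<lambda>n. snd \<phi> p / M (\<rho> n)) \<longlonglongrightarrow> 0"
      by (intro real_tendsto_divide_at_top[OF tendsto_const])
    moreover have "(\<lambda>n. pf_lin V \<phi> p (z (\<rho> n))) \<longlonglongrightarrow> pf_lin V \<phi> p l"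
      unfolding pf_lin_def by (intro tendsto_sum tendsto_mult tendsto_const l)
    ultimately have "(\<lambda>n. pf_lin V \<phi> p (z (\<rho> n)) + snd \<phi> p / M (\<rho> n)) \<longlonglongrightarrow> pf_lin V \<phi> p l + 0"
      by (intro tendsto_add)
    moreover have "pf_lin V \<phi> p (z n) + snd \<phi> p / M n \<ge> 0" for n
    proof -
      have "pf_lin V \<phi> p (z n) + snd \<phi> p / M n = pf_val V \<phi> p (y n) / M n"
        unfolding pf_lin_def pf_val_def z_def by (simp add: sum_divide_distrib add_divide_distrib)
      moreover have "pf_val V \<phi> p (y n) > 0" using y(1) \<phi> unfolding sat_def by blast
      ultimately show ?thesis using M0[of n] by simp
    qed
    ultimately show ?thesis by (intro LIMSEQ_le_const[where X = "\<lambda>n. pf_lin V \<phi> p (z (\<rho> n)) + snd \<phi> p / M (\<rho> n)"]) auto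
  qed
  then have "\<forall>k\<in>V. l k = 0" by (rule rec)
  then show False using l1 by simp
qed

text \<open>\<open>(i, j, s)\<close> stands for the elementary integer matrix adding \<open>s\<close> times the \<open>i\<close>-th
  coordinate to the \<open>j\<close>-th one; \<open>op_form\<close> is the dual action on forms.\<close>

type_synonym elem_op = "nat \<times> nat \<times> int"

fun op_vec :: "elem_op \<Rightarrow> (nat \<Rightarrow> 'a :: ring_1) \<Rightarrow> nat \<Rightarrow> 'a" where
  "op_vec (i, j, s) y = y(j := y j + of_int s * y i)"

fun op_form :: "elem_op \<Rightarrow> 'p pform \<Rightarrow> 'p pform" where
  "op_form (i, j, s) \<phi> = ((fst \<phi>)(i := \<lambda>p. fst \<phi> i p - of_int s * fst \<phi> j p), snd \<phi>)"

definition elem_ops :: "nat set \<Rightarrow> elem_op set" where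
  "elem_ops V = {(i, j, s). i \<in> V \<and> j \<in> V \<and> i \<noteq> j}"

lemma sum_two:
  fixes f :: "'a \<Rightarrow> 'b :: comm_monoid_add"
  assumes "finite V" "i \<in> V" "j \<in> V" "i \<noteq> j"
  shows "sum f V = f i + f j + sum f (V - {i, j})"
proof -
  have "sum f V = f i + sum f (V - {i})" using assms by (simp add: sum.remove)
  also have "sum f (V - {i}) = f j + sum f (V - {i} - {j})" using assms by (simp add: sum.remove)
  also have "V - {i} - {j} = V - {i, j}" by auto
  finally show ?thesis by (simp add: add.assoc)
qed

lemma pf_lin_op:
  assumes "finite V" "\<sigma> \<in> elem_ops V"
  shows "pf_lin V (op_form \<sigma> \<phi>) p (op_vec \<sigma> y) = pf_lin V \<phi> p y"
proof -
  obtain i j s where [simp]: "\<sigma> = (i, j, s)" and ij: "i \<in> V" "j \<in> V" "i \<noteq> j"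
    using assms(2) by (auto simp: elem_ops_def)
  show ?thesis
    unfolding pf_lin_def sum_two[OF assms(1) ij]
    using ij(3) by (auto simp: algebra_simps intro!: sum.cong)
qed

lemma pf_val_op:
  assumes "finite V" "\<sigma> \<in> elem_ops V"
  shows "pf_val V (op_form \<sigma> \<phi>) p (op_vec \<sigma> y) = pf_val V \<phi> p y"
proof -
  have "snd (op_form \<sigma> \<phi>) = snd \<phi>" by (cases \<sigma>) simp
  then show ?thesis by (simp add: pf_val_lin pf_lin_op[OF assms])
qed

lemma op_vec_of_int: "op_vec \<sigma> (\<lambda>k. of_int (N k)) = (\<lambda>k. of_int (op_vec \<sigma> N k))"
  by (cases \<sigma>) auto

lemma sat_op:
  assumes "finite V" "\<sigma> \<in> elem_ops V"
  shows "sat V (op_form \<sigma> ` F) p (op_vec \<sigma> y) \<longleftrightarrow> sat V F p y"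
  unfolding sat_def by (simp add: pf_val_op[OF assms])

text \<open>An elementary operation permutes the integer vectors, its inverse using
  \<open>- s\<close>; so integer solvability survives although the real solution set is
  sheared.\<close>

lemma int_free_op:
  assumes "finite V" "\<sigma> \<in> elem_ops V"
  shows "int_free V (op_form \<sigma> ` F) p \<longleftrightarrow> int_free V F p"
proof -
  have "\<exists>N'. op_vec \<sigma> N' = N" for N :: "nat \<Rightarrow> int"
  proof -
    obtain i j s where [simp]: "\<sigma> = (i, j, s)" "i \<noteq> j"
      using assms(2) by (auto simp: elem_ops_def)
    have "op_vec \<sigma> (op_vec (i, j, - s) N) = N" by auto
    then show ?thesis by blast
  qed
  then have surj: "\<forall>N :: nat \<Rightarrow> int. \<exists>N'. op_vec \<sigma> N' = N" by blast
  have step: "sat V (op_form \<sigma> ` F) p (\<lambda>k. of_int (op_vec \<sigma> N k)) \<longleftrightarrow> sat V F p (\<lambda>k. of_int (N k))"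
    for N :: "nat \<Rightarrow> int"
    unfolding op_vec_of_int[symmetric] by (rule sat_op[OF assms])
  show ?thesis
    unfolding int_free_def
  proof (intro iffI allI)
    fix N :: "nat \<Rightarrow> int"
    assume "\<forall>N. \<not> sat V (op_form \<sigma> ` F) p (\<lambda>k. of_int (N k))"
    then show "\<not> sat V F p (\<lambda>k. of_int (N k))" using step[of N] by simp
  next
    fix N :: "nat \<Rightarrow> int"
    assume "\<forall>N :: nat \<Rightarrow> int. \<not> sat V F p (\<lambda>k. of_int (N k))"
    moreover obtain N' where "op_vec \<sigma> N' = N" using surj by blast
    ultimately show "\<not> sat V (op_form \<sigma> ` F) p (\<lambda>k. of_int (N k))" using step[of N'] by simp
  qed
qed

lemma int_free_ops:
  assumes "finite V" "\<sigma>s \<in> lists (elem_ops V)"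
  shows "int_free V (fold (\<lambda>\<sigma> F. op_form \<sigma> ` F) \<sigma>s F) p \<longleftrightarrow> int_free V F p"
  using assms(2) by (induction \<sigma>s arbitrary: F) (auto simp: int_free_op[OF assms(1)])

definition vec_supp :: "nat set \<Rightarrow> (nat \<Rightarrow> real) \<Rightarrow> nat set" where
  "vec_supp V r = {k \<in> V. r k \<noteq> 0}"

text \<open>Integer coefficients suffice: after clearing denominators this is linear independence
  over the rationals of the nonzero entries.\<close>

definition indep_supp :: "nat set \<Rightarrow> (nat \<Rightarrow> real) \<Rightarrow> bool" where
  "indep_supp V r \<longleftrightarrow> (\<forall>\<alpha> :: nat \<Rightarrow> int.
     (\<Sum>k\<in>vec_supp V r. of_int (\<alpha> k) * r k) = 0 \<longrightarrow> (\<forall>k\<in>vec_supp V r. \<alpha> k = 0))"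

text \<open>Euclid's algorithm on the coefficients of an integer relation between the nonzero coordinates.\<close>

lemma reduce_support:
  fixes \<alpha> :: "nat \<Rightarrow> int"
  assumes "finite V" "(\<Sum>k\<in>vec_supp V r. of_int (\<alpha> k) * r k) = 0" "\<exists>k\<in>vec_supp V r. \<alpha> k \<noteq> 0"
  shows "\<exists>\<sigma>s\<in>lists (elem_ops V). card (vec_supp V (fold op_vec \<sigma>s r)) < card (vec_supp V r)"
  using assms(2,3)
proof (induction "\<Sum>k\<in>vec_supp V r. nat \<bar>\<alpha> k\<bar>" arbitrary: r \<alpha> rule: less_induct)
  case less
  let ?W = "vec_supp V r"
  have W: "finite ?W" using assms(1) by (simp add: vec_supp_def)
  obtain k where k: "k \<in> ?W" "\<alpha> k \<noteq> 0" using less.prems by blast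
  \<comment> \<open>A relation with a single nonzero coefficient would force a zero entry inside the
    support, so there are two coefficients to which division with remainder applies.\<close>
  have "\<exists>l\<in>?W - {k}. \<alpha> l \<noteq> 0"
  proof (rule ccontr)
    assume "\<not> ?thesis"
    then have "(\<Sum>k\<in>?W. real_of_int (\<alpha> k) * r k) = real_of_int (\<alpha> k) * r k"
      using W k(1) by (simp add: sum.remove)
    then show False using less.prems(1) k by (simp add: vec_supp_def)
  qed
  then obtain l where l: "l \<in> ?W" "l \<noteq> k" "\<alpha> l \<noteq> 0" by blast
  obtain i j where ij: "i \<in> ?W" "j \<in> ?W" "i \<noteq> j" "\<alpha> j \<noteq> 0" "\<bar>\<alpha> j\<bar> \<le> \<bar>\<alpha> i\<bar>"
  proof (cases "\<bar>\<alpha> l\<bar> \<le> \<bar>\<alpha> k\<bar>")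
    case True
    then show thesis using that[of k l] k l by auto
  next
    case False
    then show thesis using that[of l k] k l by auto
  qed
  \<comment> \<open>With \<open>q = \<alpha> i div \<alpha> j\<close>, the sum
    \<open>\<alpha> i * r i + \<alpha> j * r j\<close> equals \<open>(\<alpha> i - q * \<alpha> j) *
    r i + \<alpha> j * (r j + q * r i)\<close>. Changing the vector at \<open>j\<close> thus
    performs a division step on the coefficient at \<open>i\<close>.\<close>
  define \<sigma> :: elem_op where "\<sigma> = (i, j, \<alpha> i div \<alpha> j)"
  have \<sigma>: "\<sigma> \<in> elem_ops V" using ij by (auto simp: \<sigma>_def elem_ops_def vec_supp_def)
  define r' where "r' = op_vec \<sigma> r"
  show ?case
  \<comment> \<open>Either the support shrinks at once, or it is unchanged and the sum of the
    absolute values of the coefficients drops.\<close>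
  proof (cases "r' j = 0")
    case True
    have "vec_supp V r' = ?W - {j}" using True by (auto simp: r'_def \<sigma>_def vec_supp_def)
    then have "card (vec_supp V r') < card ?W" using ij(2) W by (metis card_Diff1_less)
    then show ?thesis using \<sigma> by (intro bexI[of _ "[\<sigma>]"]) (auto simp: r'_def)
  next
    case False
    have supp: "vec_supp V r' = ?W" using False ij(2) by (auto simp: r'_def \<sigma>_def vec_supp_def)
    define \<alpha>' where "\<alpha>' = \<alpha>(i := \<alpha> i mod \<alpha> j)"
    have mod: "\<bar>\<alpha>' i\<bar> < \<bar>\<alpha> i\<bar>"
      using ij(4,5) abs_mod_less[of "\<alpha> j" "\<alpha> i"] by (simp add: \<alpha>'_def)
    have "(\<Sum>k\<in>?W. nat \<bar>\<alpha>' k\<bar>) < (\<Sum>k\<in>?W. nat \<bar>\<alpha> k\<bar>)"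
      by (rule sum_strict_mono_ex1[OF W]) (use mod ij(1) in \<open>auto simp: \<alpha>'_def\<close>)
    moreover have "(\<Sum>k\<in>?W. real_of_int (\<alpha>' k) * r' k) = 0"
    proof -
      have m: "\<alpha> i mod \<alpha> j = \<alpha> i - (\<alpha> i div \<alpha> j) * \<alpha> j" by (simp add: minus_div_mult_eq_mod)
      have "(\<Sum>k\<in>?W. real_of_int (\<alpha>' k) * r' k) = (\<Sum>k\<in>?W. real_of_int (\<alpha> k) * r k)"
        unfolding sum_two[OF W ij(1,2,3)] using ij(3)
        by (auto simp: \<alpha>'_def r'_def \<sigma>_def m algebra_simps intro!: sum.cong)
      then show ?thesis using less.prems(1) by simp
    qed
    moreover have "\<exists>k\<in>?W. \<alpha>' k \<noteq> 0" using ij by (intro bexI[of _ j]) (auto simp: \<alpha>'_def)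
    ultimately have "\<exists>\<sigma>s\<in>lists (elem_ops V). card (vec_supp V (fold op_vec \<sigma>s r')) < card (vec_supp V r')"
      by (intro less.hyps[of \<alpha>' r']) (simp_all only: supp)
    then obtain \<sigma>s where "\<sigma>s \<in> lists (elem_ops V)"
      "card (vec_supp V (fold op_vec \<sigma>s r')) < card ?W"
      unfolding supp by blast
    then show ?thesis using \<sigma> by (intro bexI[of _ "\<sigma> # \<sigma>s"]) (auto simp: r'_def)
  qed
qed

lemma make_support_independent:
  assumes "finite V"
  shows "\<exists>\<sigma>s\<in>lists (elem_ops V). indep_supp V (fold op_vec \<sigma>s r)"
proof (induction "card (vec_supp V r)" arbitrary: r rule: less_induct)
  case less
  show ?case
  proof (cases "indep_supp V r")
    case True
    then show ?thesis by (intro bexI[of _ "[]"]) auto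
  next
    case False
    then obtain \<sigma>s where \<sigma>s: "\<sigma>s \<in> lists (elem_ops V)"
      "card (vec_supp V (fold op_vec \<sigma>s r)) < card (vec_supp V r)"
      using reduce_support[OF assms] unfolding indep_supp_def by metis
    then obtain \<sigma>s' where "\<sigma>s' \<in> lists (elem_ops V)" "indep_supp V (fold op_vec \<sigma>s' (fold op_vec \<sigma>s r))"
      using less by blast
    then show ?thesis using \<sigma>s(1) by (intro bexI[of _ "\<sigma>s @ \<sigma>s'"]) auto
  qed
qed

text \<open>Guarantees that a nonzero entry is left after the change of coordinates; its index is
  the variable that can be relaxed to the reals.\<close>

lemma op_vec_nonzero:
  fixes r :: "nat \<Rightarrow> real"
  assumes "\<sigma> \<in> elem_ops V" "vec_supp V r \<noteq> {}"
  shows "vec_supp V (op_vec \<sigma> r) \<noteq> {}"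
proof -
  obtain i j s where [simp]: "\<sigma> = (i, j, s)" and ij: "i \<in> V" "j \<in> V" "i \<noteq> j"
    using assms(1) by (auto simp: elem_ops_def)
  obtain k where k: "k \<in> V" "r k \<noteq> 0" using assms(2) by (auto simp: vec_supp_def)
  show ?thesis
  proof (cases "k = j \<and> r i = 0")
    case True
    then show ?thesis using k by (auto simp: vec_supp_def)
  next
    case False
    then show ?thesis using k ij by (cases "k = j") (auto simp: vec_supp_def)
  qed
qed

lemma ops_vec_nonzero:
  fixes r :: "nat \<Rightarrow> real"
  assumes "\<sigma>s \<in> lists (elem_ops V)" "vec_supp V r \<noteq> {}"
  shows "vec_supp V (fold op_vec \<sigma>s r) \<noteq> {}"
  using assms by (induction \<sigma>s arbitrary: r) (auto simp: op_vec_nonzero)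

lemma recession_ops:
  assumes "finite V" "\<sigma>s \<in> lists (elem_ops V)" "\<forall>\<phi>\<in>F. pf_lin V \<phi> p r \<ge> 0"
  shows "\<forall>\<phi>\<in>fold (\<lambda>\<sigma> F. op_form \<sigma> ` F) \<sigma>s F. pf_lin V \<phi> p (fold op_vec \<sigma>s r) \<ge> 0"
  using assms(2,3)
proof (induction \<sigma>s arbitrary: F r)
  case (Cons \<sigma> \<sigma>s)
  then have "\<forall>\<phi>\<in>op_form \<sigma> ` F. pf_lin V \<phi> p (op_vec \<sigma> r) \<ge> 0"
    by (simp add: pf_lin_op[OF assms(1)])
  from Cons.IH[OF this] Cons.hyps Cons.prems show ?case by simp
qed simp

text \<open>By Kronecker's theorem the multiples of \<open>r\<close> come arbitrarily close, modulo integers, to any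
  multiple of the \<open>j\<close>-th unit vector, so moving along \<open>r\<close> corrects the coordinate \<open>x\<close>.\<close>

lemma recession_line:
  assumes V: "finite V" and F: "finite F" and free: "int_free V F p"
    and rec: "\<forall>\<phi>\<in>F. pf_lin V \<phi> p r \<ge> 0" and ind: "indep_supp V r" and j: "j \<in> vec_supp V r"
  shows "\<not> sat V F p ((\<lambda>k. of_int (N k))(j := x))"
proof
  define W where "W = vec_supp V r"
  have W: "finite W" "W \<subseteq> V" using V by (auto simp: W_def vec_supp_def)
  have indW: "\<forall>\<alpha> :: nat \<Rightarrow> int. (\<Sum>k\<in>W. of_int (\<alpha> k) * r k) = 0 \<longrightarrow> (\<forall>k\<in>W. \<alpha> k = 0)"
    using ind unfolding indep_supp_def W_def .
  define y0 where "y0 = (\<lambda>k. real_of_int (N k))(j := x)"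
  assume "sat V F p ((\<lambda>k. of_int (N k))(j := x))"
  then have y0: "pf_val V \<phi> p y0 > 0" if "\<phi> \<in> F" for \<phi> using that unfolding sat_def y0_def by blast
  \<comment> \<open>A common margin by which all of the finitely many strict inequalities hold at
    \<open>y0\<close>; it is what the approximation may consume.\<close>
  obtain \<delta> where \<delta>: "\<delta> > 0" "\<And>\<phi>. \<phi> \<in> F \<Longrightarrow> pf_val V \<phi> p y0 \<ge> \<delta>"
  proof (cases "F = {}")
    case True
    then show thesis using that[of 1] by simp
  next
    case False
    then show thesis using that[of "Min ((\<lambda>\<phi>. pf_val V \<phi> p y0) ` F)"] F y0 by simp
  qed
  \<comment> \<open>An error of at most \<open>\<epsilon>\<close> in every coordinate changes each
    form by at most \<open>(C - 1) * \<epsilon>\<close>, which is below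
    \<open>\<delta> = C * \<epsilon>\<close>. The added one makes \<open>C\<close> positive and the
    estimate strict.\<close>
  define C where "C = (\<Sum>\<phi>\<in>F. \<Sum>k\<in>V. \<bar>fst \<phi> k p\<bar>) + 1"
  have C: "(\<Sum>k\<in>V. \<bar>fst \<phi> k p\<bar>) \<le> C - 1" if "\<phi> \<in> F" for \<phi>
    unfolding C_def using member_le_sum[OF that _ F, of "\<lambda>\<phi>. \<Sum>k\<in>V. \<bar>fst \<phi> k p\<bar>"] by (simp add: sum_nonneg)
  have C0: "C > 0" unfolding C_def by (smt (verit) sum_nonneg abs_ge_zero)
  define \<epsilon> where "\<epsilon> = \<delta> / C"
  have \<epsilon>: "\<epsilon> > 0" "C * \<epsilon> = \<delta>" using C0 \<delta>(1) by (auto simp: \<epsilon>_def)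
  define n where "n = card W"
  obtain e where e: "bij_betw e {..<n} W"
    using ex_bij_betw_nat_finite[OF W(1)] unfolding n_def atLeast0LessThan by blast
  define \<theta> where "\<theta> i = r (e i)" for i
  \<comment> \<open>The independence fed into Kronecker's theorem concerns the set of values, so
    repeated entries have to be excluded; they would satisfy the relation with coefficients
    \<open>1\<close> and \<open>- 1\<close>.\<close>
  have injr: "inj_on r W"
  proof (rule inj_onI, rule ccontr)
    fix k l assume kl: "k \<in> W" "l \<in> W" "r k = r l" "k \<noteq> l"
    let ?\<alpha> = "\<lambda>i. if i = k then 1 else if i = l then - 1 else 0 :: int"
    have "(\<Sum>i\<in>W. real_of_int (?\<alpha> i) * r i) = 0"
      unfolding sum_two[OF W(1) kl(1,2,4)] using kl by (auto intro!: sum.neutral)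
    then have "?\<alpha> k = 0" using indW[THEN spec, of ?\<alpha>] kl(1) by blast
    then show False by simp
  qed
  have \<theta>W: "\<theta> ` {..<n} = r ` W" using e unfolding \<theta>_def bij_betw_def by auto
  have inj\<theta>: "inj_on \<theta> {..<n}"
    using comp_inj_on[of e "{..<n}" r] e injr unfolding \<theta>_def bij_betw_def comp_def by simp
  have indp: "module.independent (\<lambda>c. (*) (real_of_int c)) (\<theta> ` {..<n})"
  proof -
    interpret Modules.module "\<lambda>c. (*) (real_of_int c)"
      by (simp add: Modules.module.intro distrib_left mult.commute)
    show ?thesis
      unfolding dependent_explicit \<theta>W
    proof clarify
      fix t u v assume t: "finite t" "t \<subseteq> r ` W" "(\<Sum>v\<in>t. real_of_int (u v) * v) = 0" "v \<in> t" "u v \<noteq> 0"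
      define \<alpha> where "\<alpha> k = (if r k \<in> t then u (r k) else 0)" for k
      have "(\<Sum>k\<in>W. real_of_int (\<alpha> k) * r k) = (\<Sum>v\<in>r ` W. real_of_int (if v \<in> t then u v else 0) * v)"
        by (simp add: sum.reindex[OF injr] \<alpha>_def)
      also have "\<dots> = (\<Sum>v\<in>t. real_of_int (u v) * v)"
        by (rule sum.mono_neutral_cong_right) (use W t(2) in auto)
      finally have "\<forall>k\<in>W. \<alpha> k = 0" using indW t(3) by simp
      moreover obtain k where "k \<in> W" "v = r k" using t(2,4) by blast
      ultimately show False using t(4,5) unfolding \<alpha>_def by metis
    qed
  qed
  \<comment> \<open>With this target the integers \<open>h\<close> approximate
    \<open>t * r k + \<beta> k\<close>. The real offset \<open>x\<close> occurs at \<open>j\<close>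
    only, where it replaces the entry of \<open>N\<close>; hence the zero at \<open>j\<close> in
    \<open>N'\<close> below.\<close>
  define \<beta> where "\<beta> k = (if k = j then x else 0)" for k
  obtain t h where th: "\<And>i. i < n \<Longrightarrow> \<bar>t * \<theta> i - of_int (h i) - (- \<beta> (e i))\<bar> < \<epsilon> / 2"
    using Kronecker_thm_1[OF indp inj\<theta>, of "\<epsilon> / 2" "\<lambda>i. - \<beta> (e i)"] \<epsilon>(1) by auto
  obtain N0 :: nat where N0: "N0 > 0" "1 / N0 < \<epsilon> / 2"
    using \<epsilon>(1) by (metis half_gt_zero gr_zeroI inverse_eq_divide real_arch_inverse)
  \<comment> \<open>The multiple \<open>t\<close> from Kronecker's theorem may be negative, but a
    recession direction may be followed only forwards. A positive multiple of
    \<open>\<bar>t\<bar> + 1\<close> that keeps all entries nearly integral is added, so that the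
    total \<open>T\<close> is nonnegative at the price of a further error below
    \<open>\<epsilon> / 2\<close>.\<close>
  obtain q h' where q: "0 < q" "\<And>i. i < n \<Longrightarrow> \<bar>of_int q * ((\<bar>t\<bar> + 1) * \<theta> i) - of_int (h' i)\<bar> < 1 / N0"
    using Dirichlet_approx_simult[OF N0(1), of n "\<lambda>i. (\<bar>t\<bar> + 1) * \<theta> i"] by metis
  define T where "T = t + of_int q * (\<bar>t\<bar> + 1)"
  have T: "T \<ge> 0"
  proof -
    have "1 * (\<bar>t\<bar> + 1) \<le> of_int q * (\<bar>t\<bar> + 1)" using q(1) by (intro mult_right_mono) auto
    from add_left_mono[OF this, of t] show ?thesis
      unfolding T_def by (rule order_trans[rotated]) simp
  qed
  define N' where "N' k = (if k \<in> W then (if k = j then 0 else N k) + h (the_inv_into {..<n} e k) +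
    h' (the_inv_into {..<n} e k) else N k)" for k
  have close: "\<bar>of_int (N' k) - (y0 k + T * r k)\<bar> \<le> \<epsilon>" if "k \<in> V" for k
  proof (cases "k \<in> W")
    case False
    then have "r k = 0" "k \<noteq> j" using that j unfolding W_def vec_supp_def by auto
    then show ?thesis using \<epsilon>(1) False by (simp add: N'_def y0_def)
  next
    case True
    then obtain i where i: "i < n" "k = e i" using e unfolding bij_betw_def by auto
    have "the_inv_into {..<n} e k = i" using e i unfolding bij_betw_def by (simp add: the_inv_into_f_f)
    then have "of_int (N' k) - (y0 k + T * r k) =
        - (t * \<theta> i - of_int (h i) - (- \<beta> (e i))) - (of_int q * ((\<bar>t\<bar> + 1) * \<theta> i) - of_int (h' i))"
      using True i(2) by (auto simp: N'_def y0_def T_def \<theta>_def \<beta>_def algebra_simps)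
    then show ?thesis using th[OF i(1)] q(2)[OF i(1)] N0(2) by linarith
  qed
  have "sat V F p (\<lambda>k. of_int (N' k))"
    unfolding sat_def
  proof
    fix \<phi> assume \<phi>: "\<phi> \<in> F"
    let ?d = "\<lambda>k. of_int (N' k) - (y0 k + T * r k)"
    have "pf_val V \<phi> p (\<lambda>k. of_int (N' k)) = pf_val V \<phi> p (\<lambda>k. (y0 k + T * r k) + ?d k)"
      by simp
    also have "\<dots> = pf_val V \<phi> p y0 + T * pf_lin V \<phi> p r + pf_lin V \<phi> p ?d"
      unfolding pf_val_add pf_lin_scale ..
    finally have eq: "pf_val V \<phi> p (\<lambda>k. of_int (N' k)) = \<dots>" .
    have "\<bar>pf_lin V \<phi> p ?d\<bar> \<le> (\<Sum>k\<in>V. \<bar>fst \<phi> k p\<bar>) * \<epsilon>"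
      by (rule pf_lin_abs_le[OF close])
    also have "\<dots> \<le> (C - 1) * \<epsilon>" using C[OF \<phi>] \<epsilon>(1) by (intro mult_right_mono) auto
    also have "\<dots> < \<delta>" using \<epsilon> by (simp add: algebra_simps)
    finally have "\<bar>pf_lin V \<phi> p ?d\<bar> < \<delta>" .
    moreover have "T * pf_lin V \<phi> p r \<ge> 0" using T rec \<phi> by simp
    ultimately show "pf_val V \<phi> p (\<lambda>k. of_int (N' k)) > 0" unfolding eq using \<delta>(2)[OF \<phi>] by linarith
  qed
  then show False using free unfolding int_free_def by blast
qed

lemma poly_form_op:
  assumes "poly_form I V \<phi>" "\<sigma> \<in> elem_ops V"
  shows "poly_form I V (op_form \<sigma> \<phi>)"
  using assms by (cases \<sigma>) (auto simp: poly_form_def elem_ops_def intro!: poly_fun_intros)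

lemma poly_form_ops:
  assumes "\<sigma>s \<in> lists (elem_ops V)" "\<forall>\<phi>\<in>F. poly_form I V \<phi>"
  shows "\<forall>\<phi>\<in>fold (\<lambda>\<sigma> F. op_form \<sigma> ` F) \<sigma>s F. poly_form I V \<phi>"
  using assms
proof (induction \<sigma>s arbitrary: F)
  case (Cons \<sigma> \<sigma>s)
  then have "\<forall>\<phi>\<in>op_form \<sigma> ` F. poly_form I V \<phi>" using poly_form_op by blast
  from Cons.IH[OF this] Cons.hyps Cons.prems show ?case by simp
qed simp

lemma finite_ops: "finite F \<Longrightarrow> finite (fold (\<lambda>\<sigma> F. op_form \<sigma> ` F) \<sigma>s F)"
  by (induction \<sigma>s arbitrary: F) auto

section \<open>Certificates for the absence of integer solutions\<close>

definition exceed_form :: "real \<Rightarrow> nat \<Rightarrow> nat \<Rightarrow> 'p pform" where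
  "exceed_form s k B = ((\<lambda>l p. if l = k then s else 0), \<lambda>p. - of_nat B)"

lemma pf_val_exceed:
  assumes "finite V" "k \<in> V"
  shows "pf_val V (exceed_form s k B) p y = s * y k - of_nat B"
  unfolding pf_val_def exceed_form_def using assms
  by (simp add: if_distrib[of "\<lambda>z. z * _"] sum.delta cong: if_cong)

lemma poly_form_exceed:
  assumes "s \<in> {1, - 1}" shows "poly_form I V (exceed_form s k B)"
proof -
  have "poly_fun I (\<lambda>p. if l = k then s else 0)" for l
    using assms poly_fun_of_int[of I "1"] poly_fun_of_int[of I "-1"] poly_fun_of_int[of I 0] by auto
  moreover have "poly_fun I (\<lambda>p. - of_nat B)"
    using poly_fun_of_int[of I "- int B"] by simp
  ultimately show ?thesis unfolding poly_form_def exceed_form_def by simp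
qed

text \<open>The first clause confines all real solutions to the box and is settled by elimination;
  the second tests the finitely many integer points of the box. For fixed \<open>B\<close> both are
  semi-algebraic conditions on the point.\<close>

definition box_certificate :: "'i set \<Rightarrow> nat set \<Rightarrow> ('i \<Rightarrow> real) pform set \<Rightarrow> nat \<Rightarrow> ('i \<Rightarrow> real) set" where
  "box_certificate I V F B = {p \<in> aff_space I.
     (\<forall>k\<in>V. \<forall>s\<in>{1, - 1}. \<not> (\<exists>y. sat V (insert (exceed_form s k B) F) p y)) \<and>
     (\<forall>N\<in>V \<rightarrow>\<^sub>E {- int B..int B}. \<not> sat V F p (\<lambda>k. of_int (N k)))}"

lemma semialgebraic_sat:
  assumes "finite F" "\<And>\<phi>. \<phi> \<in> F \<Longrightarrow> poly_form I V \<phi>"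
  shows "{p \<in> aff_space I. sat V F p (\<lambda>k. of_int (N k))} \<in> semialgebraic_Q I"
proof -
  have "poly_fun I (\<lambda>p. pf_val V \<phi> p (\<lambda>k. of_int (N k)))" if "\<phi> \<in> F" for \<phi>
    unfolding pf_val_def using assms(2)[OF that] unfolding poly_form_def by (auto intro!: poly_fun_intros)
  then show ?thesis
    unfolding sat_def by (intro semialgebraic_Q_ball semialgebraic_Q_pos assms(1))
qed

lemma semialgebraic_box_certificate:
  assumes "finite V" "finite F" "\<And>\<phi>. \<phi> \<in> F \<Longrightarrow> poly_form I V \<phi>"
  shows "box_certificate I V F B \<in> semialgebraic_Q I"
  unfolding box_certificate_def
proof (intro semialgebraic_Q_conj semialgebraic_Q_ball semialgebraic_Q_not assms(1) semialgebraic_sat assms(2,3))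
  fix k s assume "k \<in> V" "s \<in> {1, - 1 :: real}"
  then show "{p \<in> aff_space I. \<exists>y. sat V (insert (exceed_form s k B) F) p y} \<in> semialgebraic_Q I"
    using assms by (intro semialgebraic_real_feasible) (auto intro: poly_form_exceed simp del: insert_iff elim!: insertE)
qed (use assms(1) in \<open>auto intro!: finite_PiE\<close>)

lemma box_certificate_sound:
  assumes "finite V" "p \<in> box_certificate I V F B"
  shows "int_free V F p"
  unfolding int_free_def
proof (intro allI notI)
  fix N :: "nat \<Rightarrow> int" assume N: "sat V F p (\<lambda>k. of_int (N k))"
  show False
  proof (cases "\<forall>k\<in>V. \<bar>N k\<bar> \<le> int B")
    case True
    then have "restrict N V \<in> V \<rightarrow>\<^sub>E {- int B..int B}" by (auto simp: abs_le_iff)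
    moreover have "sat V F p (\<lambda>k. of_int (restrict N V k))"
      by (subst sat_cong[of V _ "\<lambda>k. of_int (N k)"]) (use N in simp_all)
    ultimately show False using assms(2) unfolding box_certificate_def by blast
  next
    case False
    then obtain k where k: "k \<in> V" "\<bar>N k\<bar> > int B" by auto
    define s :: real where "s = (if N k > 0 then 1 else - 1)"
    have "s * of_int (N k) - of_nat B > 0"
      using k(2) unfolding s_def by (auto simp: abs_if split: if_splits)
    then have "sat V (insert (exceed_form s k B) F) p (\<lambda>k. of_int (N k))"
      using N unfolding sat_def by (simp add: pf_val_exceed[OF assms(1) k(1)])
    moreover have "s \<in> {1, - 1}" unfolding s_def by simp
    ultimately show False using assms(2) k(1) unfolding box_certificate_def by blast
  qed
qed

lemma box_certificate_complete:
  assumes "finite V" "p \<in> aff_space I" "int_free V F p"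
    and B: "\<And>y k. sat V F p y \<Longrightarrow> k \<in> V \<Longrightarrow> \<bar>y k\<bar> \<le> real B"
  shows "p \<in> box_certificate I V F B"
proof -
  have "\<not> sat V (insert (exceed_form s k B) F) p y" if "k \<in> V" "s \<in> {1, - 1}" for k s y
  proof
    assume "sat V (insert (exceed_form s k B) F) p y"
    then have "s * y k - of_nat B > 0" "sat V F p y"
      unfolding sat_def by (simp_all add: pf_val_exceed[OF assms(1) that(1)])
    then show False using B[of y k] that by auto
  qed
  then show ?thesis using assms(2,3) unfolding box_certificate_def int_free_def by blast
qed

text \<open>Stronger than \<open>int_free\<close>, since the coordinate \<open>j\<close> is relaxed
  to the reals. Only after this relaxation is Fourier-Motzkin elimination of \<open>j\<close>
  exact.\<close>

definition line_certificate :: "'i set \<Rightarrow> nat set \<Rightarrow> ('i \<Rightarrow> real) pform set \<Rightarrow> nat \<Rightarrow> ('i \<Rightarrow> real) set" where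
  "line_certificate I V F j = {p \<in> aff_space I. \<forall>(N :: nat \<Rightarrow> int) x. \<not> sat V F p ((\<lambda>k. of_int (N k))(j := x))}"

lemma line_certificate_sound:
  assumes "p \<in> line_certificate I V F j" shows "int_free V F p"
  unfolding int_free_def
proof (intro allI notI)
  fix N :: "nat \<Rightarrow> int" assume "sat V F p (\<lambda>k. of_int (N k))"
  then have "sat V F p ((\<lambda>k. of_int (N k))(j := of_int (N j)))" by (simp add: fun_upd_idem)
  then show False using assms unfolding line_certificate_def by blast
qed

lemma sigma_semialg_line_certificate:
  assumes "finite V" "finite F" "\<forall>\<phi>\<in>F. poly_form I V \<phi>" "j \<in> V"
    and IH: "\<And>F. finite F \<Longrightarrow> \<forall>\<phi>\<in>F. poly_form I (V - {j}) \<phi> \<Longrightarrow>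
      sigma_semialg I {p \<in> aff_space I. int_free (V - {j}) F p}"
  shows "sigma_semialg I (line_certificate I V F j)"
proof -
  have "line_certificate I V F j = {p \<in> aff_space I.
      int_free (V - {j}) (fm_elim j F {\<phi>\<in>F. fst \<phi> j p = 0} {\<phi>\<in>F. fst \<phi> j p > 0}) p}"
    unfolding line_certificate_def int_free_def
    by (simp add: fm_elim_correct[OF assms(1,4,2) refl refl, symmetric])
  also have "\<dots> = (\<Union>(Z, Q)\<in>Pow F \<times> Pow F. fm_cond I j F Z Q \<inter>
      {p \<in> aff_space I. int_free (V - {j}) (fm_elim j F Z Q) p})"
    by (rule elim_cases)
  also have "sigma_semialg I \<dots>"
  proof (rule sigma_semialg_UN)
    show "countable (Pow F \<times> Pow F)" using assms(2) by (intro countable_finite) auto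
    fix ZQ assume "ZQ \<in> Pow F \<times> Pow F"
    then obtain Z Q where [simp]: "ZQ = (Z, Q)" and *: "Z \<subseteq> F" "Q \<subseteq> F" by auto
    have "\<forall>\<phi>\<in>fm_elim j F Z Q. poly_form I (V - {j}) \<phi>"
      using poly_form_fm_elim[of F I V j Z Q] assms(3,4) * by blast
    then have "sigma_semialg I {p \<in> aff_space I. int_free (V - {j}) (fm_elim j F Z Q) p}"
      by (rule IH[OF finite_fm_elim[OF assms(2) *]])
    moreover have "fm_cond I j F Z Q \<in> semialgebraic_Q I"
      using semialgebraic_fm_cond[OF assms(2) _ *] assms(3,4) unfolding poly_form_def by blast
    ultimately show "sigma_semialg I (case ZQ of (Z, Q) \<Rightarrow> fm_cond I j F Z Q \<inter>
        {p \<in> aff_space I. int_free (V - {j}) (fm_elim j F Z Q) p})"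
      by (simp add: sigma_semialg_Int sigma_semialg_base)
  qed
  finally show ?thesis .
qed

text \<open>The two kinds of certificate are sound by themselves; the content is that together they
  are complete. Induction on \<open>V\<close> is by proper subsets because the relaxed coordinate
  can be any element of \<open>V\<close>.\<close>

theorem sigma_semialg_int_free:
  fixes I :: "'i set"
  assumes "finite V" "finite F" "\<forall>\<phi>\<in>F. poly_form I V \<phi>"
  shows "sigma_semialg I {p \<in> aff_space I. int_free V F p}"
  using assms
proof (induction V arbitrary: F rule: finite_psubset_induct)
  case (psubset V)
  let ?G = "\<lambda>\<sigma>s. fold (\<lambda>\<sigma> F. op_form \<sigma> ` F) \<sigma>s F"
  have eq: "{p \<in> aff_space I. int_free V F p} = (\<Union>B. box_certificate I V F B) \<union>
      (\<Union>\<sigma>s\<in>lists (elem_ops V). \<Union>j\<in>V. line_certificate I V (?G \<sigma>s) j)" (is "?L = ?R")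
  proof
    show "?L \<subseteq> ?R"
    proof
      fix p assume p: "p \<in> ?L"
      show "p \<in> ?R"
      proof (cases "\<exists>B :: nat. \<forall>y. sat V F p y \<longrightarrow> (\<forall>k\<in>V. \<bar>y k\<bar> \<le> B)")
        case True
        then obtain B :: nat where "\<forall>y. sat V F p y \<longrightarrow> (\<forall>k\<in>V. \<bar>y k\<bar> \<le> B)" ..
        then have "p \<in> box_certificate I V F B"
          using p by (intro box_certificate_complete[OF psubset.hyps(1)]) simp_all
        then show ?thesis by blast
      next
        case False
        then have "\<exists>r. (\<forall>\<phi>\<in>F. pf_lin V \<phi> p r \<ge> 0) \<and> \<not> (\<forall>k\<in>V. r k = 0)"
          using bounded_or_recession[OF psubset.hyps(1), of F p] by blast
        then obtain r k where r: "\<forall>\<phi>\<in>F. pf_lin V \<phi> p r \<ge> 0" "k \<in> V" "r k \<noteq> 0"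
          by auto
        \<comment> \<open>The direction \<open>r\<close> depends on the point, but it enters the
          cover only through \<open>\<sigma>s\<close> and \<open>j\<close>, which range over
          countable sets.\<close>
        obtain \<sigma>s where \<sigma>s: "\<sigma>s \<in> lists (elem_ops V)" "indep_supp V (fold op_vec \<sigma>s r)"
          using make_support_independent[OF psubset.hyps(1)] by blast
        obtain j where j: "j \<in> vec_supp V (fold op_vec \<sigma>s r)"
          using ops_vec_nonzero[OF \<sigma>s(1), of r] r(2,3) by (auto simp: vec_supp_def)
        have "int_free V (?G \<sigma>s) p" using p by (simp add: int_free_ops[OF psubset.hyps(1) \<sigma>s(1)])
        note line = recession_line[OF psubset.hyps(1) finite_ops[OF psubset.prems(1)] this
              recession_ops[OF psubset.hyps(1) \<sigma>s(1) r(1)] \<sigma>s(2) j]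
        have "p \<in> line_certificate I V (?G \<sigma>s) j"
          using p line unfolding line_certificate_def by simp
        moreover have "j \<in> V" using j by (simp add: vec_supp_def)
        ultimately show ?thesis using \<sigma>s(1) by blast
      qed
    qed
    show "?R \<subseteq> ?L"
    proof
      fix p assume "p \<in> ?R"
      then consider B where "p \<in> box_certificate I V F B"
        | \<sigma>s j where "\<sigma>s \<in> lists (elem_ops V)" "p \<in> line_certificate I V (?G \<sigma>s) j" by blast
      then show "p \<in> ?L"
      proof cases
        case 1
        from box_certificate_sound[OF psubset.hyps(1) this] this show ?thesis
          by (simp add: box_certificate_def)
      next
        case 2
        then have "int_free V (?G \<sigma>s) p" by (intro line_certificate_sound)
        then show ?thesis using 2(2)
          by (simp add: line_certificate_def int_free_ops[OF psubset.hyps(1) 2(1)])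
      qed
    qed
  qed
  have "sigma_semialg I (line_certificate I V (?G \<sigma>s) j)" if "\<sigma>s \<in> lists (elem_ops V)" "j \<in> V" for \<sigma>s j
  proof (rule sigma_semialg_line_certificate[OF psubset.hyps(1) finite_ops[OF psubset.prems(1)]
        poly_form_ops[OF that(1) psubset.prems(2)] that(2)])
    fix F' :: "('i \<Rightarrow> real) pform set" assume "finite F'" "\<forall>\<phi>\<in>F'. poly_form I (V - {j}) \<phi>"
    then show "sigma_semialg I {p \<in> aff_space I. int_free (V - {j}) F' p}"
      using that(2) by (intro psubset.IH) auto
  qed
  note line = this
  show ?case
    unfolding eq
  proof (rule sigma_semialg_Un)
    show "sigma_semialg I (\<Union>B. box_certificate I V F B)"
      using psubset.hyps(1) psubset.prems
      by (intro sigma_semialg_UN sigma_semialg_base semialgebraic_box_certificate) auto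
    show "sigma_semialg I (\<Union>\<sigma>s\<in>lists (elem_ops V). \<Union>j\<in>V. line_certificate I V (?G \<sigma>s) j)"
      by (intro sigma_semialg_UN[of "lists (elem_ops V)"] sigma_semialg_UN[of V] line
          countable_finite[OF psubset.hyps(1)]) auto
  qed
qed

section \<open>Definable families of predicates\<close>

definition strict_definable ::
  "'i set \<Rightarrow> nat set \<Rightarrow> (('i \<Rightarrow> real) \<Rightarrow> (nat \<Rightarrow> int) \<Rightarrow> bool) \<Rightarrow> bool" where
  "strict_definable I V P \<longleftrightarrow> (\<exists>D. finite D \<and> (\<forall>F\<in>D. finite F \<and> (\<forall>\<phi>\<in>F. poly_form I V \<phi>)) \<and>
     (\<forall>p\<in>aff_space I. \<forall>N. P p N \<longleftrightarrow> (\<exists>F\<in>D. sat V F p (\<lambda>k. of_int (N k)))))"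

lemma strict_definable_atom:
  assumes "poly_form I V \<phi>"
  shows "strict_definable I V (\<lambda>p N. pf_val V \<phi> p (\<lambda>k. of_int (N k)) > 0)"
  unfolding strict_definable_def by (rule exI[of _ "{{\<phi>}}"]) (simp add: assms sat_def)

lemma strict_definable_const: "strict_definable I V (\<lambda>p N. b)"
  unfolding strict_definable_def by (rule exI[of _ "if b then {{}} else {}"]) (simp add: sat_def)

lemma strict_definable_disj:
  assumes "strict_definable I V P" "strict_definable I V Q"
  shows "strict_definable I V (\<lambda>p N. P p N \<or> Q p N)"
proof -
  obtain D E where
    "finite D" "\<forall>F\<in>D. finite F \<and> (\<forall>\<phi>\<in>F. poly_form I V \<phi>)"
    "\<forall>p\<in>aff_space I. \<forall>N. P p N \<longleftrightarrow> (\<exists>F\<in>D. sat V F p (\<lambda>k. of_int (N k)))"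
    "finite E" "\<forall>F\<in>E. finite F \<and> (\<forall>\<phi>\<in>F. poly_form I V \<phi>)"
    "\<forall>p\<in>aff_space I. \<forall>N. Q p N \<longleftrightarrow> (\<exists>F\<in>E. sat V F p (\<lambda>k. of_int (N k)))"
    using assms unfolding strict_definable_def by (elim exE conjE)
  then show ?thesis
    unfolding strict_definable_def by (intro exI[of _ "D \<union> E"]) (simp add: bex_Un ball_Un)
qed

lemma sat_Un: "sat V (F \<union> F') p y \<longleftrightarrow> sat V F p y \<and> sat V F' p y"
  unfolding sat_def by (rule ball_Un)

lemma strict_definable_conj:
  assumes "strict_definable I V P" "strict_definable I V Q"
  shows "strict_definable I V (\<lambda>p N. P p N \<and> Q p N)"
proof -
  obtain D E where DE:
    "finite D" "\<forall>F\<in>D. finite F \<and> (\<forall>\<phi>\<in>F. poly_form I V \<phi>)"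
    "\<forall>p\<in>aff_space I. \<forall>N. P p N \<longleftrightarrow> (\<exists>F\<in>D. sat V F p (\<lambda>k. of_int (N k)))"
    "finite E" "\<forall>F\<in>E. finite F \<and> (\<forall>\<phi>\<in>F. poly_form I V \<phi>)"
    "\<forall>p\<in>aff_space I. \<forall>N. Q p N \<longleftrightarrow> (\<exists>F\<in>E. sat V F p (\<lambda>k. of_int (N k)))"
    using assms unfolding strict_definable_def by (elim exE conjE)
  let ?C = "case_prod (\<union>) ` (D \<times> E)"
  have C: "(\<exists>F\<in>?C. sat V F p y) \<longleftrightarrow> (\<exists>F\<in>D. sat V F p y) \<and> (\<exists>F\<in>E. sat V F p y)" for p y
    by (auto simp: sat_Un)
  have "\<forall>p\<in>aff_space I. \<forall>N. P p N \<and> Q p N \<longleftrightarrow> (\<exists>F\<in>?C. sat V F p (\<lambda>k. of_int (N k)))"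
    unfolding C using DE(3,6) by simp
  moreover have "finite ?C" "\<forall>F\<in>?C. finite F \<and> (\<forall>\<phi>\<in>F. poly_form I V \<phi>)"
    using DE(1,2,4,5) by auto
  ultimately show ?thesis unfolding strict_definable_def by (intro exI[of _ ?C]) simp
qed

section \<open>Integer-valued affine functions\<close>

definition int_affine :: "nat set \<Rightarrow> ((nat \<Rightarrow> int) \<Rightarrow> int) \<Rightarrow> bool" where
  "int_affine V \<psi> \<longleftrightarrow> (\<exists>c d. \<forall>N. \<psi> N = (\<Sum>k\<in>V. c k * N k) + d)"

lemma int_affine_const: "int_affine V (\<lambda>N. d)"
  unfolding int_affine_def by (intro exI[of _ "\<lambda>_. 0"] exI[of _ d]) simp

lemma int_affine_coord:
  assumes "finite V" "k \<in> V" shows "int_affine V (\<lambda>N. N k)"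
  unfolding int_affine_def
  by (intro exI[of _ "\<lambda>l. if l = k then 1 else 0"] exI[of _ 0])
    (simp add: assms if_distrib[of "\<lambda>z. z * _"] sum.delta cong: if_cong)

lemma int_affine_lin:
  assumes "int_affine V \<psi>" "int_affine V \<psi>'"
  shows "int_affine V (\<lambda>N. a * \<psi> N + b * \<psi>' N)"
proof -
  obtain c d c' d' where "\<And>N. \<psi> N = (\<Sum>k\<in>V. c k * N k) + d" "\<And>N. \<psi>' N = (\<Sum>k\<in>V. c' k * N k) + d'"
    using assms unfolding int_affine_def by blast
  then have "\<forall>N. a * \<psi> N + b * \<psi>' N = (\<Sum>k\<in>V. (a * c k + b * c' k) * N k) + (a * d + b * d')"
    by (simp add: algebra_simps sum.distrib sum_distrib_left)
  then show ?thesis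
    unfolding int_affine_def
    by (intro exI[of _ "\<lambda>k. a * c k + b * c' k"] exI[of _ "a * d + b * d'"])
qed

lemma int_affine_diff:
  assumes "int_affine V \<psi>" "int_affine V \<psi>'" shows "int_affine V (\<lambda>N. \<psi> N - \<psi>' N)"
  using int_affine_lin[OF assms, of 1 "-1"] by simp

lemma int_affine_uminus:
  assumes "int_affine V \<psi>" shows "int_affine V (\<lambda>N. - \<psi> N)"
  using int_affine_lin[OF assms assms, of "-1" 0] by simp

text \<open>Additivity over the integers is linearity: multiples of a unit vector are treated first
  for natural factors, then for negative ones, and finally the unit vectors of \<open>V\<close> are
  summed.\<close>

lemma additive_sum_coords:
  fixes \<psi> :: "(nat \<Rightarrow> int) \<Rightarrow> int"
  assumes V: "finite V" and add: "\<And>N N'. \<psi> (\<lambda>k. N k + N' k) = \<psi> N + \<psi> N'"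
    and cong: "\<And>N N'. (\<And>k. k \<in> V \<Longrightarrow> N k = N' k) \<Longrightarrow> \<psi> N = \<psi> N'"
  shows "\<psi> N = (\<Sum>k\<in>V. \<psi> (\<lambda>l. if l = k then 1 else 0) * N k)"
proof -
  have zero: "\<psi> (\<lambda>_. 0) = 0" using add[of "\<lambda>_. 0" "\<lambda>_. 0"] by simp
  have neg: "\<psi> (\<lambda>k. - N k) = - \<psi> N" for N using add[of N "\<lambda>k. - N k"] zero by simp
  have nat: "\<psi> (\<lambda>l. if l = k then int m else 0) = \<psi> (\<lambda>l. if l = k then 1 else 0) * int m" for k m
  proof (induction m)
    case 0
    then show ?case using zero by (simp cong: if_cong)
  next
    case (Suc m)
    have "(\<lambda>l. if l = k then int (Suc m) else 0) =
        (\<lambda>l. (if l = k then int m else 0) + (if l = k then 1 else 0))" by auto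
    then show ?case using add Suc by (simp add: algebra_simps)
  qed
  have int: "\<psi> (\<lambda>l. if l = k then m else 0) = \<psi> (\<lambda>l. if l = k then 1 else 0) * m" for k m
  proof (cases m)
    case (nonneg n)
    then show ?thesis by (simp only: nat)
  next
    case (neg n)
    have "(\<lambda>l. if l = k then m else 0) = (\<lambda>l. - (if l = k then int (Suc n) else 0))"
      using neg by auto
    then show ?thesis
      by (simp only: \<open>\<And>N. \<psi> (\<lambda>k. - N k) = - \<psi> N\<close> nat neg mult_minus_right)
  qed
  have "\<psi> (\<lambda>l. if l \<in> W then N l else 0) = (\<Sum>k\<in>W. \<psi> (\<lambda>l. if l = k then 1 else 0) * N k)"
    if "finite W" for W
    using that
  proof (induction W)
    case empty
    then show ?case using zero by simp
  next
    case (insert k W)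
    have "(\<lambda>l. if l \<in> insert k W then N l else 0) =
        (\<lambda>l. (if l = k then N k else 0) + (if l \<in> W then N l else 0))"
      using insert.hyps(2) by auto
    then show ?case using add insert int[of k "N k"] by simp
  qed
  from this[OF V] show ?thesis using cong[of N "\<lambda>l. if l \<in> V then N l else 0"] by simp
qed

text \<open>Predicates live on the points \<open>p\<close> of a data space, while polynomials live
  on coordinate vectors; \<open>\<iota>\<close> mediates, so that no particular encoding of points
  is built into the closure properties.\<close>

locale definability =
  fixes I :: "'i set" and V :: "nat set" and \<Sigma> :: "'p set" and \<iota> :: "'p \<Rightarrow> 'i \<Rightarrow> real"
  assumes finite_V: "finite V" and coords_in: "\<And>p. p \<in> \<Sigma> \<Longrightarrow> \<iota> p \<in> aff_space I"
begin

text \<open>The complement is required to be a union of strict systems as well, so that Boolean operations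
  never lead to non-strict inequalities.\<close>

definition definable :: "('p \<Rightarrow> (nat \<Rightarrow> int) \<Rightarrow> bool) \<Rightarrow> bool" where
  "definable P \<longleftrightarrow> (\<exists>A B. strict_definable I V A \<and> strict_definable I V B \<and>
     (\<forall>p\<in>\<Sigma>. \<forall>N. (P p N \<longleftrightarrow> A (\<iota> p) N) \<and> (\<not> P p N \<longleftrightarrow> B (\<iota> p) N)))"

definition poly_on :: "('p \<Rightarrow> real) \<Rightarrow> bool" where
  "poly_on h \<longleftrightarrow> (\<exists>h'. poly_fun I h' \<and> (\<forall>p\<in>\<Sigma>. h p = h' (\<iota> p)))"

definition real_affine :: "('p \<Rightarrow> (nat \<Rightarrow> int) \<Rightarrow> real) \<Rightarrow> bool" where
  "real_affine \<rho> \<longleftrightarrow> (\<exists>\<phi>. poly_form I V \<phi> \<and> (\<forall>p\<in>\<Sigma>. \<forall>N. \<rho> p N = pf_val V \<phi> (\<iota> p) (\<lambda>k. of_int (N k))))"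

lemma definable_cong:
  assumes "definable P" "\<And>p N. p \<in> \<Sigma> \<Longrightarrow> P' p N \<longleftrightarrow> P p N"
  shows "definable P'"
  using assms unfolding definable_def by simp

lemma definable_not:
  assumes "definable P" shows "definable (\<lambda>p N. \<not> P p N)"
proof -
  obtain A B where "strict_definable I V A" "strict_definable I V B"
    "\<forall>p\<in>\<Sigma>. \<forall>N. (P p N \<longleftrightarrow> A (\<iota> p) N) \<and> (\<not> P p N \<longleftrightarrow> B (\<iota> p) N)"
    using assms unfolding definable_def by (elim exE conjE)
  then show ?thesis
    unfolding definable_def by (intro exI[of _ B] exI[of _ A]) blast
qed

lemma definable_const: "definable (\<lambda>p N. b)"
  unfolding definable_def
  by (intro exI[of _ "\<lambda>p N. b"] exI[of _ "\<lambda>p N. \<not> b"]) (simp add: strict_definable_const)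

lemma definable_conj:
  assumes "definable P" "definable Q" shows "definable (\<lambda>p N. P p N \<and> Q p N)"
proof -
  obtain A B A' B' where AB: "strict_definable I V A" "strict_definable I V B"
    "\<forall>p\<in>\<Sigma>. \<forall>N. (P p N \<longleftrightarrow> A (\<iota> p) N) \<and> (\<not> P p N \<longleftrightarrow> B (\<iota> p) N)"
    "strict_definable I V A'" "strict_definable I V B'"
    "\<forall>p\<in>\<Sigma>. \<forall>N. (Q p N \<longleftrightarrow> A' (\<iota> p) N) \<and> (\<not> Q p N \<longleftrightarrow> B' (\<iota> p) N)"
    using assms unfolding definable_def by (elim exE conjE)
  show ?thesis
    unfolding definable_def
  proof (intro exI conjI ballI allI)
    fix p N assume p: "p \<in> \<Sigma>"
    note * = AB(3)[THEN bspec, OF p, THEN spec, of N] AB(6)[THEN bspec, OF p, THEN spec, of N]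
    show "P p N \<and> Q p N \<longleftrightarrow> A (\<iota> p) N \<and> A' (\<iota> p) N" using * by argo
    show "\<not> (P p N \<and> Q p N) \<longleftrightarrow> B (\<iota> p) N \<or> B' (\<iota> p) N" using * by argo
  qed (intro strict_definable_conj strict_definable_disj AB)+
qed

lemma definable_disj:
  assumes "definable P" "definable Q" shows "definable (\<lambda>p N. P p N \<or> Q p N)"
  using definable_not[OF definable_conj[OF definable_not[OF assms(1)] definable_not[OF assms(2)]]]
  by simp

lemma definable_imp:
  assumes "definable P" "definable Q" shows "definable (\<lambda>p N. P p N \<longrightarrow> Q p N)"
  unfolding imp_conv_disj by (rule definable_disj[OF definable_not[OF assms(1)] assms(2)])

lemma definable_ball:
  assumes "finite A" "\<And>a. a \<in> A \<Longrightarrow> definable (Q a)"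
  shows "definable (\<lambda>p N. \<forall>a\<in>A. Q a p N)"
  using assms by (induction A) (simp_all add: definable_const definable_conj)

lemma strict_definable_int_pos:
  assumes "int_affine V \<psi>" shows "strict_definable I V (\<lambda>p N. \<psi> N > 0)"
proof -
  obtain c d where cd: "\<And>N. \<psi> N = (\<Sum>k\<in>V. c k * N k) + d" using assms unfolding int_affine_def by blast
  define \<phi> :: "('i \<Rightarrow> real) pform" where "\<phi> = (\<lambda>k p. of_int (c k), \<lambda>p. of_int d)"
  have "poly_form I V \<phi>" by (simp add: poly_form_def \<phi>_def poly_fun_of_int)
  moreover have "pf_val V \<phi> p (\<lambda>k. of_int (N k)) = of_int (\<psi> N)" for p N
    by (simp add: cd pf_val_def \<phi>_def)
  ultimately show ?thesis using strict_definable_atom[of I V \<phi>] by simp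
qed

text \<open>Integrality supplies the strict negation: \<open>\<psi> N > 0\<close> fails exactly when
  \<open>1 - \<psi> N > 0\<close>.\<close>

lemma definable_int_pos:
  assumes "int_affine V \<psi>" shows "definable (\<lambda>p N. \<psi> N > 0)"
proof -
  have "strict_definable I V (\<lambda>p N. 1 - \<psi> N > 0)"
    by (intro strict_definable_int_pos int_affine_diff int_affine_const assms)
  then show ?thesis
    unfolding definable_def
    by (intro exI[of _ "\<lambda>p N. \<psi> N > 0"] exI[of _ "\<lambda>p N. 1 - \<psi> N > 0"])
      (auto simp: strict_definable_int_pos[OF assms])
qed

lemma definable_int_nonneg:
  assumes "int_affine V \<psi>" shows "definable (\<lambda>p N. \<psi> N \<ge> 0)"
  using definable_not[OF definable_int_pos[OF int_affine_uminus[OF assms]]] by (simp add: not_less)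

lemma definable_int_eq:
  assumes "int_affine V \<psi>" "int_affine V \<psi>'" shows "definable (\<lambda>p N. \<psi> N = \<psi>' N)"
  using definable_conj[OF definable_int_nonneg[OF int_affine_diff[OF assms]]
      definable_int_nonneg[OF int_affine_diff[OF assms(2,1)]]]
  by (rule definable_cong) auto

text \<open>The negation of a strict inequality is strict again except on the zero set of the form.\<close>

lemma definable_real_pos:
  assumes "real_affine \<rho>" "definable (\<lambda>p N. \<rho> p N = 0)"
  shows "definable (\<lambda>p N. \<rho> p N > 0)"
proof -
  obtain \<phi> where \<phi>: "poly_form I V \<phi>"
    "\<And>p N. p \<in> \<Sigma> \<Longrightarrow> \<rho> p N = pf_val V \<phi> (\<iota> p) (\<lambda>k. of_int (N k))"
    using assms(1) unfolding real_affine_def by blast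
  obtain A where A: "strict_definable I V A" "\<forall>p\<in>\<Sigma>. \<forall>N. \<rho> p N = 0 \<longleftrightarrow> A (\<iota> p) N"
    using assms(2) unfolding definable_def by blast
  define \<phi>' :: "('i \<Rightarrow> real) pform" where "\<phi>' = (\<lambda>k p. - fst \<phi> k p, \<lambda>p. - snd \<phi> p)"
  have "poly_form I V \<phi>'" using \<phi>(1) by (auto simp: poly_form_def \<phi>'_def intro!: poly_fun_uminus)
  moreover have "pf_val V \<phi>' p y = - pf_val V \<phi> p y" for p y
    by (simp add: pf_val_def \<phi>'_def sum_negf)
  ultimately have "strict_definable I V (\<lambda>p N. - pf_val V \<phi> p (\<lambda>k. of_int (N k)) > 0)"
    using strict_definable_atom[of I V \<phi>'] by simp
  then have "strict_definable I V (\<lambda>p N. - pf_val V \<phi> p (\<lambda>k. of_int (N k)) > 0 \<or> A p N)"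
    using A(1) by (rule strict_definable_disj)
  then show ?thesis
    unfolding definable_def
  proof (intro exI conjI ballI allI)
    fix p N assume p: "p \<in> \<Sigma>"
    note * = A(2)[THEN bspec, OF p, THEN spec, of N] \<phi>(2)[OF p, of N]
    show "\<rho> p N > 0 \<longleftrightarrow> pf_val V \<phi> (\<iota> p) (\<lambda>k. of_int (N k)) > 0" using *(2) by simp
    show "\<not> \<rho> p N > 0 \<longleftrightarrow> - pf_val V \<phi> (\<iota> p) (\<lambda>k. of_int (N k)) > 0 \<or> A (\<iota> p) N"
      using * by linarith
  qed (rule strict_definable_atom[OF \<phi>(1)])
qed

lemma real_affine_add:
  assumes "real_affine \<rho>" "real_affine \<rho>'" shows "real_affine (\<lambda>p N. \<rho> p N + \<rho>' p N)"
proof -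
  obtain \<phi> \<phi>' where \<phi>: "poly_form I V \<phi>" "poly_form I V \<phi>'"
    "\<forall>p\<in>\<Sigma>. \<forall>N. \<rho> p N = pf_val V \<phi> (\<iota> p) (\<lambda>k. of_int (N k))"
    "\<forall>p\<in>\<Sigma>. \<forall>N. \<rho>' p N = pf_val V \<phi>' (\<iota> p) (\<lambda>k. of_int (N k))"
    using assms unfolding real_affine_def by (elim exE conjE)
  define \<theta> :: "('i \<Rightarrow> real) pform" where "\<theta> = (\<lambda>k p. fst \<phi> k p + fst \<phi>' k p, \<lambda>p. snd \<phi> p + snd \<phi>' p)"
  have "poly_form I V \<theta>" using \<phi>(1,2) by (auto simp: poly_form_def \<theta>_def intro!: poly_fun_add)
  moreover have "\<forall>p\<in>\<Sigma>. \<forall>N. \<rho> p N + \<rho>' p N = pf_val V \<theta> (\<iota> p) (\<lambda>k. of_int (N k))"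
    using \<phi>(3,4) by (simp add: pf_val_def \<theta>_def algebra_simps sum.distrib)
  ultimately show ?thesis unfolding real_affine_def by blast
qed

lemma real_affine_mult:
  assumes "poly_on h" "int_affine V \<psi>" shows "real_affine (\<lambda>p N. of_int (\<psi> N) * h p)"
proof -
  obtain c d where cd: "\<And>N. \<psi> N = (\<Sum>k\<in>V. c k * N k) + d" using assms(2) unfolding int_affine_def by blast
  obtain h' where h': "poly_fun I h'" "\<And>p. p \<in> \<Sigma> \<Longrightarrow> h p = h' (\<iota> p)" using assms(1) unfolding poly_on_def by blast
  define \<theta> :: "('i \<Rightarrow> real) pform" where "\<theta> = (\<lambda>k p. of_int (c k) * h' p, \<lambda>p. of_int d * h' p)"
  have "poly_form I V \<theta>" using h'(1) by (auto simp: poly_form_def \<theta>_def intro!: poly_fun_mult poly_fun_of_int)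
  moreover have "\<forall>p\<in>\<Sigma>. \<forall>N. of_int (\<psi> N) * h p = pf_val V \<theta> (\<iota> p) (\<lambda>k. of_int (N k))"
    using h'(2) by (simp add: pf_val_def \<theta>_def cd algebra_simps sum_distrib_left)
  ultimately show ?thesis unfolding real_affine_def by blast
qed

lemma poly_on_diff:
  assumes "poly_on f" "poly_on g" shows "poly_on (\<lambda>p. f p - g p)"
proof -
  obtain f' g' where "poly_fun I f'" "\<forall>p\<in>\<Sigma>. f p = f' (\<iota> p)" "poly_fun I g'" "\<forall>p\<in>\<Sigma>. g p = g' (\<iota> p)"
    using assms unfolding poly_on_def by blast
  then show ?thesis
    unfolding poly_on_def by (intro exI[of _ "\<lambda>x. f' x - g' x"]) (simp add: poly_fun_diff)
qed

lemma real_affine_poly: "poly_on h \<Longrightarrow> real_affine (\<lambda>p N. h p)"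
  using real_affine_mult[OF _ int_affine_const[of V 1]] by simp

lemma real_affine_sum:
  assumes "finite A" "\<And>a. a \<in> A \<Longrightarrow> real_affine (\<rho> a)"
  shows "real_affine (\<lambda>p N. \<Sum>a\<in>A. \<rho> a p N)"
  using assms
proof (induction A)
  case empty
  have "poly_on (\<lambda>p. 0)" unfolding poly_on_def using poly_fun_of_int[of I 0] by auto
  then show ?case using real_affine_poly[of "\<lambda>p. 0"] by simp
next
  case (insert a A)
  then show ?case using real_affine_add[of "\<rho> a"] by simp
qed

text \<open>The failure of \<open>P\<close> is a finite union of strict systems; \<open>P\<close>
  holds for every \<open>N\<close> exactly when each of these systems is free of integer
  solutions.\<close>

lemma sigma_semialg_definable:
  assumes "definable P"
  shows "\<exists>C. sigma_semialg I C \<and> {p \<in> \<Sigma>. \<forall>N. P p N} = {p \<in> \<Sigma>. \<iota> p \<in> C}"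
proof -
  obtain B where B: "strict_definable I V B" "\<forall>p\<in>\<Sigma>. \<forall>N. \<not> P p N \<longleftrightarrow> B (\<iota> p) N"
    using assms unfolding definable_def by blast
  obtain D where D: "finite D" "\<forall>F\<in>D. finite F \<and> (\<forall>\<phi>\<in>F. poly_form I V \<phi>)"
    "\<forall>p\<in>aff_space I. \<forall>N. B p N \<longleftrightarrow> (\<exists>F\<in>D. sat V F p (\<lambda>k. of_int (N k)))"
    using B(1) unfolding strict_definable_def by (elim exE conjE)
  let ?C = "{p \<in> aff_space I. \<forall>F\<in>D. int_free V F p}"
  have "sigma_semialg I ?C"
    using D(2) by (intro sigma_semialg_ball[OF D(1)] sigma_semialg_int_free[OF finite_V]) auto
  moreover have "(\<forall>N. P p N) \<longleftrightarrow> \<iota> p \<in> ?C" if "p \<in> \<Sigma>" for p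
  proof -
    have "(\<forall>N. P p N) \<longleftrightarrow> (\<forall>N. \<not> B (\<iota> p) N)"
      by (simp add: B(2)[THEN bspec, OF that, THEN spec, symmetric])
    also have "\<dots> \<longleftrightarrow> (\<forall>F\<in>D. int_free V F (\<iota> p))"
      unfolding int_free_def D(3)[THEN bspec, OF coords_in[OF that], THEN spec] by blast
    finally show ?thesis using coords_in[OF that] by simp
  qed
  ultimately show ?thesis by (intro exI[of _ ?C]) auto
qed

end

section \<open>Free quotients of abelian groups\<close>

lemma finite_rooted_tree_induct_down [consumes 2, case_names root child]:
  assumes T: "finite_rooted_tree T r ch" and x: "x \<in> T"
    and root: "P r" and child: "\<And>x y. x \<in> T \<Longrightarrow> y \<in> ch x \<Longrightarrow> P x \<Longrightarrow> P y"
  shows "P x"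
proof -
  have "(r, x) \<in> {(x, z). x \<in> T \<and> z \<in> ch x}\<^sup>*" using T x unfolding finite_rooted_tree_def by blast
  then show ?thesis
  proof (induction rule: rtrancl_induct)
    case (step y z)
    then show ?case using child by blast
  qed (rule root)
qed

lemma finite_rooted_tree_child: "finite_rooted_tree T r ch \<Longrightarrow> x \<in> T \<Longrightarrow> y \<in> ch x \<Longrightarrow> y \<in> T"
  unfolding finite_rooted_tree_def by blast

text \<open>The child relation is acyclic: a cycle through a vertex also passes through its unique
  parent, and nothing enters the root. By finiteness the converse relation is well-founded.\<close>

lemma finite_rooted_tree_induct_up [consumes 2, case_names step]:
  assumes T: "finite_rooted_tree T r ch" and x: "x \<in> T"
    and step: "\<And>x. x \<in> T \<Longrightarrow> (\<And>y. y \<in> ch x \<Longrightarrow> P y) \<Longrightarrow> P x"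
  shows "P x"
proof -
  let ?R = "{(x, z). x \<in> T \<and> z \<in> ch x}"
  have sub: "?R \<subseteq> T \<times> T" using finite_rooted_tree_child[OF T] by blast
  have noroot: "(x, r) \<notin> ?R" for x using T unfolding finite_rooted_tree_def by blast
  have "(y, y) \<notin> ?R\<^sup>+" if "y \<in> T" for y
    using T that
  proof (induction rule: finite_rooted_tree_induct_down)
    case root
    show ?case using noroot by (meson tranclE)
  next
    case (child x y)
    show ?case
    proof
      assume "(y, y) \<in> ?R\<^sup>+"
      then obtain z where z: "(y, z) \<in> ?R\<^sup>*" "(z, y) \<in> ?R" by (meson tranclD2)
      have xy: "(x, y) \<in> ?R" using child.hyps by simp
      moreover have "y \<in> T - {r}" using xy sub noroot by blast
      then have "\<exists>!x. x \<in> T \<and> y \<in> ch x" using T unfolding finite_rooted_tree_def by blast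
      ultimately have "z = x" using z(2) by blast
      then have "(x, x) \<in> ?R\<^sup>+" using rtrancl_into_trancl2[OF xy z(1)] by blast
      then show False using child.IH by contradiction
    qed
  qed
  moreover have "y \<in> T" if "(y, y) \<in> ?R\<^sup>+" for y
    using that by (rule tranclE) (use finite_rooted_tree_child[OF T] in auto)
  ultimately have "acyclic ?R" unfolding acyclic_def by blast
  moreover have "finite ?R"
    using T by (intro finite_subset[OF sub]) (simp add: finite_rooted_tree_def)
  ultimately have "wf (?R\<inverse>)" by (rule finite_acyclic_wf_converse[rotated])
  then have "x \<in> T \<longrightarrow> P x"
  proof (induction x rule: wf_induct_rule)
    case (less x)
    then show ?case using step[of x] finite_rooted_tree_child[OF T] by blast
  qed
  then show ?thesis using x by blast
qed

text \<open>Values in a ring serve both the real homomorphisms of numerical data and the integer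
  coordinates on free quotients.\<close>

lemma (in group) additive_one:
  fixes \<phi> :: "'a \<Rightarrow> 'r :: ring_1"
  assumes "\<And>x y. x \<in> carrier G \<Longrightarrow> y \<in> carrier G \<Longrightarrow> \<phi> (x \<otimes> y) = \<phi> x + \<phi> y"
  shows "\<phi> \<one> = 0"
  using assms[of \<one> \<one>] by simp

lemma (in group) additive_inv:
  fixes \<phi> :: "'a \<Rightarrow> 'r :: ring_1"
  assumes "\<And>x y. x \<in> carrier G \<Longrightarrow> y \<in> carrier G \<Longrightarrow> \<phi> (x \<otimes> y) = \<phi> x + \<phi> y" "x \<in> carrier G"
  shows "\<phi> (inv x) = - \<phi> x"
  using assms(1)[of x "inv x"] additive_one[OF assms(1)] assms(2) by (simp add: eq_neg_iff_add_eq_0 add.commute)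

lemma (in group) additive_int_pow:
  fixes \<phi> :: "'a \<Rightarrow> 'r :: ring_1"
  assumes add: "\<And>x y. x \<in> carrier G \<Longrightarrow> y \<in> carrier G \<Longrightarrow> \<phi> (x \<otimes> y) = \<phi> x + \<phi> y" and x: "x \<in> carrier G"
  shows "\<phi> (x [^] (k :: int)) = of_int k * \<phi> x"
proof -
  have nat: "\<phi> (x [^] (n :: nat)) = of_nat n * \<phi> x" for n
    by (induction n) (simp_all add: additive_one[OF add] add x algebra_simps)
  show ?thesis
  proof (cases k)
    case (nonneg n)
    then show ?thesis using nat[of n] by (simp add: int_pow_int)
  next
    case (neg n)
    have "\<phi> (x [^] k) = \<phi> (inv (x [^] Suc n))"
      unfolding neg by (simp only: int_pow_neg_int[OF x])
    also have "\<dots> = - \<phi> (x [^] Suc n)" by (rule additive_inv[OF add nat_pow_closed[OF x]])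
    also have "\<dots> = of_int k * \<phi> x" unfolding nat neg by (simp add: algebra_simps)
    finally show ?thesis .
  qed
qed

lemma (in comm_group) additive_finprod:
  fixes \<phi> :: "'a \<Rightarrow> 'r :: ring_1"
  assumes add: "\<And>x y. x \<in> carrier G \<Longrightarrow> y \<in> carrier G \<Longrightarrow> \<phi> (x \<otimes> y) = \<phi> x + \<phi> y"
    and "finite A" "\<And>i. i \<in> A \<Longrightarrow> e i \<in> carrier G"
  shows "\<phi> (finprod G e A) = (\<Sum>i\<in>A. \<phi> (e i))"
  using assms(2,3)
proof (induction A)
  case empty
  then show ?case by (simp add: additive_one[OF add])
next
  case (insert a A)
  have "e \<in> A \<rightarrow> carrier G" "e a \<in> carrier G" using insert.prems by auto
  then have "\<phi> (finprod G e (insert a A)) = \<phi> (e a) + \<phi> (finprod G e A)"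
    by (simp add: finprod_insert[OF insert.hyps] add finprod_closed)
  then show ?case using insert.IH[OF insert.prems] insert.hyps by simp
qed

text \<open>Lifts the free generators of \<open>A/H\<close> to elements \<open>e i\<close> and the
  coordinates on \<open>A/H\<close> to additive functions with common kernel \<open>H\<close>. In
  effect \<open>A\<close> is split into \<open>H\<close> and a free part.\<close>

definition quotient_frame ::
  "('g, 'c) monoid_scheme \<Rightarrow> 'g set \<Rightarrow> nat \<Rightarrow> (nat \<Rightarrow> 'g set) \<Rightarrow> (nat \<Rightarrow> 'g) \<Rightarrow> ('g \<Rightarrow> nat \<Rightarrow> int) \<Rightarrow> bool" where
  "quotient_frame A H n gen e c \<longleftrightarrow>
     (\<forall>i<n. e i \<in> carrier A \<and> gen i = H #>\<^bsub>A\<^esub> e i) \<and>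
     (\<forall>u\<in>carrier A. \<forall>v\<in>carrier A. \<forall>i<n. c (u \<otimes>\<^bsub>A\<^esub> v) i = c u i + c v i) \<and>
     (\<forall>u\<in>carrier A. (\<forall>i<n. c u i = 0) \<longleftrightarrow> u \<in> H) \<and>
     (\<forall>i<n. \<forall>j<n. c (e i) j = (if i = j then 1 else 0))"

text \<open>\<open>E\<close> evaluates a tuple of exponents at the generators. It is bijective and
  additive, so the tuple \<open>c u\<close> that it sends to the coset of \<open>u\<close> is
  additive in \<open>u\<close> and vanishes exactly on \<open>H\<close>.\<close>

lemma (in comm_group) quotient_frame_exists:
  assumes H: "subgroup H G" and gen: "free_generators (G Mod H) n gen"
  shows "\<exists>e c. quotient_frame G H n gen e c"
proof -
  interpret H: normal H G by (rule subgroup_imp_normal[OF H])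
  interpret Q: comm_group "G Mod H" by (rule abelian_FactGroup[OF H])
  define E where "E k = finprod (G Mod H) (\<lambda>i. gen i [^]\<^bsub>G Mod H\<^esub> (k i :: int)) {..<n}" for k
  let ?K = "{..<n} \<rightarrow>\<^sub>E (UNIV :: int set)"
  have genQ: "gen i \<in> carrier (G Mod H)" if "i < n" for i
    using gen that unfolding free_generators_def by blast
  have bij: "bij_betw E ?K (carrier (G Mod H))"
    using gen unfolding free_generators_def E_def by blast
  have cos: "H #> u \<in> carrier (G Mod H)" if "u \<in> carrier G" for u
    using that by (simp add: carrier_FactGroup)
  have ex: "\<exists>e. e \<in> carrier G \<and> gen i = H #> e" if "i < n" for i
    using genQ[OF that] by (auto simp: carrier_FactGroup)
  define e where "e i = (SOME e. e \<in> carrier G \<and> gen i = H #> e)" for i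
  have e: "e i \<in> carrier G" "gen i = H #> e i" if "i < n" for i
    using someI_ex[OF ex[OF that]] unfolding e_def by auto
  have exc: "\<exists>k. k \<in> ?K \<and> E k = H #> u" if "u \<in> carrier G" for u
  proof -
    have "H #> u \<in> E ` ?K" using bij cos[OF that] unfolding bij_betw_def by simp
    then obtain k where "H #> u = E k" "k \<in> ?K" by (rule imageE)
    then show ?thesis by (intro exI[of _ k]) simp
  qed
  define c where "c u = (SOME k. k \<in> ?K \<and> E k = H #> u)" for u
  have c: "c u \<in> ?K" "E (c u) = H #> u" if "u \<in> carrier G" for u
    using someI_ex[OF exc[OF that]] unfolding c_def by simp_all
  have Einj: "k = l" if "k \<in> ?K" "l \<in> ?K" "E k = E l" for k l
    using bij that unfolding bij_betw_def inj_on_def by blast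
  have Ecl: "(\<lambda>i. gen i [^]\<^bsub>G Mod H\<^esub> (k i :: int)) \<in> {..<n} \<rightarrow> carrier (G Mod H)" for k
    using genQ by (auto intro: Q.int_pow_closed)
  have Eadd: "E (\<lambda>i\<in>{..<n}. k i + l i) = E k \<otimes>\<^bsub>G Mod H\<^esub> E l" for k l
  proof -
    have "E k \<otimes>\<^bsub>G Mod H\<^esub> E l = finprod (G Mod H) (\<lambda>i. gen i [^]\<^bsub>G Mod H\<^esub> k i \<otimes>\<^bsub>G Mod H\<^esub> gen i [^]\<^bsub>G Mod H\<^esub> l i) {..<n}"
      unfolding E_def by (rule Q.finprod_multf[symmetric]) (use Ecl in auto)
    also have "\<dots> = E (\<lambda>i\<in>{..<n}. k i + l i)"
      unfolding E_def by (rule Q.finprod_cong') (use genQ Ecl in \<open>auto simp: Q.int_pow_mult intro: Q.int_pow_closed\<close>)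
    finally show ?thesis ..
  qed
  have E0: "E (\<lambda>i\<in>{..<n}. 0) = H"
  proof -
    have "E (\<lambda>i\<in>{..<n}. 0) = finprod (G Mod H) (\<lambda>i. \<one>\<^bsub>G Mod H\<^esub>) {..<n}"
      unfolding E_def by (rule Q.finprod_cong') (use Q.one_closed in auto)
    then show ?thesis unfolding Q.finprod_one by (simp only: one_FactGroup)
  qed
  have E1: "E (\<lambda>j\<in>{..<n}. if i = j then 1 else 0) = gen i" if "i < n" for i
  proof -
    have "E (\<lambda>j\<in>{..<n}. if i = j then 1 else 0) = finprod (G Mod H) (\<lambda>j. if i = j then gen j else \<one>\<^bsub>G Mod H\<^esub>) {..<n}"
      unfolding E_def
      by (rule Q.finprod_cong') (use genQ Q.one_closed in auto)
    also have "\<dots> = gen i" by (rule Q.finprod_singleton) (use genQ that in auto)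
    finally show ?thesis .
  qed
  have "quotient_frame G H n gen e c"
    unfolding quotient_frame_def
  proof (intro conjI allI impI ballI)
    fix u v i assume uv: "u \<in> carrier G" "v \<in> carrier G" and i: "i < n"
    have "E (c (u \<otimes> v)) = E (\<lambda>i\<in>{..<n}. c u i + c v i)"
      unfolding Eadd using uv by (simp add: c H.rcos_sum)
    then have "c (u \<otimes> v) = (\<lambda>i\<in>{..<n}. c u i + c v i)"
      by (rule Einj[rotated 2]) (use uv c(1) in auto)
    then show "c (u \<otimes> v) i = c u i + c v i" using i by simp
  next
    fix u assume u: "u \<in> carrier G"
    have "(\<forall>i<n. c u i = 0) \<longleftrightarrow> c u = (\<lambda>i\<in>{..<n}. 0)"
      using c(1)[OF u] by (auto simp: PiE_def extensional_def fun_eq_iff)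
    also have "\<dots> \<longleftrightarrow> H #> u = H"
      using Einj[OF c(1)[OF u], of "\<lambda>i\<in>{..<n}. 0"] c(2)[OF u] E0 by auto
    also have "\<dots> \<longleftrightarrow> u \<in> H" using coset_join1[OF _ u H] coset_join2[OF u H] by blast
    finally show "(\<forall>i<n. c u i = 0) \<longleftrightarrow> u \<in> H" .
  next
    fix i j assume ij: "i < n" "j < n"
    have "E (c (e i)) = E (\<lambda>j\<in>{..<n}. if i = j then 1 else 0)"
      using E1[OF ij(1)] c(2) e[OF ij(1)] by simp
    then have "c (e i) = (\<lambda>j\<in>{..<n}. if i = j then 1 else 0)"
      by (rule Einj[rotated 2]) (use c(1) e(1)[OF ij(1)] in auto)
    then show "c (e i) j = (if i = j then 1 else 0)" using ij by simp
  qed (use e in auto)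
  then show ?thesis by blast
qed

context comm_group
begin

context
  fixes H n gen e c
  assumes H: "subgroup H G" and fr: "quotient_frame G H n gen e c"
begin

definition frame_section :: "(nat \<Rightarrow> int) \<Rightarrow> 'a" where
  "frame_section k = finprod G (\<lambda>i. e i [^] k i) {..<n}"

lemma frame_e: "i < n \<Longrightarrow> e i \<in> carrier G"
  using fr unfolding quotient_frame_def by blast

lemma frame_add: "i < n \<Longrightarrow> u \<in> carrier G \<Longrightarrow> v \<in> carrier G \<Longrightarrow> c (u \<otimes> v) i = c u i + c v i"
  using fr unfolding quotient_frame_def by blast

lemma frame_kernel: "u \<in> carrier G \<Longrightarrow> (\<forall>i<n. c u i = 0) \<longleftrightarrow> u \<in> H"
  using fr unfolding quotient_frame_def by blast

lemma frame_delta: "i < n \<Longrightarrow> j < n \<Longrightarrow> c (e i) j = (if i = j then 1 else 0)"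
  using fr unfolding quotient_frame_def by blast

lemma frame_section_closed: "frame_section k \<in> carrier G"
  unfolding frame_section_def by (rule finprod_closed) (auto intro: frame_e int_pow_closed)

lemma additive_frame_section:
  fixes \<phi> :: "'a \<Rightarrow> 'r :: ring_1"
  assumes add: "\<And>x y. x \<in> carrier G \<Longrightarrow> y \<in> carrier G \<Longrightarrow> \<phi> (x \<otimes> y) = \<phi> x + \<phi> y"
  shows "\<phi> (frame_section k) = (\<Sum>i<n. of_int (k i) * \<phi> (e i))"
proof -
  have "\<phi> (frame_section k) = (\<Sum>i<n. \<phi> (e i [^] k i))"
    unfolding frame_section_def by (rule additive_finprod[OF add]) (auto intro: frame_e int_pow_closed)
  also have "\<dots> = (\<Sum>i<n. of_int (k i) * \<phi> (e i))"
    by (rule sum.cong) (auto simp: additive_int_pow[OF add frame_e])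
  finally show ?thesis .
qed

lemma frame_section_coord:
  assumes "j < n" shows "c (frame_section k) j = k j"
proof -
  have "c (frame_section k) j = (\<Sum>i<n. k i * c (e i) j)"
    using additive_frame_section[of "\<lambda>u. c u j" k] frame_add[OF assms] by simp
  also have "\<dots> = (\<Sum>i<n. if i = j then k i else 0)"
    by (rule sum.cong) (simp_all add: frame_delta assms)
  finally show ?thesis using assms by simp
qed

lemma frame_residue:
  assumes u: "u \<in> carrier G" shows "u \<otimes> inv (frame_section (c u)) \<in> H"
proof -
  have "c (u \<otimes> inv (frame_section (c u))) i = 0" if "i < n" for i
  proof -
    have "c (inv (frame_section (c u))) i = - c (frame_section (c u)) i"
      by (rule additive_inv[of "\<lambda>u. c u i"]) (use frame_add[OF that] frame_section_closed in auto)
    then show ?thesis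
      using frame_add[OF that u inv_closed[OF frame_section_closed]] frame_section_coord[OF that] by simp
  qed
  then show ?thesis using frame_kernel[of "u \<otimes> inv (frame_section (c u))"] u frame_section_closed by simp
qed

text \<open>An additive function that kills \<open>H\<close> does not see the residue of
  \<open>u\<close>, so the lifted generators determine it.\<close>

lemma additive_frame:
  fixes \<phi> :: "'a \<Rightarrow> 'r :: ring_1"
  assumes add: "\<And>x y. x \<in> carrier G \<Longrightarrow> y \<in> carrier G \<Longrightarrow> \<phi> (x \<otimes> y) = \<phi> x + \<phi> y"
    and ker: "\<And>h. h \<in> H \<Longrightarrow> \<phi> h = 0" and u: "u \<in> carrier G"
  shows "\<phi> u = (\<Sum>i<n. of_int (c u i) * \<phi> (e i))"
proof -
  have "\<phi> (u \<otimes> inv (frame_section (c u))) = 0" by (rule ker[OF frame_residue[OF u]])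
  then have "\<phi> u = \<phi> (frame_section (c u))"
    using add[OF u inv_closed[OF frame_section_closed]] additive_inv[OF add frame_section_closed] by simp
  then show ?thesis using additive_frame_section[OF add] by simp
qed

end

end

section \<open>The preorder of a preotree\<close>

locale framed_preotree =
  fixes G :: "('g, 'c) monoid_scheme" (structure) and act :: "'g \<Rightarrow> 'm \<Rightarrow> 'm" and M :: "'m set"
    and \<tau> :: "('w, 'g, 'm) preotree" and gen :: "'w \<Rightarrow> nat \<Rightarrow> 'g set" and enum :: "'w \<Rightarrow> nat \<Rightarrow> 'w"
  assumes preotree: "preotree_on G act M \<tau>" and framed: "data_frame G \<tau> gen enum"
begin

abbreviation "ch \<equiv> po_children \<tau>"
abbreviation "Gv \<equiv> po_grp \<tau>"
abbreviation "Mv \<equiv> po_set \<tau>"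

text \<open>For a non-leaf all children carry the same group; the union names it without selecting a
  child.\<close>

definition kern :: "'w \<Rightarrow> 'g set" where
  "kern v = (\<Union>w\<in>ch v. Gv w)"

sublocale comm_group G
  using preotree unfolding preotree_on_def by blast

lemma tree: "finite_rooted_tree (po_verts \<tau>) (po_root \<tau>) ch"
  using preotree unfolding preotree_on_def by (elim conjE)

lemma vertex_axioms:
  "\<forall>v\<in>po_verts \<tau>. saturated (Gv v) G \<and> Mv v \<subseteq> M \<and> (\<forall>u\<in>Gv v. act u ` Mv v \<subseteq> Mv v)"
  using preotree unfolding preotree_on_def by (elim conjE)

lemma child_axioms:
  "\<forall>v\<in>po_verts \<tau>. \<forall>w\<in>ch v. Mv w \<subseteq> Mv v \<and> saturated (Gv w) (grp_at G \<tau> v) \<and>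
     (\<forall>s\<in>Mv v. stabilizer (grp_at G \<tau> v) act s \<subseteq> Gv w)"
  using preotree unfolding preotree_on_def by (elim conjE)

lemma children_axioms:
  "\<forall>v\<in>po_verts \<tau>. ch v \<noteq> {} \<longrightarrow> (\<exists>H. (\<forall>w\<in>ch v. Gv w = H) \<and>
     (\<forall>s\<in>Mv v. \<exists>t\<in>Mv v. (\<Union>w\<in>ch v. Mv w) \<inter> orbit (grp_at G \<tau> v) act s = orbit (restr G H) act t)) \<and>
     disjoint_family_on Mv (ch v)"
  using preotree unfolding preotree_on_def by (elim conjE)

lemma nonleafD: "v \<in> po_nonleaves \<tau> \<Longrightarrow> v \<in> po_verts \<tau>" "v \<in> po_nonleaves \<tau> \<Longrightarrow> ch v \<noteq> {}"
  unfolding po_nonleaves_def by auto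

lemma child_vert: "v \<in> po_verts \<tau> \<Longrightarrow> w \<in> ch v \<Longrightarrow> w \<in> po_verts \<tau>"
  by (rule finite_rooted_tree_child[OF tree])

lemma root_vert: "po_root \<tau> \<in> po_verts \<tau>"
  using tree unfolding finite_rooted_tree_def by blast

lemma action: "monoid_action G act M"
  using preotree unfolding preotree_on_def fg_action_def by blast

lemma act_one: "s \<in> M \<Longrightarrow> act \<one> s = s"
  using action unfolding monoid_action_def by blast

lemma act_mult: "u \<in> carrier G \<Longrightarrow> u' \<in> carrier G \<Longrightarrow> s \<in> M \<Longrightarrow> act (u \<otimes> u') s = act u (act u' s)"
  using action unfolding monoid_action_def by blast

lemma act_closed: "u \<in> carrier G \<Longrightarrow> s \<in> M \<Longrightarrow> act u s \<in> M"
  using action unfolding monoid_action_def by blast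

lemma Gv_subgroup: "v \<in> po_verts \<tau> \<Longrightarrow> subgroup (Gv v) G"
  using vertex_axioms unfolding saturated_def by simp

lemma Gv_closed: "v \<in> po_verts \<tau> \<Longrightarrow> u \<in> Gv v \<Longrightarrow> u \<in> carrier G"
  using Gv_subgroup subgroup.mem_carrier by fast

lemma Gv_mult: "v \<in> po_verts \<tau> \<Longrightarrow> u \<in> Gv v \<Longrightarrow> u' \<in> Gv v \<Longrightarrow> u \<otimes> u' \<in> Gv v"
  using Gv_subgroup subgroup.m_closed by fast

lemma Gv_inv: "v \<in> po_verts \<tau> \<Longrightarrow> u \<in> Gv v \<Longrightarrow> inv u \<in> Gv v"
  using Gv_subgroup subgroup.m_inv_closed by fast

lemma Gv_one: "v \<in> po_verts \<tau> \<Longrightarrow> \<one> \<in> Gv v"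
  using Gv_subgroup subgroup.one_closed by fast

lemma Mv_sub: "v \<in> po_verts \<tau> \<Longrightarrow> s \<in> Mv v \<Longrightarrow> s \<in> M"
  using vertex_axioms by blast

lemma Mv_act: "v \<in> po_verts \<tau> \<Longrightarrow> u \<in> Gv v \<Longrightarrow> s \<in> Mv v \<Longrightarrow> act u s \<in> Mv v"
  using vertex_axioms by (simp add: image_subset_iff)

lemma Mv_child: "v \<in> po_verts \<tau> \<Longrightarrow> w \<in> ch v \<Longrightarrow> s \<in> Mv w \<Longrightarrow> s \<in> Mv v"
  using child_axioms by blast

lemma root_simps: "Gv (po_root \<tau>) = carrier G" "Mv (po_root \<tau>) = M"
  using preotree unfolding preotree_on_def by simp_all

lemma act_mult_v: "v \<in> po_verts \<tau> \<Longrightarrow> u \<in> Gv v \<Longrightarrow> u' \<in> Gv v \<Longrightarrow> s \<in> Mv v \<Longrightarrow>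
    act (u \<otimes> u') s = act u (act u' s)"
  by (rule act_mult) (auto intro: Gv_closed Mv_sub)

lemma carrier_restr: "carrier (restr G K) = K" "x \<otimes>\<^bsub>restr G K\<^esub> y = x \<otimes> y" "\<one>\<^bsub>restr G K\<^esub> = \<one>"
  unfolding restr_def by simp_all

lemma Gv_group: "v \<in> po_verts \<tau> \<Longrightarrow> comm_group (grp_at G \<tau> v)"
  unfolding restr_def
  by (rule group.group_comm_groupI[OF subgroup.subgroup_is_group[OF Gv_subgroup is_group]])
    (auto simp: m_comm Gv_closed)

lemma inv_restr: "v \<in> po_verts \<tau> \<Longrightarrow> u \<in> Gv v \<Longrightarrow> inv\<^bsub>grp_at G \<tau> v\<^esub> u = inv u"
  unfolding restr_def by (rule m_inv_consistent[OF Gv_subgroup])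

lemma child_data:
  assumes "v \<in> po_nonleaves \<tau>"
  shows "\<And>w. w \<in> ch v \<Longrightarrow> Gv w = kern v"
    and "\<And>s. s \<in> Mv v \<Longrightarrow> \<exists>t\<in>Mv v. (\<Union>w\<in>ch v. Mv w) \<inter> orbit (grp_at G \<tau> v) act s = orbit (restr G (kern v)) act t"
    and "disjoint_family_on Mv (ch v)"
proof -
  obtain H where H: "\<forall>w\<in>ch v. Gv w = H"
    "\<forall>s\<in>Mv v. \<exists>t\<in>Mv v. (\<Union>w\<in>ch v. Mv w) \<inter> orbit (grp_at G \<tau> v) act s = orbit (restr G H) act t"
    "disjoint_family_on Mv (ch v)"
    using children_axioms[THEN bspec, OF nonleafD(1)[OF assms]] nonleafD(2)[OF assms] by blast
  have "kern v = H" using H(1) nonleafD[OF assms] unfolding kern_def by auto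
  then show "\<And>w. w \<in> ch v \<Longrightarrow> Gv w = kern v"
    "\<And>s. s \<in> Mv v \<Longrightarrow> \<exists>t\<in>Mv v. (\<Union>w\<in>ch v. Mv w) \<inter> orbit (grp_at G \<tau> v) act s = orbit (restr G (kern v)) act t"
    "disjoint_family_on Mv (ch v)"
    using H by blast+
qed

lemma kern_subgroup: "v \<in> po_nonleaves \<tau> \<Longrightarrow> subgroup (kern v) (grp_at G \<tau> v)"
proof -
  assume v: "v \<in> po_nonleaves \<tau>"
  then obtain w where w: "w \<in> ch v" using nonleafD by blast
  then have "subgroup (Gv w) (grp_at G \<tau> v)"
    using child_axioms nonleafD(1)[OF v] unfolding saturated_def by simp
  then show "subgroup (kern v) (grp_at G \<tau> v)" using child_data(1)[OF v w] by simp
qed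

lemma kern_sub: "v \<in> po_nonleaves \<tau> \<Longrightarrow> u \<in> kern v \<Longrightarrow> u \<in> Gv v"
  using subgroup.mem_carrier[OF kern_subgroup, of v u] by (simp add: carrier_restr)

lemma stabilizer_kern:
  assumes "v \<in> po_nonleaves \<tau>" "s \<in> Mv v" "u \<in> Gv v" "act u s = s"
  shows "u \<in> kern v"
proof -
  obtain w where w: "w \<in> ch v" using nonleafD(2)[OF assms(1)] by blast
  have "stabilizer (grp_at G \<tau> v) act s \<subseteq> Gv w"
    using child_axioms nonleafD(1)[OF assms(1)] w assms(2) by simp
  then show ?thesis
    using assms child_data(1)[OF assms(1) w] by (auto simp: stabilizer_def carrier_restr)
qed

section \<open>Translating elements into the sets of the children\<close>

lemma mem_orbit: "x \<in> orbit (restr G K) act s \<longleftrightarrow> (\<exists>u\<in>K. x = act u s)"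
  by (auto simp: orbit_def carrier_restr)

lemma reach:
  assumes "v \<in> po_nonleaves \<tau>" "s \<in> Mv v"
  shows "\<exists>u\<in>Gv v. \<exists>w\<in>ch v. act u s \<in> Mv w"
proof -
  obtain t where t: "t \<in> Mv v"
    "(\<Union>w\<in>ch v. Mv w) \<inter> orbit (grp_at G \<tau> v) act s = orbit (restr G (kern v)) act t"
    using child_data(2)[OF assms] by blast
  have "\<one> \<in> kern v" using subgroup.one_closed[OF kern_subgroup[OF assms(1)]] by (simp add: carrier_restr)
  then have "act \<one> t \<in> (\<Union>w\<in>ch v. Mv w) \<inter> orbit (grp_at G \<tau> v) act s"
    unfolding t(2) mem_orbit by blast
  then obtain w u where "w \<in> ch v" "act \<one> t \<in> Mv w" "u \<in> Gv v" "act \<one> t = act u s"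
    unfolding Int_iff mem_orbit by blast
  then show ?thesis by (intro bexI[of _ u] bexI[of _ w]) simp_all
qed

text \<open>Both translates of \<open>s\<close> lie in one orbit of the kernel, so they differ by
  some \<open>k\<close> in it, which preserves \<open>Mv w\<close>. Then
  \<open>inv k \<otimes> (u' \<otimes> inv u)\<close> fixes \<open>act u s\<close>, and stabilisers
  lie in the kernel.\<close>

lemma reach_unique:
  assumes v: "v \<in> po_nonleaves \<tau>" and s: "s \<in> Mv v"
    and u: "u \<in> Gv v" "w \<in> ch v" "act u s \<in> Mv w" and u': "u' \<in> Gv v" "w' \<in> ch v" "act u' s \<in> Mv w'"
  shows "w' = w" "u' \<otimes> inv u \<in> kern v"
proof -
  note vv = nonleafD(1)[OF v]
  note w = child_vert[OF vv u(2)]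
  note Hw = child_data(1)[OF v u(2)]
  obtain t where t: "t \<in> Mv v"
    "(\<Union>w\<in>ch v. Mv w) \<inter> orbit (grp_at G \<tau> v) act s = orbit (restr G (kern v)) act t"
    using child_data(2)[OF v s] by blast
  have "act u s \<in> (\<Union>w\<in>ch v. Mv w) \<inter> orbit (grp_at G \<tau> v) act s"
    "act u' s \<in> (\<Union>w\<in>ch v. Mv w) \<inter> orbit (grp_at G \<tau> v) act s"
    unfolding Int_iff mem_orbit using u u' by blast+
  then obtain h h' where h: "h \<in> kern v" "act u s = act h t" "h' \<in> kern v" "act u' s = act h' t"
    unfolding t(2) mem_orbit by blast
  have hG: "h \<in> Gv v" "h' \<in> Gv v" "h \<in> carrier G" "h' \<in> carrier G"
    using h kern_sub[OF v] Gv_closed[OF vv] by blast+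
  have uG: "u \<in> carrier G" "u' \<in> carrier G" using u u' Gv_closed[OF vv] by blast+
  define k where "k = h' \<otimes> inv h"
  have k: "k \<in> kern v" using h Gv_mult[OF w] Gv_inv[OF w] unfolding Hw k_def by blast
  have kG: "k \<in> Gv v" "k \<in> carrier G" using k kern_sub[OF v] Gv_closed[OF vv] by blast+
  have tM: "t \<in> M" "s \<in> M" using Mv_sub[OF vv] t(1) s by blast+
  have "act k (act u s) = act (k \<otimes> h) t" unfolding h(2) by (rule act_mult[symmetric]) (fact kG hG tM)+
  also have "k \<otimes> h = h'" using hG by (simp add: k_def m_assoc)
  finally have ku: "act k (act u s) = act u' s" unfolding h(4) .
  then have "act u' s \<in> Mv w" using Mv_act[OF w _ u(3), of k] k Hw by simp
  then show "w' = w" using child_data(3)[OF v] u(2) u'(2,3) unfolding disjoint_family_on_def by blast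
  define x where "x = inv k \<otimes> (u' \<otimes> inv u)"
  have x: "x \<in> Gv v" unfolding x_def using kG(1) u(1) u'(1) by (intro Gv_mult[OF vv] Gv_inv[OF vv])
  have us: "act u s \<in> Mv v" using Mv_act[OF vv u(1) s] .
  have "act x (act u s) = act (x \<otimes> u) s" by (rule act_mult_v[OF vv x u(1) s, symmetric])
  also have "x \<otimes> u = inv k \<otimes> u'" using kG uG by (simp add: x_def m_assoc)
  also have "act (inv k \<otimes> u') s = act (inv k) (act u' s)" by (rule act_mult) (use kG uG tM in auto)
  also have "\<dots> = act (inv k) (act k (act u s))" unfolding ku ..
  also have "\<dots> = act (inv k \<otimes> k) (act u s)" by (rule act_mult[symmetric]) (use kG uG tM act_closed in auto)
  also have "\<dots> = act u s" using kG act_one act_closed[OF uG(1) tM(2)] by simp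
  finally have "x \<in> kern v" by (rule stabilizer_kern[OF v us x])
  then have "k \<otimes> x \<in> kern v" using k Gv_mult[OF w] unfolding Hw by blast
  moreover have "k \<otimes> x = u' \<otimes> inv u" using kG uG by (simp add: x_def m_assoc[symmetric])
  ultimately show "u' \<otimes> inv u \<in> kern v" by simp
qed

lemma kern_shift:
  assumes v: "v \<in> po_nonleaves \<tau>" and s: "s \<in> Mv v" and u: "u \<in> Gv v" "u' \<in> Gv v"
  shows "act u' s = act (u' \<otimes> inv u) (act u s)"
proof -
  note vv = nonleafD(1)[OF v]
  have "act (u' \<otimes> inv u) (act u s) = act (u' \<otimes> inv u \<otimes> u) s"
    by (rule act_mult_v[OF vv _ u(1) s, symmetric]) (intro Gv_mult[OF vv] Gv_inv[OF vv] u)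
  also have "u' \<otimes> inv u \<otimes> u = u'" using u Gv_closed[OF vv] by (simp add: m_assoc)
  finally show ?thesis ..
qed

section \<open>The preorder belonging to one choice of numerical data\<close>

context
  fixes f g assumes nd: "numerical_data G act \<tau> f g"
begin

lemma nd_axioms:
  assumes "v \<in> po_nonleaves \<tau>"
  shows "\<forall>u\<in>Gv v. \<forall>s\<in>Mv v. g v (act u s) = f v u + g v s"
    and "\<forall>w\<in>ch v. Gv w = kernel (grp_at G \<tau> v) real_add_group (f v) \<and> (\<exists>c. \<forall>s\<in>Mv w. g v s = c)"
    and "\<forall>w\<in>ch v. \<forall>w'\<in>ch v. w \<noteq> w' \<longrightarrow> (\<forall>s\<in>Mv w. \<forall>t\<in>Mv w'. g v s - g v t \<notin> f v ` Gv v)"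
proof -
  note * = nd[unfolded numerical_data_def, THEN bspec, OF assms]
  from * show "\<forall>u\<in>Gv v. \<forall>s\<in>Mv v. g v (act u s) = f v u + g v s" by (elim conjE)
  from * show "\<forall>w\<in>ch v. Gv w = kernel (grp_at G \<tau> v) real_add_group (f v) \<and> (\<exists>c. \<forall>s\<in>Mv w. g v s = c)"
    by (elim conjE)
  from * show "\<forall>w\<in>ch v. \<forall>w'\<in>ch v. w \<noteq> w' \<longrightarrow> (\<forall>s\<in>Mv w. \<forall>t\<in>Mv w'. g v s - g v t \<notin> f v ` Gv v)"
    by (elim conjE)
qed

lemma nd_hom: "v \<in> po_nonleaves \<tau> \<Longrightarrow> u \<in> Gv v \<Longrightarrow> u' \<in> Gv v \<Longrightarrow> f v (u \<otimes> u') = f v u + f v u'"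
  using nd unfolding numerical_data_def hom_def by (simp add: carrier_restr real_add_group_def)

lemma nd_act: "v \<in> po_nonleaves \<tau> \<Longrightarrow> u \<in> Gv v \<Longrightarrow> s \<in> Mv v \<Longrightarrow> g v (act u s) = f v u + g v s"
  using nd_axioms(1) by blast

lemma nd_kernel:
  assumes "v \<in> po_nonleaves \<tau>" shows "kern v = {u \<in> Gv v. f v u = 0}"
proof -
  obtain w where w: "w \<in> ch v" using nonleafD(2)[OF assms] by blast
  then have "Gv w = kernel (grp_at G \<tau> v) real_add_group (f v)"
    using nd_axioms(2)[OF assms] by simp
  then show ?thesis using child_data(1)[OF assms w] by (simp add: kernel_def carrier_restr real_add_group_def)
qed

lemma nd_const: "v \<in> po_nonleaves \<tau> \<Longrightarrow> w \<in> ch v \<Longrightarrow> s \<in> Mv w \<Longrightarrow> t \<in> Mv w \<Longrightarrow> g v s = g v t"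
  using nd_axioms(2)[of v] by metis

lemma nd_distinct: "v \<in> po_nonleaves \<tau> \<Longrightarrow> w \<in> ch v \<Longrightarrow> w' \<in> ch v \<Longrightarrow> w \<noteq> w' \<Longrightarrow> s \<in> Mv w \<Longrightarrow>
    t \<in> Mv w' \<Longrightarrow> u \<in> Gv v \<Longrightarrow> g v s - g v t \<noteq> f v u"
  using nd_axioms(3)[of v] by blast

lemma group_v: "v \<in> po_verts \<tau> \<Longrightarrow> group (grp_at G \<tau> v)"
  using Gv_group comm_group.axioms(2) by blast

lemma nd_inv:
  assumes v: "v \<in> po_nonleaves \<tau>" and u: "u \<in> Gv v" shows "f v (inv u) = - f v u"
proof -
  have "f v (inv\<^bsub>grp_at G \<tau> v\<^esub> u) = - f v u"
    by (rule group.additive_inv[OF group_v[OF nonleafD(1)[OF v]]]) (auto simp: carrier_restr nd_hom v u)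
  then show ?thesis using inv_restr[OF nonleafD(1)[OF v] u] by simp
qed

text \<open>Let \<open>u'\<close> carry \<open>t\<close> into a child set. The heights of
  \<open>act u s\<close> and \<open>act u' t\<close> differ by a value of \<open>f v\<close>, so
  distinct children are excluded; the heights then agree, and \<open>u \<otimes> inv u'\<close> lies
  in the kernel, which preserves the child set.\<close>

lemma same_height:
  assumes v: "v \<in> po_nonleaves \<tau>" and st: "s \<in> Mv v" "t \<in> Mv v" "g v s = g v t"
    and u: "u \<in> Gv v" "w \<in> ch v" "act u s \<in> Mv w"
  shows "act u t \<in> Mv w"
proof -
  note vv = nonleafD(1)[OF v]
  obtain u' w' where u': "u' \<in> Gv v" "w' \<in> ch v" "act u' t \<in> Mv w'" using reach[OF v st(2)] by blast
  have eq: "g v (act u s) - g v (act u' t) = f v (u \<otimes> inv u')"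
    using nd_act[OF v u(1) st(1)] nd_act[OF v u'(1) st(2)] st(3)
      nd_hom[OF v u(1) Gv_inv[OF vv u'(1)]] nd_inv[OF v u'(1)] by simp
  have uu: "u \<otimes> inv u' \<in> Gv v" by (intro Gv_mult[OF vv] Gv_inv[OF vv] u u')
  have w: "w = w'" using nd_distinct[OF v u(2) u'(2) _ u(3) u'(3) uu] eq by blast
  then have "f v (u \<otimes> inv u') = 0" using eq nd_const[OF v u(2,3), of "act u' t"] u'(3) by simp
  then have "u \<otimes> inv u' \<in> Gv w'" using uu nd_kernel[OF v] child_data(1)[OF v u'(2)] by simp
  then have "act (u \<otimes> inv u') (act u' t) \<in> Mv w'"
    by (rule Mv_act[OF child_vert[OF vv u'(2)] _ u'(3)])
  then show ?thesis using kern_shift[OF v st(2) u'(1) u(1)] w by simp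
qed

text \<open>The right-hand side does not mention the numerical data; equality of heights is a
  property of the preotree alone.\<close>

lemma same_height_iff:
  assumes v: "v \<in> po_nonleaves \<tau>" and st: "s \<in> Mv v" "t \<in> Mv v"
    and u: "u \<in> Gv v" "w \<in> ch v" "act u s \<in> Mv w"
  shows "g v s = g v t \<longleftrightarrow> act u t \<in> Mv w"
proof
  show "act u t \<in> Mv w" if "g v s = g v t" by (rule same_height[OF v st that u])
  show "g v s = g v t" if "act u t \<in> Mv w"
    using nd_const[OF v u(2,3) that] nd_act[OF v u(1) st(1)] nd_act[OF v u(1) st(2)] by simp
qed

abbreviation "tle \<equiv> preotree_le \<tau> act f g"

lemma le_in: "tle v s t \<Longrightarrow> s \<in> Mv v \<and> t \<in> Mv v"
  by (erule preotree_le.cases) auto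

lemma le_leaf: "ch v = {} \<Longrightarrow> tle v s t \<longleftrightarrow> s \<in> Mv v \<and> t \<in> Mv v"
  using preotree_le.leaf le_in by metis

lemma le_nonleaf:
  assumes "ch v \<noteq> {}"
  shows "tle v s t \<longleftrightarrow> s \<in> Mv v \<and> t \<in> Mv v \<and>
    (g v s < g v t \<or> g v s = g v t \<and> (\<exists>u\<in>Gv v. \<exists>w\<in>ch v. tle w (act u s) (act u t)))"
  by (subst preotree_le.simps) (use assms in blast)

lemma le_shift:
  assumes "v \<in> po_verts \<tau>" "u \<in> Gv v" "tle v s t"
  shows "tle v (act u s) (act u t)"
proof (cases "ch v = {}")
  case True
  then show ?thesis using assms le_leaf Mv_act by simp
next
  case False
  then have v: "v \<in> po_nonleaves \<tau>" using assms(1) by (simp add: po_nonleaves_def)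
  have st: "s \<in> Mv v" "t \<in> Mv v" using le_in assms(3) by blast+
  note uv = Mv_act[OF assms(1,2)]
  consider "g v s < g v t" | u' w where "g v s = g v t" "u' \<in> Gv v" "w \<in> ch v" "tle w (act u' s) (act u' t)"
    using assms(3) unfolding le_nonleaf[OF False] by blast
  then show ?thesis
  proof cases
    case 1
    then show ?thesis unfolding le_nonleaf[OF False] using st uv nd_act[OF v assms(2)] by simp
  next
    case 2
    have u'': "u' \<otimes> inv u \<in> Gv v" by (intro Gv_mult Gv_inv assms 2)
    have "tle w (act (u' \<otimes> inv u) (act u s)) (act (u' \<otimes> inv u) (act u t))"
      using 2(4) kern_shift[OF v _ assms(2) 2(2)] st by simp
    moreover have "g v (act u s) = g v (act u t)" using 2(1) st nd_act[OF v assms(2)] by simp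
    ultimately show ?thesis
      unfolding le_nonleaf[OF False] using st uv u'' 2(3) by blast
  qed
qed

text \<open>Two admissible translations differ by an element of the kernel, which is the group at
  the child, and the preorder there is invariant under it. This is the independence of the choice of
  \<open>u\<close> in the definition of the preorder.\<close>

lemma le_choice:
  assumes v: "v \<in> po_nonleaves \<tau>" and st: "s \<in> Mv v" "t \<in> Mv v" "g v s = g v t"
    and u: "u \<in> Gv v" "w \<in> ch v" "act u s \<in> Mv w"
  shows "tle v s t \<longleftrightarrow> tle w (act u s) (act u t)"
proof
  assume "tle w (act u s) (act u t)"
  then show "tle v s t" unfolding le_nonleaf[OF nonleafD(2)[OF v]] using st u by blast
next
  assume "tle v s t"
  then obtain u' w' where u': "u' \<in> Gv v" "w' \<in> ch v" "tle w' (act u' s) (act u' t)"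
    unfolding le_nonleaf[OF nonleafD(2)[OF v]] using st by auto
  then have s': "act u' s \<in> Mv w'" using le_in by blast
  note uniq = reach_unique[OF v st(1) u'(1,2) s' u]
  have "tle w (act (u \<otimes> inv u') (act u' s)) (act (u \<otimes> inv u') (act u' t))"
    using le_shift[OF child_vert[OF nonleafD(1)[OF v] u(2)]] uniq child_data(1)[OF v u(2)] u'(3) by simp
  then show "tle w (act u s) (act u t)"
    using kern_shift[OF v _ u'(1) u(1)] st by simp
qed

text \<open>At equal heights one common translation carries all elements involved into the same
  child set, where the induction hypothesis applies.\<close>

lemma le_refl_total_trans:
  assumes "v \<in> po_verts \<tau>"
  shows "(\<forall>s\<in>Mv v. tle v s s) \<and> (\<forall>s\<in>Mv v. \<forall>t\<in>Mv v. tle v s t \<or> tle v t s) \<and>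
    (\<forall>s t r. tle v s t \<longrightarrow> tle v t r \<longrightarrow> tle v s r)"
  using tree assms
proof (induction rule: finite_rooted_tree_induct_up)
  case (step v)
  show ?case
  proof (cases "ch v = {}")
    case True
    then show ?thesis by (simp add: le_leaf)
  next
    case False
    then have v: "v \<in> po_nonleaves \<tau>" using step.hyps by (simp add: po_nonleaves_def)
    have total: "tle v s t \<or> tle v t s" if st: "s \<in> Mv v" "t \<in> Mv v" for s t
    proof (cases "g v s = g v t")
      case True
      obtain u w where u: "u \<in> Gv v" "w \<in> ch v" "act u s \<in> Mv w" using reach[OF v st(1)] by blast
      note t = same_height[OF v st True u]
      then show ?thesis
        using step.IH[OF u(2)] u(3) le_choice[OF v st True u] le_choice[OF v st(2,1) True[symmetric] u(1,2) t] by blast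
    next
      case False
      then consider "g v s < g v t" | "g v t < g v s" by linarith
      then show ?thesis using st unfolding le_nonleaf[OF \<open>ch v \<noteq> {}\<close>] by (cases; simp)
    qed
    moreover have "tle v s r" if str: "tle v s t" "tle v t r" for s t r
    proof -
      have M: "s \<in> Mv v" "t \<in> Mv v" "r \<in> Mv v" using le_in str by blast+
      have "g v s \<le> g v t" "g v t \<le> g v r" using str unfolding le_nonleaf[OF False] by auto
      then consider "g v s < g v r" | "g v s = g v t" "g v t = g v r" by linarith
      then show ?thesis
      proof cases
        case 1
        then show ?thesis unfolding le_nonleaf[OF False] using M by blast
      next
        case 2
        obtain u w where u: "u \<in> Gv v" "w \<in> ch v" "act u s \<in> Mv w" using reach[OF v M(1)] by blast
        note t = same_height[OF v M(1,2) 2(1) u]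
        have "tle w (act u s) (act u t)" using le_choice[OF v M(1,2) 2(1) u] str(1) by blast
        moreover have "tle w (act u t) (act u r)" using le_choice[OF v M(2,3) 2(2) u(1,2) t] str(2) by blast
        ultimately have "tle w (act u s) (act u r)" using step.IH[OF u(2)] by blast
        then show ?thesis using le_choice[OF v M(1,3) _ u] 2 by simp
      qed
    qed
    ultimately show ?thesis by blast
  qed
qed

lemma preotree_preorder_total: "total_preorder_on M (preotree_preorder \<tau> act f g)"
proof -
  note * = le_refl_total_trans[OF root_vert, unfolded root_simps]
  have "trans (preotree_preorder \<tau> act f g)"
    unfolding preotree_preorder_def by (rule transI) (use * in blast)
  moreover have "preotree_preorder \<tau> act f g \<subseteq> M \<times> M"
    unfolding preotree_preorder_def using le_in[of "po_root \<tau>"] root_simps(2) by auto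
  moreover have "refl_on M (preotree_preorder \<tau> act f g)"
    unfolding preotree_preorder_def refl_on_def using * by blast
  moreover have "total_on M (preotree_preorder \<tau> act f g)"
    unfolding preotree_preorder_def total_on_def using * by blast
  ultimately show ?thesis unfolding total_preorder_on_def preorder_on_def by blast
qed

lemma preotree_preorder_compatible: "compatible_rel G act (preotree_preorder \<tau> act f g)"
  unfolding compatible_rel_def preotree_preorder_def
  using le_shift[OF root_vert] root_simps by auto

end

text \<open>Equivalence forces equal heights all the way down to a leaf, and by
  \<open>same_height_iff\<close> this can be read off without numbers.\<close>

lemma equiv_independent:
  assumes nd: "numerical_data G act \<tau> f g" "numerical_data G act \<tau> f' g'"
    and "v \<in> po_verts \<tau>"
  shows "\<forall>s t. preotree_le \<tau> act f g v s t \<and> preotree_le \<tau> act f g v t s \<longrightarrow>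
    preotree_le \<tau> act f' g' v s t"
  using tree assms(3)
proof (induction rule: finite_rooted_tree_induct_up)
  case (step v)
  show ?case
  proof (cases "ch v = {}")
    case True
    then show ?thesis by (simp add: le_leaf[OF nd(1)] le_leaf[OF nd(2)])
  next
    case False
    then have v: "v \<in> po_nonleaves \<tau>" using step.hyps by (simp add: po_nonleaves_def)
    show ?thesis
    proof (intro allI impI)
      fix s t assume st: "preotree_le \<tau> act f g v s t \<and> preotree_le \<tau> act f g v t s"
      then have M: "s \<in> Mv v" "t \<in> Mv v" using le_in[OF nd(1)] by blast+
      have gst: "g v s = g v t" using st unfolding le_nonleaf[OF nd(1) False] by auto
      obtain u w where u: "u \<in> Gv v" "w \<in> ch v" "act u s \<in> Mv w" using reach[OF v M(1)] by blast
      note t = same_height[OF nd(1) v M gst u]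
      have "preotree_le \<tau> act f g w (act u s) (act u t)" "preotree_le \<tau> act f g w (act u t) (act u s)"
        using st le_choice[OF nd(1) v M gst u] le_choice[OF nd(1) v M(2,1) gst[symmetric] u(1,2) t] by blast+
      then have "preotree_le \<tau> act f' g' w (act u s) (act u t)" using step.IH[OF u(2)] by blast
      moreover have "g' v s = g' v t" using same_height_iff[OF nd(2) v M u] t by blast
      ultimately show "preotree_le \<tau> act f' g' v s t" using le_choice[OF nd(2) v M _ u] by blast
    qed
  qed
qed

end

section \<open>Numerical data encoded by a point\<close>

text \<open>Affine dependence stated without separating a constant from a linear part, which makes
  closure under products and inverses immediate. The last clause confines the dependence to the
  variables in \<open>V\<close>.\<close>

definition affine_map :: "('g, 'c) monoid_scheme \<Rightarrow> nat set \<Rightarrow> ((nat \<Rightarrow> int) \<Rightarrow> 'g) \<Rightarrow> bool" where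
  "affine_map G V \<Phi> \<longleftrightarrow> (\<forall>N. \<Phi> N \<in> carrier G) \<and>
     (\<forall>N N'. \<Phi> (\<lambda>k. N k + N' k) \<otimes>\<^bsub>G\<^esub> \<Phi> (\<lambda>_. 0) = \<Phi> N \<otimes>\<^bsub>G\<^esub> \<Phi> N') \<and>
     (\<forall>N N'. (\<forall>k\<in>V. N k = N' k) \<longrightarrow> \<Phi> N = \<Phi> N')"

lemma int_affine_add:
  assumes "int_affine V \<psi>"
  shows "\<psi> (\<lambda>k. N k + N' k) + \<psi> (\<lambda>_. 0) = \<psi> N + \<psi> N'"
  using assms unfolding int_affine_def by (auto simp: algebra_simps sum.distrib)

lemma int_affine_dep:
  assumes "int_affine V \<psi>" "\<forall>k\<in>V. N k = N' k" shows "\<psi> N = \<psi> N'"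
  using assms unfolding int_affine_def by auto

context comm_group
begin

lemma affine_map_closed: "affine_map G V \<Phi> \<Longrightarrow> \<Phi> N \<in> carrier G"
  unfolding affine_map_def by simp

lemma affine_map_const: "x \<in> carrier G \<Longrightarrow> affine_map G V (\<lambda>N. x)"
  unfolding affine_map_def by simp

lemma affine_map_mult:
  assumes "affine_map G V \<Phi>" "affine_map G V \<Psi>" shows "affine_map G V (\<lambda>N. \<Phi> N \<otimes> \<Psi> N)"
proof -
  have c: "\<Phi> N \<in> carrier G" "\<Psi> N \<in> carrier G" for N using assms affine_map_closed by blast+
  have "\<Phi> (\<lambda>k. N k + N' k) \<otimes> \<Psi> (\<lambda>k. N k + N' k) \<otimes> (\<Phi> (\<lambda>_. 0) \<otimes> \<Psi> (\<lambda>_. 0)) =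
      \<Phi> N \<otimes> \<Psi> N \<otimes> (\<Phi> N' \<otimes> \<Psi> N')" for N N'
  proof -
    have "\<Phi> (\<lambda>k. N k + N' k) \<otimes> \<Psi> (\<lambda>k. N k + N' k) \<otimes> (\<Phi> (\<lambda>_. 0) \<otimes> \<Psi> (\<lambda>_. 0)) =
      (\<Phi> (\<lambda>k. N k + N' k) \<otimes> \<Phi> (\<lambda>_. 0)) \<otimes> (\<Psi> (\<lambda>k. N k + N' k) \<otimes> \<Psi> (\<lambda>_. 0))"
      using c by (simp add: m_ac)
    also have "\<dots> = (\<Phi> N \<otimes> \<Phi> N') \<otimes> (\<Psi> N \<otimes> \<Psi> N')"
      using assms unfolding affine_map_def by simp
    finally show ?thesis using c by (simp add: m_ac)
  qed
  moreover have "\<Phi> N \<otimes> \<Psi> N = \<Phi> N' \<otimes> \<Psi> N'" if "\<forall>k\<in>V. N k = N' k" for N N'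
    using assms that unfolding affine_map_def by metis
  ultimately show ?thesis unfolding affine_map_def using c by simp
qed

lemma affine_map_inv:
  assumes "affine_map G V \<Phi>" shows "affine_map G V (\<lambda>N. inv (\<Phi> N))"
proof -
  have c: "\<Phi> N \<in> carrier G" for N using assms affine_map_closed by blast
  have "inv (\<Phi> (\<lambda>k. N k + N' k)) \<otimes> inv (\<Phi> (\<lambda>_. 0)) = inv (\<Phi> N) \<otimes> inv (\<Phi> N')" for N N'
  proof -
    have "inv (\<Phi> (\<lambda>k. N k + N' k) \<otimes> \<Phi> (\<lambda>_. 0)) = inv (\<Phi> N \<otimes> \<Phi> N')"
      using assms unfolding affine_map_def by simp
    then show ?thesis using c by (simp add: inv_mult)
  qed
  moreover have "inv (\<Phi> N) = inv (\<Phi> N')" if "\<forall>k\<in>V. N k = N' k" for N N'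
    using assms that unfolding affine_map_def by metis
  ultimately show ?thesis unfolding affine_map_def using c by simp
qed

lemma affine_map_pow:
  assumes "int_affine V \<psi>" "x \<in> carrier G" shows "affine_map G V (\<lambda>N. x [^] \<psi> N)"
  unfolding affine_map_def
proof (intro conjI allI impI)
  fix N N'
  show "x [^] \<psi> N \<in> carrier G" using assms(2) by (rule int_pow_closed)
  show "x [^] \<psi> (\<lambda>k. N k + N' k) \<otimes> x [^] \<psi> (\<lambda>_. 0) = x [^] \<psi> N \<otimes> x [^] \<psi> N'"
    unfolding int_pow_mult[OF assms(2), symmetric] int_affine_add[OF assms(1)] ..
  show "x [^] \<psi> N = x [^] \<psi> N'" if "\<forall>k\<in>V. N k = N' k"
    using int_affine_dep[OF assms(1) that] by simp
qed

lemma affine_map_finprod: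
  assumes "finite A" "\<And>i. i \<in> A \<Longrightarrow> affine_map G V (\<Phi> i)"
  shows "affine_map G V (\<lambda>N. finprod G (\<lambda>i. \<Phi> i N) A)"
  using assms
proof (induction A)
  case empty
  then show ?case by (simp add: affine_map_const)
next
  case (insert a A)
  have "finprod G (\<lambda>i. \<Phi> i N) (insert a A) = \<Phi> a N \<otimes> finprod G (\<lambda>i. \<Phi> i N) A" for N
    by (rule finprod_insert[OF insert.hyps]) (use insert.prems affine_map_closed in auto)
  then show ?case using insert affine_map_mult[of V "\<Phi> a"] by simp
qed

text \<open>Subtracting the value at zero turns the affine rule into additivity in
  \<open>N\<close>.\<close>

lemma int_affine_additive:
  fixes c :: "'a \<Rightarrow> int"
  assumes V: "finite V" and \<Phi>: "affine_map G V \<Phi>"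
    and add: "\<And>x y. x \<in> carrier G \<Longrightarrow> y \<in> carrier G \<Longrightarrow> c (x \<otimes> y) = c x + c y"
  shows "int_affine V (\<lambda>N. c (\<Phi> N))"
proof -
  have cl: "\<Phi> N \<in> carrier G" for N using \<Phi> affine_map_closed by blast
  define \<psi> where "\<psi> N = c (\<Phi> N) - c (\<Phi> (\<lambda>_. 0))" for N
  have "\<psi> (\<lambda>k. N k + N' k) = \<psi> N + \<psi> N'" for N N'
  proof -
    have "c (\<Phi> (\<lambda>k. N k + N' k) \<otimes> \<Phi> (\<lambda>_. 0)) = c (\<Phi> N \<otimes> \<Phi> N')"
      using \<Phi> unfolding affine_map_def by simp
    then show ?thesis using cl by (simp add: add \<psi>_def)
  qed
  moreover have "\<psi> N = \<psi> N'" if "\<And>k. k \<in> V \<Longrightarrow> N k = N' k" for N N'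
  proof -
    have "\<Phi> N = \<Phi> N'" using \<Phi> that unfolding affine_map_def by blast
    then show ?thesis by (simp add: \<psi>_def)
  qed
  ultimately have sum: "\<psi> N = (\<Sum>k\<in>V. \<psi> (\<lambda>l. if l = k then 1 else 0) * N k)" for N
    by (rule additive_sum_coords[OF V])
  have "c (\<Phi> N) = (\<Sum>k\<in>V. \<psi> (\<lambda>l. if l = k then 1 else 0) * N k) + c (\<Phi> (\<lambda>_. 0))" for N
    unfolding sum[of N, symmetric] unfolding \<psi>_def by simp
  then have "\<forall>N. c (\<Phi> N) = (\<Sum>k\<in>V. \<psi> (\<lambda>l. if l = k then 1 else 0) * N k) + c (\<Phi> (\<lambda>_. 0))" ..
  then show ?thesis unfolding int_affine_def by (intro exI)
qed

text \<open>The second part is what permits the descent in the tree: the residue of an affine family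
  modulo \<open>H\<close> is an affine family again.\<close>

lemma affine_frame:
  assumes V: "finite V" and H: "subgroup H G" and fr: "quotient_frame G H n gen e c"
    and \<Phi>: "affine_map G V \<Phi>"
  shows "i < n \<Longrightarrow> int_affine V (\<lambda>N. c (\<Phi> N) i)"
    and "affine_map G V (\<lambda>N. \<Phi> N \<otimes> inv (frame_section n e (c (\<Phi> N))))"
proof -
  show aff: "int_affine V (\<lambda>N. c (\<Phi> N) i)" if "i < n" for i
    by (rule int_affine_additive[OF V \<Phi>, of "\<lambda>u. c u i"]) (rule frame_add[OF H fr that])
  have "affine_map G V (\<lambda>N. frame_section n e (c (\<Phi> N)))"
    unfolding frame_section_def[OF H fr]
    by (intro affine_map_finprod affine_map_pow aff) (use frame_e[OF H fr] in auto)
  then show "affine_map G V (\<lambda>N. \<Phi> N \<otimes> inv (frame_section n e (c (\<Phi> N))))"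
    by (intro affine_map_mult affine_map_inv \<Phi>)
qed

end

context framed_preotree
begin

definition dimv :: "'w \<Rightarrow> nat" where "dimv v = fst (po_dims G \<tau> v)"

definition frame_of :: "'w \<Rightarrow> (nat \<Rightarrow> 'g) \<times> ('g \<Rightarrow> nat \<Rightarrow> int)" where
  "frame_of v = (SOME ec. quotient_frame (grp_at G \<tau> v) (kern v) (dimv v) (gen v) (fst ec) (snd ec))"

abbreviation "fe v \<equiv> fst (frame_of v)"
abbreviation "fc v \<equiv> snd (frame_of v)"

lemma frame: 
  assumes v: "v \<in> po_nonleaves \<tau>"
  shows "quotient_frame (grp_at G \<tau> v) (kern v) (dimv v) (gen v) (fe v) (fc v)"
proof -
  have "free_generators (grp_at G \<tau> v Mod kern v) (dimv v) (gen v)"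
    using framed v unfolding data_frame_def po_quotient_def dimv_def kern_def by blast
  from comm_group.quotient_frame_exists[OF Gv_group[OF nonleafD(1)[OF v]] kern_subgroup[OF v] this]
  have "\<exists>ec. quotient_frame (grp_at G \<tau> v) (kern v) (dimv v) (gen v) (fst ec) (snd ec)" by auto
  then show ?thesis unfolding frame_of_def by (rule someI_ex)
qed

lemma fc_add: "v \<in> po_nonleaves \<tau> \<Longrightarrow> i < dimv v \<Longrightarrow> u \<in> Gv v \<Longrightarrow> u' \<in> Gv v \<Longrightarrow>
    fc v (u \<otimes> u') i = fc v u i + fc v u' i"
  using frame[of v] unfolding quotient_frame_def by (simp add: carrier_restr)

lemma fc_kernel: "v \<in> po_nonleaves \<tau> \<Longrightarrow> u \<in> Gv v \<Longrightarrow> (\<forall>i<dimv v. fc v u i = 0) \<longleftrightarrow> u \<in> kern v"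
  using frame[of v] unfolding quotient_frame_def by (simp add: carrier_restr)

lemma fe_in: "v \<in> po_nonleaves \<tau> \<Longrightarrow> i < dimv v \<Longrightarrow> fe v i \<in> Gv v"
  using frame[of v] unfolding quotient_frame_def by (simp add: carrier_restr)

lemma fc_delta: "v \<in> po_nonleaves \<tau> \<Longrightarrow> i < dimv v \<Longrightarrow> j < dimv v \<Longrightarrow>
    fc v (fe v i) j = (if i = j then 1 else 0)"
  using frame[of v] unfolding quotient_frame_def by (simp add: carrier_restr)

lemma gen_coset:
  assumes "v \<in> po_nonleaves \<tau>" "i < dimv v"
  shows "gen v i = {h \<otimes> fe v i | h. h \<in> kern v}"
  using frame[OF assms(1)] assms(2) unfolding quotient_frame_def
  by (auto simp: carrier_restr r_coset_def)

definition idx :: "'w \<Rightarrow> 'w \<Rightarrow> nat" where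
  "idx v = the_inv_into {..<card (ch v)} (enum v)"

lemma enum_bij: "v \<in> po_nonleaves \<tau> \<Longrightarrow> bij_betw (enum v) {..<card (ch v)} (ch v)"
  using framed unfolding data_frame_def po_dims_def by simp

lemma idx: 
  assumes v: "v \<in> po_nonleaves \<tau>" and w: "w \<in> ch v"
  shows "idx v w < card (ch v)" "enum v (idx v w) = w"
proof -
  have "inj_on (enum v) {..<card (ch v)}" "w \<in> enum v ` {..<card (ch v)}"
    using enum_bij[OF v] w unfolding bij_betw_def by auto
  then show "enum v (idx v w) = w" "idx v w < card (ch v)"
    unfolding idx_def using f_the_inv_into_f the_inv_into_into[of _ _ w "{..<card (ch v)}"] by fastforce+
qed

lemma idx_enum:
  assumes v: "v \<in> po_nonleaves \<tau>" and j: "j < card (ch v)"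
  shows "enum v j \<in> ch v" "idx v (enum v j) = j"
  using enum_bij[OF v] j unfolding bij_betw_def idx_def by (auto simp: the_inv_into_f_f)

section \<open>Uniqueness of the data encoded by a point\<close>

context
  fixes q f g assumes enc: "encoded_by G act \<tau> gen enum q f g"
begin

lemma enc_nd: "numerical_data G act \<tau> f g"
  using enc unfolding encoded_by_def by (rule conjunct1)

lemma enc_f:
  assumes v: "v \<in> po_nonleaves \<tau>" and u: "u \<in> Gv v"
  shows "f v u = (\<Sum>i<dimv v. of_int (fc v u i) * fst (q v) i)"
proof -
  have fe: "f v (fe v i) = fst (q v) i" if "i < dimv v" for i
  proof -
    have "\<one> \<in> kern v" using subgroup.one_closed[OF kern_subgroup[OF v]] by (simp add: carrier_restr)
    moreover have "fe v i = \<one> \<otimes> fe v i"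
      using fe_in[OF v that] Gv_closed[OF nonleafD(1)[OF v]] by simp
    ultimately have "fe v i \<in> gen v i" unfolding gen_coset[OF v that] by blast
    then show ?thesis using enc v that unfolding encoded_by_def dimv_def by simp
  qed
  have "f v u = (\<Sum>i<dimv v. of_int (fc v u i) * f v (fe v i))"
    by (rule comm_group.additive_frame[OF Gv_group[OF nonleafD(1)[OF v]] kern_subgroup[OF v] frame[OF v]])
      (use u nd_hom[OF enc_nd v] nd_kernel[OF enc_nd v] in \<open>auto simp: carrier_restr\<close>)
  then show ?thesis using fe by simp
qed

lemma enc_child:
  assumes v: "v \<in> po_nonleaves \<tau>" and w: "w \<in> ch v" and s: "s \<in> Mv w"
  shows "g v s = snd (q v) (idx v w)"
proof -
  have "idx v w < snd (po_dims G \<tau> v)" using idx(1)[OF v w] by (simp add: po_dims_def)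
  then have "\<forall>s\<in>Mv (enum v (idx v w)). g v s = snd (q v) (idx v w)"
    using enc v unfolding encoded_by_def by blast
  then show ?thesis using s idx(2)[OF v w] by simp
qed

lemma enc_g:
  assumes v: "v \<in> po_nonleaves \<tau>" and s: "s \<in> Mv v" and u: "u \<in> Gv v" "w \<in> ch v" "act u s \<in> Mv w"
  shows "g v s = snd (q v) (idx v w) - f v u"
  using enc_child[OF v u(2,3)] nd_act[OF enc_nd v u(1) s] by simp

end

text \<open>Data encoded by the same point assign the same heights, because every element can be
  translated into a child set, where its height is a coordinate of \<open>q\<close>.\<close>

lemma encoded_le_mono:
  assumes enc: "encoded_by G act \<tau> gen enum q f g" "encoded_by G act \<tau> gen enum q f' g'"
    and "preotree_le \<tau> act f g v s t" "v \<in> po_verts \<tau>"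
  shows "preotree_le \<tau> act f' g' v s t"
proof -
  have geq: "g v s = g' v s" if v: "v \<in> po_nonleaves \<tau>" and s: "s \<in> Mv v" for v s
  proof -
    obtain u w where u: "u \<in> Gv v" "w \<in> ch v" "act u s \<in> Mv w" using reach[OF v s] by blast
    show ?thesis
      using enc_g[OF enc(1) v s u] enc_g[OF enc(2) v s u] enc_f[OF enc(1) v u(1)] enc_f[OF enc(2) v u(1)] by simp
  qed
  show ?thesis
    using assms(3,4)
  proof (induction rule: preotree_le.induct)
    case (leaf v s t)
    then show ?case by (simp add: preotree_le.leaf)
  next
    case (less v s t)
    then have "v \<in> po_nonleaves \<tau>" by (simp add: po_nonleaves_def)
    then show ?case using less geq by (intro preotree_le.less) auto
  next
    case (step s v t u w)
    then have "v \<in> po_nonleaves \<tau>" by (auto simp: po_nonleaves_def)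
    then have eq: "g' v s = g' v t"
      using geq[of v s] geq[of v t] step.hyps(1-3) by simp
    show ?case
      by (rule preotree_le.step[of s \<tau> v t g' u w act f', OF step.hyps(1,2) eq step.hyps(4,5)
            step.IH[OF child_vert[OF step.prems step.hyps(5)]]])
  qed
qed

lemma point_preorder_eq:
  assumes enc: "encoded_by G act \<tau> gen enum q f g"
  shows "point_preorder G act \<tau> gen enum q = preotree_preorder \<tau> act f g"
  unfolding point_preorder_def preotree_preorder_def
  using enc encoded_le_mono[OF _ enc _ root_vert] by blast

section \<open>Existence of the data encoded by a point\<close>

context
  fixes q assumes q: "q \<in> data_space G \<tau>"
begin

lemma q_irr: "v \<in> po_nonleaves \<tau> \<Longrightarrow> q v \<in> irrational_space (dimv v) (card (ch v))"
  using q unfolding data_space_def dimv_def po_dims_def by (auto dest: PiE_mem)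

lemma q_lin_indep:
  assumes v: "v \<in> po_nonleaves \<tau>" and "(\<Sum>i<dimv v. of_int (k i) * fst (q v) i) = 0" "i < dimv v"
  shows "k i = 0"
proof -
  obtain a b where ab: "q v = (a, b)" by (cases "q v")
  have "\<forall>r :: nat \<Rightarrow> rat. (\<Sum>i<dimv v. of_rat (r i) * a i) = 0 \<longrightarrow> (\<forall>i<dimv v. r i = 0)"
    using q_irr[OF v] unfolding ab irrational_space_def by blast
  from this[THEN spec, of "\<lambda>i. of_int (k i)"] show ?thesis using assms(2,3) ab by simp
qed

lemma q_cosets:
  assumes v: "v \<in> po_nonleaves \<tau>" and "j < card (ch v)" "l < card (ch v)" "j \<noteq> l"
  shows "snd (q v) j - snd (q v) l \<noteq> (\<Sum>i<dimv v. of_int (k i) * fst (q v) i)"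
proof -
  obtain a b where ab: "q v = (a, b)" by (cases "q v")
  have "\<forall>j<card (ch v). \<forall>l<card (ch v). j \<noteq> l \<longrightarrow>
      b j - b l \<notin> range (\<lambda>k :: nat \<Rightarrow> int. \<Sum>i<dimv v. of_int (k i) * a i)"
    using q_irr[OF v] unfolding ab irrational_space_def by blast
  then have "b j - b l \<notin> range (\<lambda>k :: nat \<Rightarrow> int. \<Sum>i<dimv v. of_int (k i) * a i)"
    using assms by simp
  then show ?thesis unfolding ab fst_conv snd_conv by blast
qed

lemma q_interval:
  assumes v: "v \<in> po_nonleaves \<tau>" and "dimv v = 1" "j < card (ch v)"
  shows "snd (q v) j \<in> {0<..<\<bar>fst (q v) 0\<bar>}"
proof -
  obtain a b where ab: "q v = (a, b)" by (cases "q v")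
  have "dimv v = 1 \<longrightarrow> (\<forall>j<card (ch v). b j \<in> {0<..<\<bar>a 0\<bar>})"
    using q_irr[OF v] unfolding ab irrational_space_def by blast
  then show ?thesis using assms(2,3) ab by simp
qed

definition num_f :: "'w \<Rightarrow> 'g \<Rightarrow> real" where
  "num_f v u = (\<Sum>i<dimv v. of_int (fc v u i) * fst (q v) i)"

text \<open>The value forced by the transformation rule once \<open>s\<close> has been moved into
  the child set of \<open>w\<close>; it does not depend on the choice of \<open>u\<close> by
  \<open>reach_unique\<close>.\<close>

definition num_g :: "'w \<Rightarrow> 'm \<Rightarrow> real" where
  "num_g v s = (SOME x. \<exists>u\<in>Gv v. \<exists>w\<in>ch v. act u s \<in> Mv w \<and> x = snd (q v) (idx v w) - num_f v u)"

lemma num_f_add: "v \<in> po_nonleaves \<tau> \<Longrightarrow> u \<in> Gv v \<Longrightarrow> u' \<in> Gv v \<Longrightarrow> num_f v (u \<otimes> u') = num_f v u + num_f v u'"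
  unfolding num_f_def by (simp add: fc_add algebra_simps sum.distrib)

lemma num_f_kernel:
  assumes v: "v \<in> po_nonleaves \<tau>" and u: "u \<in> Gv v"
  shows "num_f v u = 0 \<longleftrightarrow> u \<in> kern v"
  using fc_kernel[OF v u] q_lin_indep[OF v, of "fc v u"] unfolding num_f_def by auto

lemma num_f_inv:
  assumes v: "v \<in> po_nonleaves \<tau>" and u: "u \<in> Gv v" shows "num_f v (inv u) = - num_f v u"
proof -
  have "group (grp_at G \<tau> v)" using Gv_group[OF nonleafD(1)[OF v]] comm_group.axioms(2) by blast
  then have "num_f v (inv\<^bsub>grp_at G \<tau> v\<^esub> u) = - num_f v u"
    by (rule group.additive_inv) (auto simp: carrier_restr num_f_add v u)
  then show ?thesis using inv_restr[OF nonleafD(1)[OF v] u] by simp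
qed

lemma num_g_eq:
  assumes v: "v \<in> po_nonleaves \<tau>" and s: "s \<in> Mv v" and u: "u \<in> Gv v" "w \<in> ch v" "act u s \<in> Mv w"
  shows "num_g v s = snd (q v) (idx v w) - num_f v u"
proof -
  have "\<exists>x. \<exists>u\<in>Gv v. \<exists>w\<in>ch v. act u s \<in> Mv w \<and> x = snd (q v) (idx v w) - num_f v u"
    using u by blast
  from someI_ex[OF this] obtain u' w' where u': "u' \<in> Gv v" "w' \<in> ch v" "act u' s \<in> Mv w'"
    "num_g v s = snd (q v) (idx v w') - num_f v u'"
    unfolding num_g_def by blast
  note uniq = reach_unique[OF v s u'(1-3) u]
  have "num_f v (u \<otimes> inv u') = 0"
    using uniq(2) num_f_kernel[OF v] kern_sub[OF v] by blast
  then have "num_f v u = num_f v u'"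
    using num_f_add[OF v u(1) Gv_inv[OF nonleafD(1)[OF v] u'(1)]] num_f_inv[OF v u'(1)] by simp
  then show ?thesis using u'(4) uniq(1) by simp
qed

lemma num_g_child:
  assumes v: "v \<in> po_nonleaves \<tau>" and w: "w \<in> ch v" and s: "s \<in> Mv w"
  shows "num_g v s = snd (q v) (idx v w)"
proof -
  note vv = nonleafD(1)[OF v]
  have "act \<one> s = s" using act_one Mv_sub[OF vv Mv_child[OF vv w s]] by blast
  then have "num_g v s = snd (q v) (idx v w) - num_f v \<one>"
    using num_g_eq[OF v Mv_child[OF vv w s] Gv_one[OF vv] w] s by simp
  moreover have "num_f v \<one> = 0"
    using num_f_kernel[OF v Gv_one[OF vv]] subgroup.one_closed[OF kern_subgroup[OF v]] by (simp add: carrier_restr)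
  ultimately show ?thesis by simp
qed

lemma num_g_act:
  assumes v: "v \<in> po_nonleaves \<tau>" and u: "u \<in> Gv v" and s: "s \<in> Mv v"
  shows "num_g v (act u s) = num_f v u + num_g v s"
proof -
  note vv = nonleafD(1)[OF v]
  obtain u' w where u': "u' \<in> Gv v" "w \<in> ch v" "act u' s \<in> Mv w" using reach[OF v s] by blast
  have uu: "u' \<otimes> inv u \<in> Gv v" by (intro Gv_mult[OF vv] Gv_inv[OF vv] u u')
  have "act (u' \<otimes> inv u) (act u s) \<in> Mv w" using u'(3) kern_shift[OF v s u u'(1)] by simp
  then have "num_g v (act u s) = snd (q v) (idx v w) - num_f v (u' \<otimes> inv u)"
    by (rule num_g_eq[OF v Mv_act[OF vv u s] uu u'(2)])
  then show ?thesis
    using num_g_eq[OF v s u'] num_f_add[OF v u'(1) Gv_inv[OF vv u]] num_f_inv[OF v u] by simp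
qed

text \<open>When \<open>G v / kern v\<close> is generated by the coset of \<open>u0\<close>, comparing the two bases gives
  \<open>\<bar>f u0\<bar> = \<bar>a 0\<bar>\<close>.\<close>

lemma rank_one:
  assumes v: "v \<in> po_nonleaves \<tau>" and u0: "u0 \<in> Gv v"
    and gen1: "free_generators (grp_at G \<tau> v Mod kern v) 1 (\<lambda>_. kern v #>\<^bsub>grp_at G \<tau> v\<^esub> u0)"
  shows "dimv v = 1" "\<bar>num_f v u0\<bar> = \<bar>fst (q v) 0\<bar>"
proof -
  interpret A: comm_group "grp_at G \<tau> v" by (rule Gv_group[OF nonleafD(1)[OF v]])
  obtain e c where fr: "quotient_frame (grp_at G \<tau> v) (kern v) 1 (\<lambda>_. kern v #>\<^bsub>grp_at G \<tau> v\<^esub> u0) e c"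
    using A.quotient_frame_exists[OF kern_subgroup[OF v] gen1] by blast
  have e: "e 0 \<in> Gv v" "c (e 0) 0 = 1"
    using A.frame_e[OF kern_subgroup[OF v] fr, of 0] A.frame_delta[OF kern_subgroup[OF v] fr, of 0 0]
    by (simp_all add: carrier_restr)
  have "dimv v \<le> 1"
    unfolding dimv_def po_dims_def fst_conv free_rank_def po_quotient_def kern_def[symmetric]
    by (rule Least_le) (use gen1 in blast)
  moreover have "dimv v \<noteq> 0"
  proof
    assume "dimv v = 0"
    then have "e 0 \<in> kern v" using fc_kernel[OF v e(1)] by simp
    moreover have "e 0 \<in> carrier (grp_at G \<tau> v)" using e(1) by (simp add: carrier_restr)
    ultimately have "\<forall>i<1. c (e 0) i = 0" using A.frame_kernel[OF kern_subgroup[OF v] fr] by blast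
    from this[THEN spec, of 0] show False using e(2) by simp
  qed
  ultimately show dim: "dimv v = 1" by simp
  have add: "fc v (x \<otimes>\<^bsub>grp_at G \<tau> v\<^esub> y) 0 = fc v x 0 + fc v y 0"
    if "x \<in> carrier (grp_at G \<tau> v)" "y \<in> carrier (grp_at G \<tau> v)" for x y
    using fc_add[OF v, of 0 x y] that dim by (simp add: carrier_restr)
  have ker: "fc v h 0 = 0" if "h \<in> kern v" for h
    using fc_kernel[OF v kern_sub[OF v that]] that dim by simp
  have "kern v #>\<^bsub>grp_at G \<tau> v\<^esub> u0 = kern v #>\<^bsub>grp_at G \<tau> v\<^esub> e 0"
    using fr unfolding quotient_frame_def by simp
  then have "e 0 \<in> kern v #>\<^bsub>grp_at G \<tau> v\<^esub> u0"
    using A.rcos_self[OF _ kern_subgroup[OF v], of "e 0"] e(1) by (simp add: carrier_restr)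
  then obtain h where h: "h \<in> kern v" "e 0 = h \<otimes> u0" by (auto simp: r_coset_def carrier_restr)
  have "fc v (e 0) 0 = fc v u0 0"
    using fc_add[OF v _ kern_sub[OF v h(1)] u0, of 0] ker[OF h(1)] dim h(2) by simp
  moreover have "fc v (fe v 0) 0 = c (fe v 0) 0 * fc v (e 0) 0"
    using A.additive_frame[OF kern_subgroup[OF v] fr add ker, of "fe v 0"] fe_in[OF v, of 0] dim
    by (simp add: carrier_restr)
  ultimately have "1 = c (fe v 0) 0 * fc v u0 0" using fc_delta[OF v, of 0 0] dim by simp
  \<comment> \<open>Two integers with product \<open>1\<close>: up to sign, \<open>u0\<close>
    represents the chosen generator.\<close>
  then have "\<bar>fc v u0 0\<bar> = 1" by (metis abs_1 abs_mult dvd_triv_right zdvd1_eq)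
  then have "\<bar>real_of_int (fc v u0 0)\<bar> = 1" by linarith
  then show "\<bar>num_f v u0\<bar> = \<bar>fst (q v) 0\<bar>" unfolding num_f_def dim by (simp add: abs_mult)
qed

lemma num_kernel:
  "v \<in> po_nonleaves \<tau> \<Longrightarrow> kernel (grp_at G \<tau> v) real_add_group (num_f v) = kern v"
  using num_f_kernel[of v] kern_sub[of v] by (auto simp: kernel_def carrier_restr real_add_group_def)

text \<open>Each clause of the irrational space supplies one axiom: linear independence gives the
  kernel, the condition on differences gives distinct cosets, and the interval condition gives the
  normalisation in rank one.\<close>

lemma numerical_data_exists: "numerical_data G act \<tau> num_f num_g"
  unfolding numerical_data_def Let_def
proof (intro ballI conjI impI)
  fix v assume v: "v \<in> po_nonleaves \<tau>"
  note vv = nonleafD(1)[OF v]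
  show "num_f v \<in> hom (grp_at G \<tau> v) real_add_group"
    using num_f_add[OF v] by (auto simp: hom_def carrier_restr real_add_group_def)
  show "num_g v (act u s) = num_f v u + num_g v s" if "u \<in> Gv v" "s \<in> Mv v" for u s
    by (rule num_g_act[OF v that])
  show "Gv w = kernel (grp_at G \<tau> v) real_add_group (num_f v)" if "w \<in> ch v" for w
    using child_data(1)[OF v that] num_kernel[OF v] by simp
  show "\<exists>c. \<forall>s\<in>Mv w. num_g v s = c" if "w \<in> ch v" for w
    using num_g_child[OF v that] by blast
  show "num_g v s - num_g v t \<notin> num_f v ` Gv v"
    if "w \<in> ch v" "w' \<in> ch v" "w \<noteq> w'" "s \<in> Mv w" "t \<in> Mv w'" for w w' s t
  proof
    assume "num_g v s - num_g v t \<in> num_f v ` Gv v"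
    then obtain u where "num_g v s - num_g v t = num_f v u" by (rule imageE)
    then have "snd (q v) (idx v w) - snd (q v) (idx v w') = num_f v u"
      using num_g_child[OF v that(1,4)] num_g_child[OF v that(2,5)] by simp
    moreover have "idx v w \<noteq> idx v w'" using idx(2)[OF v] that(1-3) by metis
    ultimately show False
      using q_cosets[OF v idx(1)[OF v that(1)] idx(1)[OF v that(2)], of "fc v u"] unfolding num_f_def by simp
  qed
  show "num_g v s \<in> {0<..<\<bar>num_f v u0\<bar>}"
    if "u0 \<in> Gv v" "free_generators (grp_at G \<tau> v Mod kernel (grp_at G \<tau> v) real_add_group (num_f v)) 1
        (\<lambda>_. kernel (grp_at G \<tau> v) real_add_group (num_f v) #>\<^bsub>grp_at G \<tau> v\<^esub> u0)"
      "w \<in> ch v" "s \<in> Mv w" for u0 w s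
    using rank_one[OF v that(1) that(2)[unfolded num_kernel[OF v]]] num_g_child[OF v that(3,4)]
      q_interval[OF v _ idx(1)[OF v that(3)]] by simp
qed

lemma encoded_exists: "encoded_by G act \<tau> gen enum q num_f num_g"
  unfolding encoded_by_def
proof (intro conjI ballI allI impI numerical_data_exists)
  fix v assume v: "v \<in> po_nonleaves \<tau>"
  show "num_f v u = fst (q v) i" if "i < fst (po_dims G \<tau> v)" "u \<in> gen v i" for i u
  proof -
    have i: "i < dimv v" using that by (simp add: dimv_def)
    from that(2) obtain h where h: "h \<in> kern v" "u = h \<otimes> fe v i" unfolding gen_coset[OF v i] by blast
    have "num_f v u = num_f v h + num_f v (fe v i)"
      unfolding h(2) by (rule num_f_add[OF v kern_sub[OF v h(1)] fe_in[OF v i]])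
    moreover have "num_f v h = 0" using num_f_kernel[OF v kern_sub[OF v h(1)]] h(1) by simp
    moreover have "num_f v (fe v i) = (\<Sum>j<dimv v. if i = j then fst (q v) j else 0)"
      unfolding num_f_def by (rule sum.cong) (simp_all add: fc_delta[OF v i])
    ultimately show ?thesis using i by simp
  qed
  show "num_g v s = snd (q v) j" if "j < snd (po_dims G \<tau> v)" "s \<in> Mv (enum v j)" for j s
    using num_g_child[OF v idx_enum(1)[OF v] that(2)] idx_enum(2)[OF v] that(1) by (simp add: po_dims_def)
qed

end

end

section \<open>Comparisons along affine families\<close>

context comm_group
begin

lemma frame_section_cong:
  assumes H: "subgroup H G" and fr: "quotient_frame G H n gen e c"
    and "\<And>i. i < n \<Longrightarrow> k i = l i"
  shows "frame_section n e k = frame_section n e l"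
  unfolding frame_section_def[OF H fr]
  by (rule finprod_cong') (use assms(3) frame_e[OF H fr] in auto)

end

text \<open>\<open>F\<close> and \<open>H\<close> fix numerical data for all points at once, so that
  a comparison becomes a predicate in \<open>p\<close> and \<open>N\<close>.\<close>

locale preotree_family =
  framed_preotree G act M \<tau> gen enum + definability I V \<Sigma> \<iota>
  for G :: "('g, 'c) monoid_scheme" (structure) and act :: "'g \<Rightarrow> 'm \<Rightarrow> 'm" and M
    and \<tau> :: "('w, 'g, 'm) preotree" and gen enum
    and I :: "'i set" and V and \<Sigma> :: "'p set" and \<iota> +
  fixes Q :: "'p \<Rightarrow> 'w \<Rightarrow> (nat \<Rightarrow> real) \<times> (nat \<Rightarrow> real)" and F :: "'p \<Rightarrow> 'w \<Rightarrow> 'g \<Rightarrow> real"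
    and H :: "'p \<Rightarrow> 'w \<Rightarrow> 'm \<Rightarrow> real"
  assumes Q_in: "\<And>p. p \<in> \<Sigma> \<Longrightarrow> Q p \<in> data_space G \<tau>"
    and enc: "\<And>p. p \<in> \<Sigma> \<Longrightarrow> encoded_by G act \<tau> gen enum (Q p) (F p) (H p)"
    and poly_fst: "\<And>v i. v \<in> po_nonleaves \<tau> \<Longrightarrow> i < fst (po_dims G \<tau> v) \<Longrightarrow> poly_on (\<lambda>p. fst (Q p v) i)"
    and poly_snd: "\<And>v j. v \<in> po_nonleaves \<tau> \<Longrightarrow> j < snd (po_dims G \<tau> v) \<Longrightarrow> poly_on (\<lambda>p. snd (Q p v) j)"
begin

abbreviation "cmp p \<equiv> preotree_le \<tau> act (F p) (H p)"

text \<open>The families are quantified inside the definition because the induction passes from a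
  family to its residue modulo the kernel.\<close>

definition cmp_definable :: "'w \<Rightarrow> bool" where
  "cmp_definable v \<longleftrightarrow> (\<forall>X\<in>Mv v. \<forall>Y\<in>Mv v. \<forall>\<Phi> \<Psi>. affine_map (grp_at G \<tau> v) V \<Phi> \<longrightarrow>
     affine_map (grp_at G \<tau> v) V \<Psi> \<longrightarrow> definable (\<lambda>p N. cmp p v (act (\<Phi> N) X) (act (\<Psi> N) Y)))"

lemma affine_map_grp_at:
  "affine_map (grp_at G \<tau> v) V \<Phi> \<longleftrightarrow> (\<forall>N. \<Phi> N \<in> Gv v) \<and>
     (\<forall>N N'. \<Phi> (\<lambda>k. N k + N' k) \<otimes> \<Phi> (\<lambda>_. 0) = \<Phi> N \<otimes> \<Phi> N') \<and>
     (\<forall>N N'. (\<forall>k\<in>V. N k = N' k) \<longrightarrow> \<Phi> N = \<Phi> N')"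
  unfolding affine_map_def carrier_restr ..

text \<open>The difference of heights decides the comparison unless it vanishes. It vanishes only in
  the same child and for equal coordinates modulo the kernel; then one translation replaces both
  families by their residues, which are compared at the child.\<close>

lemma cmp_definable_between_children:
  assumes v: "v \<in> po_nonleaves \<tau>" and IH: "\<And>w. w \<in> ch v \<Longrightarrow> cmp_definable w"
    and w: "w0 \<in> ch v" "w1 \<in> ch v" and XY: "X \<in> Mv w0" "Y \<in> Mv w1"
    and aff: "affine_map (grp_at G \<tau> v) V \<Phi>" "affine_map (grp_at G \<tau> v) V \<Psi>"
  shows "definable (\<lambda>p N. cmp p v (act (\<Phi> N) X) (act (\<Psi> N) Y))"
proof -
  note vv = nonleafD(1)[OF v] and ne = nonleafD(2)[OF v]
  interpret A: comm_group "grp_at G \<tau> v" by (rule Gv_group[OF vv])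
  note kfr = kern_subgroup[OF v] frame[OF v]
  have cl: "\<Phi> N \<in> Gv v" "\<Psi> N \<in> Gv v" for N using aff unfolding affine_map_grp_at by blast+
  have XYv: "X \<in> Mv v" "Y \<in> Mv v" using XY w Mv_child[OF vv] by blast+
  note memv = Mv_act[OF vv cl(1) XYv(1)] Mv_act[OF vv cl(2) XYv(2)]
  define a where "a p i = fst (Q p v) i" for p i
  define b where "b p w = snd (Q p v) (idx v w)" for p w
  define \<alpha> where "\<alpha> N i = fc v (\<Phi> N) i" for N i
  define \<beta> where "\<beta> N i = fc v (\<Psi> N) i" for N i
  \<comment> \<open>The height of the second element minus that of the first, expanded in the
    coordinates of the point.\<close>
  define \<rho> where "\<rho> p N = (\<Sum>i<dimv v. of_int (\<beta> N i - \<alpha> N i) * a p i) + (b p w1 - b p w0)" for p N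
  have int_aff: "int_affine V (\<lambda>N. \<alpha> N i)" "int_affine V (\<lambda>N. \<beta> N i)" if "i < dimv v" for i
    unfolding \<alpha>_def \<beta>_def
    using A.affine_frame(1)[OF finite_V kfr aff(1) that] A.affine_frame(1)[OF finite_V kfr aff(2) that] by blast+
  have poly_a: "poly_on (\<lambda>p. a p i)" if "i < dimv v" for i
    using poly_fst[OF v, of i] that unfolding a_def dimv_def by simp
  have poly_b: "poly_on (\<lambda>p. b p w)" if "w \<in> ch v" for w
    using poly_snd[OF v, of "idx v w"] idx(1)[OF v that] unfolding b_def by (simp add: po_dims_def)
  have \<rho>_aff: "real_affine \<rho>"
    unfolding \<rho>_def
    by (intro real_affine_add real_affine_sum real_affine_mult real_affine_poly poly_on_diff
        int_affine_diff int_aff poly_a poly_b w) auto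
  have \<rho>: "\<rho> p N = H p v (act (\<Psi> N) Y) - H p v (act (\<Phi> N) X)" if p: "p \<in> \<Sigma>" for p N
  proof -
    note nd = enc_nd[OF enc[OF p]]
    have "H p v (act (\<Phi> N) X) = (\<Sum>i<dimv v. of_int (\<alpha> N i) * a p i) + b p w0"
      using nd_act[OF nd v cl(1)[of N] XYv(1)] enc_f[OF enc[OF p] v cl(1)[of N]] enc_child[OF enc[OF p] v w(1) XY(1)]
      by (simp add: \<alpha>_def a_def b_def)
    moreover have "H p v (act (\<Psi> N) Y) = (\<Sum>i<dimv v. of_int (\<beta> N i) * a p i) + b p w1"
      using nd_act[OF nd v cl(2)[of N] XYv(2)] enc_f[OF enc[OF p] v cl(2)[of N]] enc_child[OF enc[OF p] v w(2) XY(2)]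
      by (simp add: \<beta>_def a_def b_def)
    ultimately show ?thesis by (simp add: \<rho>_def algebra_simps sum_subtractf)
  qed
  \<comment> \<open>The irrationality conditions enter here: differences
    \<open>b p w0 - b p w1\<close> for distinct children are not integer combinations of the
    \<open>a p i\<close>, and these are independent. The resulting condition does not involve
    \<open>p\<close>.\<close>
  have zero: "\<rho> p N = 0 \<longleftrightarrow> w0 = w1 \<and> (\<forall>i\<in>{..<dimv v}. \<alpha> N i = \<beta> N i)" if p: "p \<in> \<Sigma>" for p N
  proof
    assume z: "\<rho> p N = 0"
    have w01: "w0 = w1"
    proof (rule ccontr)
      assume "w0 \<noteq> w1"
      then have "idx v w0 \<noteq> idx v w1" using idx(2)[OF v w(1)] idx(2)[OF v w(2)] by auto
      from q_cosets[OF Q_in[OF p] v idx(1)[OF v w(1)] idx(1)[OF v w(2)] this, of "\<lambda>i. \<beta> N i - \<alpha> N i"]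
      show False using z by (simp add: \<rho>_def a_def b_def)
    qed
    moreover have "\<beta> N i - \<alpha> N i = 0" if "i < dimv v" for i
      by (rule q_lin_indep[OF Q_in[OF p] v _ that]) (use z w01 in \<open>simp add: \<rho>_def a_def b_def\<close>)
    ultimately show "w0 = w1 \<and> (\<forall>i\<in>{..<dimv v}. \<alpha> N i = \<beta> N i)" by simp
  qed (simp add: \<rho>_def)
  have zero_def: "definable (\<lambda>p N. \<rho> p N = 0)"
  proof (rule definable_cong[OF _ zero])
    show "definable (\<lambda>p N. w0 = w1 \<and> (\<forall>i\<in>{..<dimv v}. \<alpha> N i = \<beta> N i))"
      by (intro definable_conj definable_const definable_ball definable_int_eq int_aff) auto
  qed
  have pos: "definable (\<lambda>p N. \<rho> p N > 0)" by (rule definable_real_pos[OF \<rho>_aff zero_def])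
  show ?thesis
  proof (cases "w0 = w1")
    case False
    show ?thesis
    proof (rule definable_cong[OF pos])
      fix p N assume p: "p \<in> \<Sigma>"
      have "\<rho> p N \<noteq> 0" using zero[OF p] False by blast
      then show "cmp p v (act (\<Phi> N) X) (act (\<Psi> N) Y) \<longleftrightarrow> \<rho> p N > 0"
        unfolding le_nonleaf[OF enc_nd[OF enc[OF p]] ne] using memv \<rho>[OF p, of N] by auto
    qed
  next
    case True
    define res where "res \<Theta> N = \<Theta> N \<otimes>\<^bsub>grp_at G \<tau> v\<^esub>
      inv\<^bsub>grp_at G \<tau> v\<^esub> (A.frame_section (dimv v) (fe v) (fc v (\<Theta> N)))" for \<Theta> :: "(nat \<Rightarrow> int) \<Rightarrow> 'g" and N :: "nat \<Rightarrow> int"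
    have sec: "A.frame_section (dimv v) (fe v) k \<in> Gv v" for k
      using A.frame_section_closed[OF kfr, of k] by (simp add: carrier_restr)
    have res_kern: "res \<Theta> N \<in> kern v" if "\<And>N. \<Theta> N \<in> Gv v" for \<Theta> N
      unfolding res_def by (rule A.frame_residue[OF kfr]) (simp add: carrier_restr that)
    have res_aff: "affine_map (grp_at G \<tau> w0) V (res \<Theta>)" if "affine_map (grp_at G \<tau> v) V \<Theta>" for \<Theta>
    proof -
      have "affine_map (grp_at G \<tau> v) V (res \<Theta>)"
        unfolding res_def by (rule A.affine_frame(2)[OF finite_V kfr that])
      moreover have "res \<Theta> N \<in> Gv w0" for N
        using res_kern[of \<Theta> N] that child_data(1)[OF v w(1)] unfolding affine_map_grp_at by simp
      ultimately show ?thesis unfolding affine_map_grp_at by simp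
    qed
    have res_act: "act (inv (A.frame_section (dimv v) (fe v) (fc v (\<Theta> N)))) (act (\<Theta> N) Z) = act (res \<Theta> N) Z"
      if "\<Theta> N \<in> Gv v" "Z \<in> Mv v" for \<Theta> N Z
    proof -
      have "act (inv (A.frame_section (dimv v) (fe v) (fc v (\<Theta> N)))) (act (\<Theta> N) Z) =
          act (inv (A.frame_section (dimv v) (fe v) (fc v (\<Theta> N))) \<otimes> \<Theta> N) Z"
        by (rule act_mult_v[OF vv Gv_inv[OF vv sec] that, symmetric])
      also have "inv (A.frame_section (dimv v) (fe v) (fc v (\<Theta> N))) \<otimes> \<Theta> N = res \<Theta> N"
        unfolding res_def carrier_restr inv_restr[OF vv sec]
        by (rule m_comm) (use Gv_closed[OF vv] Gv_inv[OF vv] sec that in blast)+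
      finally show ?thesis .
    qed
    have "definable (\<lambda>p N. cmp p w0 (act (res \<Phi> N) X) (act (res \<Psi> N) Y))"
      using IH[OF w(1)] XY True res_aff[OF aff(1)] res_aff[OF aff(2)] unfolding cmp_definable_def by simp
    then have "definable (\<lambda>p N. \<rho> p N > 0 \<or> \<rho> p N = 0 \<and> cmp p w0 (act (res \<Phi> N) X) (act (res \<Psi> N) Y))"
      by (intro definable_disj definable_conj pos zero_def)
    then show ?thesis
    proof (rule definable_cong)
      fix p N assume p: "p \<in> \<Sigma>"
      note nd = enc_nd[OF enc[OF p]]
      let ?u = "inv (A.frame_section (dimv v) (fe v) (fc v (\<Phi> N)))"
      have u: "?u \<in> Gv v" by (rule Gv_inv[OF vv sec])
      have s: "act ?u (act (\<Phi> N) X) = act (res \<Phi> N) X" by (rule res_act[OF cl(1) XYv(1)])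
      have "act (res \<Phi> N) X \<in> Mv w0"
        by (rule Mv_act[OF child_vert[OF vv w(1)] _ XY(1)])
          (use res_kern[of \<Phi> N] cl(1) child_data(1)[OF v w(1)] in simp)
      then have sw: "act ?u (act (\<Phi> N) X) \<in> Mv w0" unfolding s .
      have choice: "cmp p v (act (\<Phi> N) X) (act (\<Psi> N) Y) \<longleftrightarrow> cmp p w0 (act (res \<Phi> N) X) (act (res \<Psi> N) Y)"
        if z: "\<rho> p N = 0"
      proof -
        \<comment> \<open>At height difference zero both families have equal coordinates and hence
          the same section, so the single translation \<open>?u\<close> yields both
          residues.\<close>
        have "A.frame_section (dimv v) (fe v) (fc v (\<Phi> N)) = A.frame_section (dimv v) (fe v) (fc v (\<Psi> N))"
          by (rule A.frame_section_cong[OF kfr]) (use zero[OF p] z in \<open>simp add: \<alpha>_def \<beta>_def\<close>)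
        then have t: "act ?u (act (\<Psi> N) Y) = act (res \<Psi> N) Y"
          using res_act[of \<Psi> N Y, OF cl(2) XYv(2)] by simp
        have "H p v (act (\<Phi> N) X) = H p v (act (\<Psi> N) Y)" using z \<rho>[OF p] by simp
        from le_choice[OF nd v memv this u w(1) sw] show ?thesis unfolding s t .
      qed
      have "cmp p v (act (\<Phi> N) X) (act (\<Psi> N) Y) \<longleftrightarrow> \<rho> p N > 0" if "\<rho> p N \<noteq> 0"
        unfolding le_nonleaf[OF nd ne] using memv \<rho>[OF p, of N] that by auto
      then show "cmp p v (act (\<Phi> N) X) (act (\<Psi> N) Y) \<longleftrightarrow>
          \<rho> p N > 0 \<or> \<rho> p N = 0 \<and> cmp p w0 (act (res \<Phi> N) X) (act (res \<Psi> N) Y)"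
        using choice by (cases "\<rho> p N = 0") simp_all
    qed
  qed
qed

lemma cmp_definable_all:
  assumes "v \<in> po_verts \<tau>" shows "cmp_definable v"
  using tree assms
proof (induction rule: finite_rooted_tree_induct_up)
  case (step v)
  show ?case
    unfolding cmp_definable_def
  proof (intro ballI allI impI)
    fix X Y \<Phi> \<Psi>
    assume X: "X \<in> Mv v" and Y: "Y \<in> Mv v" and aff: "affine_map (grp_at G \<tau> v) V \<Phi>" "affine_map (grp_at G \<tau> v) V \<Psi>"
    have cl: "\<Phi> N \<in> Gv v" "\<Psi> N \<in> Gv v" for N using aff unfolding affine_map_grp_at by blast+
    show "definable (\<lambda>p N. cmp p v (act (\<Phi> N) X) (act (\<Psi> N) Y))"
    proof (cases "ch v = {}")
      case True
      have "cmp p v (act (\<Phi> N) X) (act (\<Psi> N) Y)" if "p \<in> \<Sigma>" for p N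
        unfolding le_leaf[OF enc_nd[OF enc[OF that]] True]
        using Mv_act[OF step.hyps cl(1) X] Mv_act[OF step.hyps cl(2) Y] by simp
      then show ?thesis by (intro definable_cong[OF definable_const[of True]]) simp
    next
      case False
      then have v: "v \<in> po_nonleaves \<tau>" using step.hyps by (simp add: po_nonleaves_def)
      interpret A: comm_group "grp_at G \<tau> v" by (rule Gv_group[OF step.hyps])
      obtain u0 w0 where u0: "u0 \<in> Gv v" "w0 \<in> ch v" "act u0 X \<in> Mv w0" using reach[OF v X] by blast
      obtain u1 w1 where u1: "u1 \<in> Gv v" "w1 \<in> ch v" "act u1 Y \<in> Mv w1" using reach[OF v Y] by blast
      \<comment> \<open>The translations that move the base points into child sets are undone inside
        the families, which stay affine.\<close>
      have shift: "affine_map (grp_at G \<tau> v) V (\<lambda>N. \<Theta> N \<otimes> inv u)"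
        if "affine_map (grp_at G \<tau> v) V \<Theta>" "u \<in> Gv v" for \<Theta> u
        using A.affine_map_mult[OF that(1) A.affine_map_const[of "inv u" V]] Gv_inv[OF step.hyps that(2)]
        by (simp add: carrier_restr)
      have "definable (\<lambda>p N. cmp p v (act (\<Phi> N \<otimes> inv u0) (act u0 X)) (act (\<Psi> N \<otimes> inv u1) (act u1 Y)))"
        by (rule cmp_definable_between_children[OF v step.IH u0(2) u1(2) u0(3) u1(3)
              shift[OF aff(1) u0(1)] shift[OF aff(2) u1(1)]])
      moreover have "act (\<Phi> N \<otimes> inv u0) (act u0 X) = act (\<Phi> N) X"
        "act (\<Psi> N \<otimes> inv u1) (act u1 Y) = act (\<Psi> N) Y" for N
        using kern_shift[OF v X u0(1) cl(1)] kern_shift[OF v Y u1(1) cl(2)] by simp_all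
      ultimately show ?thesis by simp
    qed
  qed
qed

lemma preorder_definable:
  assumes "X \<in> M" "Y \<in> M" "affine_map G V \<Phi>" "affine_map G V \<Psi>"
  shows "definable (\<lambda>p N. (act (\<Phi> N) X, act (\<Psi> N) Y) \<in> point_preorder G act \<tau> gen enum (Q p))"
proof -
  have "affine_map (grp_at G \<tau> (po_root \<tau>)) V \<Theta> \<longleftrightarrow> affine_map G V \<Theta>" for \<Theta>
    unfolding affine_map_grp_at unfolding root_simps affine_map_def ..
  then have "definable (\<lambda>p N. cmp p (po_root \<tau>) (act (\<Phi> N) X) (act (\<Psi> N) Y))"
    using cmp_definable_all[OF root_vert] assms unfolding cmp_definable_def root_simps by simp
  then show ?thesis
    by (rule definable_cong) (simp add: point_preorder_eq[OF enc] preotree_preorder_def)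
qed

end

section \<open>Monoid partrees and Dickson's lemma\<close>

text \<open>Take \<open>B\<close> for the first \<open>K\<close> coordinates and let
  \<open>c\<close> bound the coordinate \<open>K\<close> on \<open>B\<close>. Elements exceeding
  \<open>c\<close> there are dominated from below by \<open>B\<close>; each of the finitely many
  remaining values of that coordinate gives a slice with its own finite set.\<close>

lemma dickson:
  fixes X :: "(nat \<Rightarrow> nat) set"
  shows "\<exists>B. finite B \<and> B \<subseteq> X \<and> (\<forall>n\<in>X. \<exists>m\<in>B. \<forall>i<K. m i \<le> n i)"
proof (induction K arbitrary: X)
  case 0
  show ?case
  proof (cases "X = {}")
    case False
    then obtain m where "m \<in> X" by blast
    then show ?thesis by (intro exI[of _ "{m}"]) auto
  qed auto
next
  case (Suc K)
  obtain B where B: "finite B" "B \<subseteq> X" "\<forall>n\<in>X. \<exists>m\<in>B. \<forall>i<K. m i \<le> n i"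
    using Suc[of X] by (elim exE conjE)
  \<comment> \<open>\<open>insert 0\<close> gives the maximum a meaning when \<open>B\<close> is
    empty.\<close>
  define c where "c = Max (insert 0 ((\<lambda>m. m K) ` B))"
  have c: "m K \<le> c" if "m \<in> B" for m unfolding c_def using B(1) that by (intro Max_ge) auto
  define C where "C d = (SOME C. finite C \<and> C \<subseteq> {n\<in>X. n K = d} \<and>
    (\<forall>n\<in>{n\<in>X. n K = d}. \<exists>m\<in>C. \<forall>i<K. m i \<le> n i))" for d
  have C: "finite (C d)" "C d \<subseteq> {n\<in>X. n K = d}" "\<forall>n\<in>{n\<in>X. n K = d}. \<exists>m\<in>C d. \<forall>i<K. m i \<le> n i" for d
    using someI_ex[OF Suc[of "{n\<in>X. n K = d}"]] unfolding C_def by simp_all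
  show ?case
  proof (intro exI[of _ "B \<union> (\<Union>d\<le>c. C d)"] conjI ballI)
    show "finite (B \<union> (\<Union>d\<le>c. C d))" using B(1) C(1) by auto
    show "B \<union> (\<Union>d\<le>c. C d) \<subseteq> X" using B(2) C(2) by blast
    fix n assume n: "n \<in> X"
    show "\<exists>m\<in>B \<union> (\<Union>d\<le>c. C d). \<forall>i<Suc K. m i \<le> n i"
    proof (cases "n K \<le> c")
      case True
      obtain m where m: "m \<in> C (n K)" "\<forall>i<K. m i \<le> n i" using C(3)[of "n K"] n by blast
      then have "m K = n K" using C(2) by blast
      then have "\<forall>i<Suc K. m i \<le> n i" using m(2) by (simp add: less_Suc_eq)
      then show ?thesis using m(1) True by blast
    next
      case False
      obtain m where m: "m \<in> B" "\<forall>i<K. m i \<le> n i" using B(3) n by blast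
      then have "\<forall>i<Suc K. m i \<le> n i" using c[OF m(1)] False by (simp add: less_Suc_eq)
      then show ?thesis using m(1) by blast
    qed
  qed
qed

section \<open>Products of powers of generators\<close>

context comm_monoid
begin

definition pow_prod :: "nat \<Rightarrow> (nat \<Rightarrow> 'a) \<Rightarrow> (nat \<Rightarrow> nat) \<Rightarrow> 'a" where
  "pow_prod k a n = finprod G (\<lambda>i. a i [^] n i) {..<k}"

lemma pow_prod_0: "pow_prod 0 a n = \<one>"
  unfolding pow_prod_def by simp

lemma pow_prod_Suc:
  assumes "\<And>i. i < Suc k \<Longrightarrow> a i \<in> carrier G"
  shows "pow_prod (Suc k) a n = a k [^] n k \<otimes> pow_prod k a n"
  unfolding pow_prod_def lessThan_Suc by (rule finprod_insert) (use assms in auto)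

lemma pow_prod_closed: "(\<And>i. i < k \<Longrightarrow> a i \<in> carrier G) \<Longrightarrow> pow_prod k a n \<in> carrier G"
  unfolding pow_prod_def by (rule finprod_closed) auto

lemma pow_prod_add:
  assumes "\<And>i. i < k \<Longrightarrow> a i \<in> carrier G"
  shows "pow_prod k a (\<lambda>i. n i + m i) = pow_prod k a n \<otimes> pow_prod k a m"
proof -
  have "pow_prod k a (\<lambda>i. n i + m i) = finprod G (\<lambda>i. a i [^] n i \<otimes> a i [^] m i) {..<k}"
    unfolding pow_prod_def by (rule finprod_cong') (use assms in \<open>auto simp: nat_pow_mult\<close>)
  also have "\<dots> = pow_prod k a n \<otimes> pow_prod k a m"
    unfolding pow_prod_def by (rule finprod_multf) (use assms in auto)
  finally show ?thesis .
qed

lemma pow_prod_cong: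
  assumes "\<And>i. i < k \<Longrightarrow> a i \<in> carrier G" "\<And>i. i < k \<Longrightarrow> n i = m i"
  shows "pow_prod k a n = pow_prod k a m"
  unfolding pow_prod_def by (rule finprod_cong') (use assms in auto)

lemma pow_prod_delta:
  assumes "\<And>i. i < k \<Longrightarrow> a i \<in> carrier G" "j < k"
  shows "pow_prod k a (\<lambda>i. if i = j then 1 else 0) = a j"
proof -
  have "pow_prod k a (\<lambda>i. if i = j then 1 else 0) = finprod G (\<lambda>i. if j = i then a i else \<one>) {..<k}"
    unfolding pow_prod_def by (rule finprod_cong') (use assms in auto)
  also have "\<dots> = a j" by (rule finprod_singleton) (use assms in auto)
  finally show ?thesis .
qed

lemma fg_monoid_pow_prod:
  assumes "fg_monoid G"
  shows "\<exists>k a. (\<forall>i<k. a i \<in> carrier G) \<and> (\<forall>v\<in>carrier G. \<exists>n. v = pow_prod k a n)"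
proof -
  obtain A where A: "finite A" "A \<subseteq> carrier G" "\<forall>K. submonoid K G \<and> A \<subseteq> K \<longrightarrow> carrier G \<subseteq> K"
    using assms unfolding fg_monoid_def by blast
  obtain a where a: "bij_betw a {..<card A} A"
    using ex_bij_betw_nat_finite[OF A(1)] unfolding atLeast0LessThan by blast
  have aG: "\<And>i. i < card A \<Longrightarrow> a i \<in> carrier G" using a A(2) unfolding bij_betw_def by blast
  let ?K = "range (pow_prod (card A) a)"
  have "submonoid ?K G"
  proof (rule submonoid.intro)
    show "?K \<subseteq> carrier G" using pow_prod_closed[OF aG] by auto
    show "x \<otimes> y \<in> ?K" if "x \<in> ?K" "y \<in> ?K" for x y
    proof -
      obtain n m where "x = pow_prod (card A) a n" "y = pow_prod (card A) a m" using \<open>x \<in> ?K\<close> \<open>y \<in> ?K\<close> by auto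
      then have "x \<otimes> y = pow_prod (card A) a (\<lambda>i. n i + m i)" using pow_prod_add[OF aG] by simp
      then show ?thesis by blast
    qed
    have "pow_prod (card A) a (\<lambda>i. 0) = \<one>" unfolding pow_prod_def by simp
    then show "\<one> \<in> ?K" by (metis rangeI)
  qed
  moreover have "A \<subseteq> ?K"
  proof
    fix x assume "x \<in> A"
    then obtain j where "j < card A" "x = a j" using a unfolding bij_betw_def by auto
    then have "x = pow_prod (card A) a (\<lambda>i. if i = j then 1 else 0)" using pow_prod_delta[OF aG] by simp
    then show "x \<in> ?K" by blast
  qed
  ultimately have "carrier G \<subseteq> ?K" using A(3) by blast
  then show ?thesis using aG by (intro exI[of _ "card A"] exI[of _ a]) auto
qed

end

lemma common_path_hd: "common_path \<mu> s t xs \<Longrightarrow> xs \<noteq> [] \<and> xs ! 0 = pt_root \<mu>"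
  unfolding common_path_def by (auto simp: hd_conv_nth)

lemma common_path_step: "common_path \<mu> s t xs \<Longrightarrow> Suc i < length xs \<Longrightarrow> xs ! Suc i \<in> pt_children \<mu> (xs ! i)"
  unfolding common_path_def by blast

lemma common_path_label: "common_path \<mu> s t xs \<Longrightarrow> i < length xs \<Longrightarrow> s \<in> pt_label \<mu> (xs ! i) \<and> t \<in> pt_label \<mu> (xs ! i)"
  unfolding common_path_def by (meson nth_mem)

lemma common_path_last:
  "common_path \<mu> s t xs \<Longrightarrow> y \<in> pt_children \<mu> (last xs) \<Longrightarrow> \<not> (s \<in> pt_label \<mu> y \<and> t \<in> pt_label \<mu> y)"
  unfolding common_path_def by blast

locale generated_partree = comm_monoid P for P :: "('u, 'c) monoid_scheme" (structure) +
  fixes act :: "'u \<Rightarrow> 's \<Rightarrow> 's" and S :: "'s set" and \<mu> :: "('v, 's, 'u) mpartree"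
    and K :: nat and a :: "nat \<Rightarrow> 'u"
  assumes action: "fg_action P act S" and partree_mu: "monoid_partree P act S \<mu>"
    and a_closed: "i < K \<Longrightarrow> a i \<in> carrier P"
    and a_gen: "v \<in> carrier P \<Longrightarrow> \<exists>n. v = pow_prod K a n"
begin

abbreviation "T \<equiv> pt_verts \<mu>"
abbreviation "ch \<equiv> pt_children \<mu>"
abbreviation "L \<equiv> pt_label \<mu>"
abbreviation "\<Pi>m \<equiv> mp_mon \<mu>"
abbreviation "pw \<equiv> pow_prod K a"

lemma partree: "partree_on S \<mu>"
  using partree_mu unfolding monoid_partree_def by (rule conjunct1)

lemma mp_axioms:
  "\<forall>x\<in>T. submonoid (\<Pi>m x) P \<and> fg_monoid (mon_at P \<mu> x) \<and> good_action (mon_at P \<mu> x) (mp_act \<mu> x) (ch x)"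
  "\<Pi>m (pt_root \<mu>) = carrier P"
  "\<forall>x\<in>T. \<forall>y\<in>ch x. stabilizer (mon_at P \<mu> x) (mp_act \<mu> x) y = \<Pi>m y"
  "\<forall>x\<in>T. fg_action (mon_at P \<mu> x) act (L x) \<and> (\<forall>y\<in>ch x. \<forall>u\<in>\<Pi>m x. act u ` L y \<subseteq> L (mp_act \<mu> x u y))"
proof -
  note * = partree_mu[unfolded monoid_partree_def]
  from * show "\<forall>x\<in>T. submonoid (\<Pi>m x) P \<and> fg_monoid (mon_at P \<mu> x) \<and> good_action (mon_at P \<mu> x) (mp_act \<mu> x) (ch x)"
    by (elim conjE)
  from * show "\<Pi>m (pt_root \<mu>) = carrier P" by (elim conjE)
  from * show "\<forall>x\<in>T. \<forall>y\<in>ch x. stabilizer (mon_at P \<mu> x) (mp_act \<mu> x) y = \<Pi>m y" by (elim conjE)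
  from * show "\<forall>x\<in>T. fg_action (mon_at P \<mu> x) act (L x) \<and> (\<forall>y\<in>ch x. \<forall>u\<in>\<Pi>m x. act u ` L y \<subseteq> L (mp_act \<mu> x u y))"
    by (elim conjE)
qed

lemma tree: "finite_rooted_tree T (pt_root \<mu>) ch"
  using partree unfolding partree_on_def by (rule conjunct1)

lemma partree_axioms:
  "L (pt_root \<mu>) = S"
  "\<forall>x\<in>T. ch x \<noteq> {} \<longrightarrow> L x = (\<Union>y\<in>ch x. L y) \<and> disjoint_family_on L (ch x)"
proof -
  note * = partree[unfolded partree_on_def]
  from * show "L (pt_root \<mu>) = S" by (elim conjE)
  from * show "\<forall>x\<in>T. ch x \<noteq> {} \<longrightarrow> L x = (\<Union>y\<in>ch x. L y) \<and> disjoint_family_on L (ch x)" by (elim conjE)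
qed

lemma finite_T: "finite T"
  using tree unfolding finite_rooted_tree_def by blast

lemma root_T: "pt_root \<mu> \<in> T"
  using tree unfolding finite_rooted_tree_def by blast

lemma child_T: "x \<in> T \<Longrightarrow> y \<in> ch x \<Longrightarrow> y \<in> T"
  by (rule finite_rooted_tree_child[OF tree])

lemma child_label: "x \<in> T \<Longrightarrow> y \<in> ch x \<Longrightarrow> s \<in> L y \<Longrightarrow> s \<in> L x"
  using partree_axioms(2) by blast

lemma label_child: "x \<in> T \<Longrightarrow> ch x \<noteq> {} \<Longrightarrow> s \<in> L x \<Longrightarrow> \<exists>y\<in>ch x. s \<in> L y"
  using partree_axioms(2) by blast

lemma child_unique: "x \<in> T \<Longrightarrow> y \<in> ch x \<Longrightarrow> z \<in> ch x \<Longrightarrow> s \<in> L y \<Longrightarrow> s \<in> L z \<Longrightarrow> y = z"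
  using partree_axioms(2) unfolding disjoint_family_on_def by blast

lemma mon_simps: "carrier (mon_at P \<mu> x) = \<Pi>m x" "u \<otimes>\<^bsub>mon_at P \<mu> x\<^esub> v = u \<otimes> v" "\<one>\<^bsub>mon_at P \<mu> x\<^esub> = \<one>"
  unfolding restr_def by simp_all

lemma mon_sub: "x \<in> T \<Longrightarrow> submonoid (\<Pi>m x) P"
  using mp_axioms(1) by blast

lemma mon_closed: "x \<in> T \<Longrightarrow> u \<in> \<Pi>m x \<Longrightarrow> u \<in> carrier P"
  using mon_sub submonoid.mem_carrier by metis

lemma mon_mult: "x \<in> T \<Longrightarrow> u \<in> \<Pi>m x \<Longrightarrow> v \<in> \<Pi>m x \<Longrightarrow> u \<otimes> v \<in> \<Pi>m x"
  using mon_sub submonoid.m_closed by metis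

lemma mon_one: "x \<in> T \<Longrightarrow> \<one> \<in> \<Pi>m x"
  using mon_sub submonoid.one_closed by metis

lemma label_action: "x \<in> T \<Longrightarrow> monoid_action (mon_at P \<mu> x) act (L x)"
  using mp_axioms(4) unfolding fg_action_def by blast

lemma label_act: "x \<in> T \<Longrightarrow> u \<in> \<Pi>m x \<Longrightarrow> s \<in> L x \<Longrightarrow> act u s \<in> L x"
  using label_action[of x] unfolding monoid_action_def by (simp add: mon_simps)

lemma S_action: "monoid_action P act S"
  using action unfolding fg_action_def by (rule conjunct1)

lemma act_S: "u \<in> carrier P \<Longrightarrow> s \<in> S \<Longrightarrow> act u s \<in> S"
  using S_action unfolding monoid_action_def by simp

lemma act_one: "s \<in> S \<Longrightarrow> act \<one> s = s"
  using S_action unfolding monoid_action_def by simp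

lemma act_mult: "u \<in> carrier P \<Longrightarrow> v \<in> carrier P \<Longrightarrow> s \<in> S \<Longrightarrow> act (u \<otimes> v) s = act u (act v s)"
  using S_action unfolding monoid_action_def by simp

lemma act_commute:
  assumes "u \<in> carrier P" "v \<in> carrier P" "s \<in> S" shows "act u (act v s) = act v (act u s)"
  using act_mult[OF assms] act_mult[OF assms(2,1,3)] m_comm[OF assms(1,2)] by simp

lemma label_S: "x \<in> T \<Longrightarrow> s \<in> L x \<Longrightarrow> s \<in> S"
proof -
  assume "x \<in> T" "s \<in> L x"
  have "s \<in> L x \<longrightarrow> s \<in> S"
    using tree \<open>x \<in> T\<close>
  proof (induction rule: finite_rooted_tree_induct_down)
    case root
    show ?case using partree_axioms(1) by simp
  next
    case (child x y)
    then show ?case using child_label by blast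
  qed
  then show "s \<in> S" using \<open>s \<in> L x\<close> by blast
qed

lemma good:
  assumes "x \<in> T"
  shows "\<And>u y. u \<in> \<Pi>m x \<Longrightarrow> y \<in> ch x \<Longrightarrow> mp_act \<mu> x u y \<in> ch x"
    and "\<And>u v y. u \<in> \<Pi>m x \<Longrightarrow> v \<in> \<Pi>m x \<Longrightarrow> y \<in> ch x \<Longrightarrow> mp_act \<mu> x (u \<otimes> v) y = y \<Longrightarrow>
      mp_act \<mu> x u y = y \<and> mp_act \<mu> x v y = y"
proof -
  have "good_action (mon_at P \<mu> x) (mp_act \<mu> x) (ch x)" using mp_axioms(1) assms by blast
  note * = this[unfolded good_action_def monoid_action_def mon_simps]
  from * have "\<forall>u\<in>\<Pi>m x. \<forall>y\<in>ch x. mp_act \<mu> x u y \<in> ch x" by (elim conjE)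
  then show "\<And>u y. u \<in> \<Pi>m x \<Longrightarrow> y \<in> ch x \<Longrightarrow> mp_act \<mu> x u y \<in> ch x" by blast
  from * have "\<forall>u\<in>\<Pi>m x. \<forall>v\<in>\<Pi>m x. \<forall>y\<in>ch x. mp_act \<mu> x (u \<otimes> v) y = y \<longrightarrow>
      mp_act \<mu> x u y = y \<and> mp_act \<mu> x v y = y" by (elim conjE)
  then show "\<And>u v y. u \<in> \<Pi>m x \<Longrightarrow> v \<in> \<Pi>m x \<Longrightarrow> y \<in> ch x \<Longrightarrow> mp_act \<mu> x (u \<otimes> v) y = y \<Longrightarrow>
      mp_act \<mu> x u y = y \<and> mp_act \<mu> x v y = y" by blast
qed

lemma mon_child:
  assumes "x \<in> T" "y \<in> ch x" shows "\<Pi>m y = {u \<in> \<Pi>m x. mp_act \<mu> x u y = y}"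
  using mp_axioms(3) assms unfolding stabilizer_def by (simp add: mon_simps)

text \<open>Goodness makes every \<open>\<Pi>m x\<close> a face of the monoid, hence generated by the \<open>a i\<close> it contains.\<close>

lemma face:
  assumes "x \<in> T" "u \<in> carrier P" "v \<in> carrier P"
  shows "u \<otimes> v \<in> \<Pi>m x \<longrightarrow> u \<in> \<Pi>m x \<and> v \<in> \<Pi>m x"
  using tree assms(1)
proof (induction rule: finite_rooted_tree_induct_down)
  case root
  then show ?case using mp_axioms(2) assms by simp
next
  case (child x y)
  then show ?case unfolding mon_child[OF child.hyps] using good(2)[OF child.hyps(1) _ _ child.hyps(2)] by blast
qed

lemma pw_closed: "pw n \<in> carrier P"
  by (rule pow_prod_closed[OF a_closed])

lemma pow_prod_mon:
  assumes x: "x \<in> T" and "k \<le> K" "\<And>i. i < k \<Longrightarrow> n i > 0 \<Longrightarrow> a i \<in> \<Pi>m x"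
  shows "pow_prod k a n \<in> \<Pi>m x"
  using assms(2,3)
proof (induction k)
  case 0
  show ?case unfolding pow_prod_0 by (rule mon_one[OF x])
next
  case (Suc k)
  have pow: "b [^] (m :: nat) \<in> \<Pi>m x" if "m > 0 \<Longrightarrow> b \<in> \<Pi>m x" for b m
    using that by (induction m) (auto simp: mon_one[OF x] intro: mon_mult[OF x])
  have "pow_prod (Suc k) a n = a k [^] n k \<otimes> pow_prod k a n"
    by (rule pow_prod_Suc) (use Suc.prems a_closed in auto)
  moreover have "pow_prod k a n \<in> \<Pi>m x" using Suc by simp
  ultimately show ?case using pow[of "n k" "a k"] Suc.prems mon_mult[OF x] by simp
qed

text \<open>When \<open>n i > 0\<close>, the generator \<open>a i\<close> divides
  \<open>pw n\<close>, so the face property applies to it.\<close>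

lemma pw_mon_iff:
  assumes x: "x \<in> T" shows "pw n \<in> \<Pi>m x \<longleftrightarrow> (\<forall>i<K. n i > 0 \<longrightarrow> a i \<in> \<Pi>m x)"
proof
  assume n: "pw n \<in> \<Pi>m x"
  show "\<forall>i<K. n i > 0 \<longrightarrow> a i \<in> \<Pi>m x"
  proof (intro allI impI)
    fix i assume i: "i < K" "n i > 0"
    let ?d = "\<lambda>j. if j = i then 1 else 0 :: nat"
    have "pw n = pw (\<lambda>j. ?d j + (n(i := n i - 1)) j)"
      by (rule pow_prod_cong) (use i a_closed in auto)
    also have "\<dots> = pw ?d \<otimes> pw (n(i := n i - 1))" by (rule pow_prod_add[OF a_closed])
    also have "pw ?d = a i" by (rule pow_prod_delta[OF a_closed i(1)])
    finally show "a i \<in> \<Pi>m x" using face[OF x a_closed[OF i(1)] pw_closed] n by simp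
  qed
next
  assume "\<forall>i<K. n i > 0 \<longrightarrow> a i \<in> \<Pi>m x"
  then show "pw n \<in> \<Pi>m x" by (intro pow_prod_mon[OF x]) auto
qed

text \<open>Records the position of an element of \<open>S\<close>: the vertices on the path from
  the root to the leaf that holds it.\<close>

definition prof :: "'s \<Rightarrow> 'v set" where
  "prof s = {x \<in> T. s \<in> L x}"

text \<open>Going down the tree: \<open>act v s\<close> lies in the label of \<open>v\<close> times
  the child \<open>y\<close> as well as in that of \<open>y\<close>. Labels of siblings are
  disjoint, so \<open>v\<close> fixes \<open>y\<close> and belongs to its stabiliser.\<close>

lemma prof_stable:
  assumes "x \<in> T" "v \<in> carrier P"
  shows "s \<in> L x \<longrightarrow> act v s \<in> L x \<longrightarrow> v \<in> \<Pi>m x"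
  using tree assms(1)
proof (induction rule: finite_rooted_tree_induct_down)
  case root
  show ?case using mp_axioms(2) assms by simp
next
  case (child x y)
  show ?case
  proof (intro impI)
    assume s: "s \<in> L y" "act v s \<in> L y"
    then have v: "v \<in> \<Pi>m x" using child child_label by blast
    have "act v ` L y \<subseteq> L (mp_act \<mu> x v y)" using mp_axioms(4) child.hyps v by simp
    then have "act v s \<in> L (mp_act \<mu> x v y)" using s(1) by blast
    then have "mp_act \<mu> x v y = y"
      using child_unique[OF child.hyps(1) good(1)[OF child.hyps(1) v child.hyps(2)] child.hyps(2)] s(2) by blast
    then show "v \<in> \<Pi>m y" unfolding mon_child[OF child.hyps] using v by simp
  qed
qed

text \<open>Acting preserves every label that contains \<open>s\<close>, and disjointness of
  siblings rules out any new one.\<close>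

lemma prof_act:
  assumes s: "s \<in> S" and v: "\<And>x. x \<in> prof s \<Longrightarrow> v \<in> \<Pi>m x"
  shows "prof (act v s) = prof s"
proof -
  have "act v s \<in> L x \<longrightarrow> s \<in> L x" if "x \<in> T" for x
    using tree that
  proof (induction rule: finite_rooted_tree_induct_down)
    case root
    show ?case using partree_axioms(1) s by simp
  next
    case (child x y)
    show ?case
    proof
      assume y: "act v s \<in> L y"
      then have "s \<in> L x" using child child_label by blast
      then obtain z where z: "z \<in> ch x" "s \<in> L z" using label_child[OF child.hyps(1)] child.hyps(2) by blast
      then have "z \<in> prof s" using child_T[OF child.hyps(1)] by (simp add: prof_def)
      then have "act v s \<in> L z" using label_act v z(2) by (simp add: prof_def)
      then show "s \<in> L y" using child_unique[OF child.hyps(1) child.hyps(2) z(1) y] z(2) by simp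
    qed
  qed
  moreover have "act v s \<in> L x" if "x \<in> prof s" for x
    using label_act[OF _ v[OF that]] that by (simp add: prof_def)
  ultimately show ?thesis by (auto simp: prof_def)
qed

text \<open>Generators that move neither \<open>s\<close> nor \<open>act u s\<close> to another
  position; compatibility compares elements before and after the action of \<open>u\<close>.\<close>

definition allowed :: "'u \<Rightarrow> 's \<Rightarrow> nat set" where
  "allowed u s = {i. i < K \<and> (\<forall>x\<in>prof s \<union> prof (act u s). a i \<in> \<Pi>m x)}"

text \<open>Dickson's lemma is applied separately to the exponents with prescribed positions of
  \<open>s\<close> and \<open>act u s\<close>. If \<open>m\<close> lies below \<open>n\<close> and
  has the same positions, then by \<open>prof_stable\<close> the quotient \<open>pw d\<close> lies
  in all the submonoids concerned, and by the face property so does every generator occurring in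
  it.\<close>

lemma finite_base:
  assumes u: "u \<in> carrier P"
  shows "\<exists>B. finite B \<and> B \<subseteq> S \<and> (\<forall>s\<in>S. \<exists>s0\<in>B. \<exists>n. s = act (pw n) s0 \<and> (\<forall>i<K. n i > 0 \<longrightarrow> i \<in> allowed u s0))"
proof -
  obtain E where E: "finite E" "E \<subseteq> S" "S = (\<Union>s\<in>E. orbit P act s)"
    using action unfolding fg_action_def by blast
  define X where "X e A A' = {n. prof (act (pw n) e) = A \<and> prof (act u (act (pw n) e)) = A'}" for e A A'
  define B where "B e A A' = (SOME B. finite B \<and> B \<subseteq> X e A A' \<and> (\<forall>n\<in>X e A A'. \<exists>m\<in>B. \<forall>i<K. m i \<le> n i))"
    for e A A'
  have B: "finite (B e A A')" "B e A A' \<subseteq> X e A A'" "\<forall>n\<in>X e A A'. \<exists>m\<in>B e A A'. \<forall>i<K. m i \<le> n i" for e A A'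
    using someI_ex[OF dickson[of "X e A A'" K]] unfolding B_def by simp_all
  define C where "C = (\<Union>e\<in>E. \<Union>A\<in>Pow T. \<Union>A'\<in>Pow T. (\<lambda>n. act (pw n) e) ` B e A A')"
  have "finite C" unfolding C_def using E(1) finite_T B(1) by auto
  moreover have "C \<subseteq> S" unfolding C_def using E(2) act_S[OF pw_closed] by auto
  moreover have "\<exists>s0\<in>C. \<exists>n. s = act (pw n) s0 \<and> (\<forall>i<K. n i > 0 \<longrightarrow> i \<in> allowed u s0)" if s: "s \<in> S" for s
  proof -
    obtain e v where ev: "e \<in> E" "v \<in> carrier P" "s = act v e" using s E(3) unfolding orbit_def by blast
    have eS: "e \<in> S" using ev(1) E(2) by blast
    obtain n where n: "v = pw n" using a_gen[OF ev(2)] by blast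
    define A where "A = prof (act (pw n) e)"
    define A' where "A' = prof (act u (act (pw n) e))"
    have "n \<in> X e A A'" by (simp add: X_def A_def A'_def)
    then obtain m where m: "m \<in> B e A A'" "\<forall>i<K. m i \<le> n i" using B(3) by blast
    define s0 where "s0 = act (pw m) e"
    have s0S: "s0 \<in> S" unfolding s0_def by (rule act_S[OF pw_closed eS])
    have "m \<in> X e A A'" using B(2) m(1) by blast
    then have profs: "prof s0 = A" "prof (act u s0) = A'" by (simp_all add: X_def s0_def)
    have "A \<in> Pow T" "A' \<in> Pow T" by (auto simp: A_def A'_def prof_def)
    then have s0C: "s0 \<in> C" unfolding C_def s0_def using ev(1) m(1) by blast
    define d where "d i = n i - m i" for i
    have "pw n = pw (\<lambda>i. d i + m i)" by (rule pow_prod_cong) (use m(2) a_closed in \<open>auto simp: d_def\<close>)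
    then have "pw n = pw d \<otimes> pw m" using pow_prod_add[of K a d m] a_closed by simp
    then have sd: "s = act (pw d) s0"
      unfolding ev(3) n s0_def by (simp add: act_mult[OF pw_closed pw_closed eS])
    have d1: "pw d \<in> \<Pi>m x" if "x \<in> A" for x
    proof (rule prof_stable[THEN mp, THEN mp])
      show "x \<in> T" using that by (simp add: A_def prof_def)
      show "s0 \<in> L x" using that profs(1) by (auto simp: prof_def)
      show "act (pw d) s0 \<in> L x" using that unfolding sd[symmetric] ev(3) n by (simp add: A_def prof_def)
    qed (rule pw_closed)
    have d2: "pw d \<in> \<Pi>m x" if "x \<in> A'" for x
    proof (rule prof_stable[THEN mp, THEN mp])
      show "x \<in> T" using that by (simp add: A'_def prof_def)
      show "act u s0 \<in> L x" using that profs(2) by (auto simp: prof_def)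
      have "act (pw d) (act u s0) = act u s" unfolding sd by (rule act_commute[OF pw_closed u s0S])
      then show "act (pw d) (act u s0) \<in> L x" using that unfolding ev(3) n by (simp add: A'_def prof_def)
    qed (rule pw_closed)
    have "i \<in> allowed u s0" if "i < K" "d i > 0" for i
    proof -
      have "a i \<in> \<Pi>m x" if "x \<in> A \<union> A'" for x
      proof -
        have "x \<in> T" "pw d \<in> \<Pi>m x" using that d1 d2 by (auto simp: A_def A'_def prof_def)
        then show ?thesis using pw_mon_iff \<open>i < K\<close> \<open>d i > 0\<close> by blast
      qed
      then show ?thesis unfolding allowed_def profs using that(1) by blast
    qed
    then show ?thesis using s0C sd by blast
  qed
  ultimately show ?thesis by blast
qed

section \<open>Uniqueness of the path of common vertices\<close>

lemma common_path_T:
  assumes "common_path \<mu> s t xs" "i < length xs" shows "xs ! i \<in> T"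
  using assms(2)
proof (induction i)
  case 0
  then show ?case using common_path_hd[OF assms(1)] root_T by simp
next
  case (Suc i)
  then show ?case using child_T[OF _ common_path_step[OF assms(1) Suc.prems]] by simp
qed

lemma common_path_set: "common_path \<mu> s t xs \<Longrightarrow> x \<in> set xs \<Longrightarrow> x \<in> T \<and> s \<in> L x \<and> t \<in> L x"
  using common_path_T common_path_label by (metis in_set_conv_nth)

lemma common_path_last_T: "common_path \<mu> s t xs \<Longrightarrow> last xs \<in> T"
  using common_path_set[of s t xs "last xs"] common_path_hd[of \<mu> s t xs] by (metis last_in_set)

lemma common_path_prefix:
  assumes "common_path \<mu> s t xs" "common_path \<mu> s t ys" "i < length xs" "i < length ys"
  shows "xs ! i = ys ! i"
  using assms(3,4)
proof (induction i)
  case 0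
  then show ?case using common_path_hd[OF assms(1)] common_path_hd[OF assms(2)] by simp
next
  case (Suc i)
  then have eq: "xs ! i = ys ! i" by simp
  have "xs ! i \<in> T" using common_path_T[OF assms(1)] Suc.prems by simp
  then show ?case
    using child_unique[OF _ common_path_step[OF assms(1) Suc.prems(1)]]
      common_path_step[OF assms(2) Suc.prems(2)] common_path_label[OF assms(1) Suc.prems(1)]
      common_path_label[OF assms(2) Suc.prems(2)] unfolding eq by blast
qed

text \<open>A longer path would continue to a child of \<open>last xs\<close> containing both
  elements, against maximality.\<close>

lemma common_path_length:
  assumes "common_path \<mu> s t xs" "common_path \<mu> s t ys" shows "length ys \<le> length xs"
proof (rule ccontr)
  assume less: "\<not> length ys \<le> length xs"
  define k where "k = length xs - 1"
  have k: "length xs = Suc k" using common_path_hd[OF assms(1)] by (cases xs) (auto simp: k_def)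
  have "xs ! k = ys ! k" by (rule common_path_prefix[OF assms]) (use k less in auto)
  moreover have "last xs = xs ! k" using common_path_hd[OF assms(1)] by (simp add: last_conv_nth k_def)
  ultimately have "ys ! Suc k \<in> ch (last xs)" using common_path_step[OF assms(2), of k] k less by simp
  then have "\<not> (s \<in> L (ys ! Suc k) \<and> t \<in> L (ys ! Suc k))" by (rule common_path_last[OF assms(1)])
  then show False using common_path_label[OF assms(2), of "Suc k"] k less by simp
qed

lemma common_path_unique:
  assumes "common_path \<mu> s t xs" "common_path \<mu> s t ys" shows "xs = ys"
proof (rule nth_equalityI)
  show "length xs = length ys" using common_path_length[OF assms] common_path_length[OF assms(2,1)] by simp
  then show "xs ! i = ys ! i" if "i < length xs" for i using common_path_prefix[OF assms] that by simp
qed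

lemma prof_label: "prof s = prof s' \<Longrightarrow> x \<in> T \<Longrightarrow> s \<in> L x \<longleftrightarrow> s' \<in> L x"
  unfolding prof_def by blast

text \<open>The path sees the elements only through their positions, so one list of vertices serves
  a whole family.\<close>

lemma common_path_cong:
  assumes "prof s = prof s'" "prof t = prof t'" "common_path \<mu> s t xs"
  shows "common_path \<mu> s' t' xs"
proof -
  have "\<forall>x\<in>set xs. s' \<in> L x \<and> t' \<in> L x"
    using common_path_set[OF assms(3)] prof_label[OF assms(1)] prof_label[OF assms(2)] by blast
  moreover have "\<forall>y\<in>ch (last xs). \<not> (s' \<in> L y \<and> t' \<in> L y)"
    using common_path_last[OF assms(3)] prof_label[OF assms(1)] prof_label[OF assms(2)]
      child_T[OF common_path_last_T[OF assms(3)]] by blast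
  ultimately show ?thesis using assms(3) unfolding common_path_def by blast
qed

end

section \<open>The locus of compatible preorders\<close>

lemma gr_of_closed:
  assumes "comm_monoid P" "u \<in> carrier P" shows "gr_of P u \<in> carrier (Gr P)"
  using assms comm_monoid.axioms(1) monoid.one_closed unfolding gr_of_def Gr_def
  by (fastforce intro: quotientI)

lemma gr_of_mult:
  assumes "comm_monoid P" "u \<in> carrier P" "v \<in> carrier P"
  shows "gr_of P (u \<otimes>\<^bsub>P\<^esub> v) = gr_of P u \<otimes>\<^bsub>Gr P\<^esub> gr_of P v"
proof -
  have "\<one>\<^bsub>P\<^esub> \<in> carrier P" "\<one>\<^bsub>P\<^esub> \<otimes>\<^bsub>P\<^esub> \<one>\<^bsub>P\<^esub> = \<one>\<^bsub>P\<^esub>"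
    using comm_monoid.axioms(1)[OF assms(1)] by (auto intro: monoid.one_closed monoid.l_one)
  then show ?thesis unfolding gr_of_def using Gr_mult[OF assms(1,2) _ assms(3)] by simp
qed

lemma gr_of_one: "gr_of P \<one>\<^bsub>P\<^esub> = \<one>\<^bsub>Gr P\<^esub>"
  by (simp add: gr_of_def Gr_def)

lemma gr_set_rel_sym: "(x, y) \<in> gr_set_rel P act S \<Longrightarrow> (y, x) \<in> gr_set_rel P act S"
proof -
  have "sym ((gr_set_step P act S \<union> (gr_set_step P act S)\<inverse>)\<^sup>*)"
    by (intro sym_rtrancl sym_Un_converse)
  then show "(x, y) \<in> gr_set_rel P act S \<Longrightarrow> (y, x) \<in> gr_set_rel P act S"
    unfolding gr_set_rel_def by (rule symD)
qed

lemma gr_set_rel_trans: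
  "(x, y) \<in> gr_set_rel P act S \<Longrightarrow> (y, z) \<in> gr_set_rel P act S \<Longrightarrow> (x, z) \<in> gr_set_rel P act S"
  unfolding gr_set_rel_def by (rule rtrancl_trans)

lemma gr_set_rel_class: "(x, y) \<in> gr_set_rel P act S \<Longrightarrow> gr_set_rel P act S `` {x} = gr_set_rel P act S `` {y}"
  using gr_set_rel_sym[of x y P act S] gr_set_rel_trans[of _ _ P act S] by blast

text \<open>Multiplication by \<open>b\<close> carries generating steps to generating steps; hence
  the action on classes is well defined.\<close>

lemma gr_set_rel_mult:
  assumes P: "comm_monoid P" and b: "b \<in> carrier (Gr P)" and xy: "(x, y) \<in> gr_set_rel P act S"
  shows "((b \<otimes>\<^bsub>Gr P\<^esub> fst x, snd x), (b \<otimes>\<^bsub>Gr P\<^esub> fst y, snd y)) \<in> gr_set_rel P act S"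
  using xy unfolding gr_set_rel_def
proof (induction rule: rtrancl_induct)
  case (step y z)
  interpret G: comm_group "Gr P" by (rule comm_group_Gr[OF P])
  have "((b \<otimes>\<^bsub>Gr P\<^esub> fst y, snd y), (b \<otimes>\<^bsub>Gr P\<^esub> fst z, snd z)) \<in> gr_set_step P act S"
    if yz: "(y, z) \<in> gr_set_step P act S" for y z
  proof -
    obtain a u s where a: "a \<in> carrier (Gr P)" "u \<in> carrier P" "s \<in> S"
      "y = (a \<otimes>\<^bsub>Gr P\<^esub> gr_of P u, s)" "z = (a, act u s)"
      using yz unfolding gr_set_step_def by blast
    have "b \<otimes>\<^bsub>Gr P\<^esub> (a \<otimes>\<^bsub>Gr P\<^esub> gr_of P u) = (b \<otimes>\<^bsub>Gr P\<^esub> a) \<otimes>\<^bsub>Gr P\<^esub> gr_of P u"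
      using a b gr_of_closed[OF P a(2)] by (simp add: G.m_assoc)
    moreover have "b \<otimes>\<^bsub>Gr P\<^esub> a \<in> carrier (Gr P)" using a b by simp
    ultimately show ?thesis unfolding gr_set_step_def a(4,5) using a(2,3) by auto
  qed
  then have "((b \<otimes>\<^bsub>Gr P\<^esub> fst y, snd y), (b \<otimes>\<^bsub>Gr P\<^esub> fst z, snd z)) \<in>
      gr_set_step P act S \<union> (gr_set_step P act S)\<inverse>"
    using step.hyps(2) by blast
  with step.IH show ?case by (rule rtrancl_into_rtrancl)
qed simp

lemma gr_act_set_of:
  assumes P: "comm_monoid P" and b: "b \<in> carrier (Gr P)"
  shows "gr_act P act S b (gr_set_of P act S s) = gr_set_rel P act S `` {(b, s)}"
proof -
  interpret G: comm_group "Gr P" by (rule comm_group_Gr[OF P])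
  let ?X = "gr_set_of P act S s" and ?C = "gr_set_rel P act S `` {(b, s)}"
  have "gr_set_rel P act S `` {(b \<otimes>\<^bsub>Gr P\<^esub> fst y, snd y)} = ?C" if "y \<in> ?X" for y
  proof -
    have "((\<one>\<^bsub>Gr P\<^esub>, s), y) \<in> gr_set_rel P act S" using that by (simp add: gr_set_of_def)
    from gr_set_rel_class[OF gr_set_rel_mult[OF P b this]] show ?thesis using b by simp
  qed
  then have "gr_act P act S b ?X = (\<Union>y\<in>?X. ?C)"
    unfolding gr_act_def by (simp add: case_prod_beta)
  moreover have "(\<one>\<^bsub>Gr P\<^esub>, s) \<in> ?X" by (simp add: gr_set_of_def gr_set_rel_def)
  ultimately show ?thesis by blast
qed

lemma gr_set_of_act:
  assumes P: "comm_monoid P" and u: "u \<in> carrier P" and s: "s \<in> S"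
  shows "gr_set_of P act S (act u s) = gr_act P act S (gr_of P u) (gr_set_of P act S s)"
proof -
  interpret G: comm_group "Gr P" by (rule comm_group_Gr[OF P])
  have "((\<one>\<^bsub>Gr P\<^esub> \<otimes>\<^bsub>Gr P\<^esub> gr_of P u, s), (\<one>\<^bsub>Gr P\<^esub>, act u s)) \<in> gr_set_step P act S"
    unfolding gr_set_step_def using u s by blast
  then have "((gr_of P u, s), (\<one>\<^bsub>Gr P\<^esub>, act u s)) \<in> gr_set_rel P act S"
    unfolding gr_set_rel_def using gr_of_closed[OF P u] by auto
  then show ?thesis
    unfolding gr_act_set_of[OF P gr_of_closed[OF P u]] unfolding gr_set_of_def
    by (rule gr_set_rel_class[symmetric])
qed

lemma gr_set_of_in:
  assumes "comm_monoid P" "s \<in> S" shows "gr_set_of P act S s \<in> gr_set P act S"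
proof -
  interpret G: comm_group "Gr P" by (rule comm_group_Gr[OF assms(1)])
  show ?thesis unfolding gr_set_of_def gr_set_def using assms(2) by (intro quotientI) simp
qed

section \<open>The partree at a point of the data space\<close>

locale varied_partree = generated_partree P act S \<mu> K a
  for P :: "('u, 'c) monoid_scheme" (structure) and act :: "'u \<Rightarrow> 's \<Rightarrow> 's" and S :: "'s set"
    and \<mu> :: "('v, 's, 'u) mpartree" and K :: nat and a :: "nat \<Rightarrow> 'u" +
  fixes \<tau> :: "'v \<Rightarrow> ('w, ('u \<times> 'u) set, (('u \<times> 'u) set \<times> 's) set) preotree"
    and gen :: "'v \<Rightarrow> 'w \<Rightarrow> nat \<Rightarrow> ('u \<times> 'u) set set" and enum :: "'v \<Rightarrow> 'w \<Rightarrow> nat \<Rightarrow> 'w"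
  assumes corr: "x \<in> pt_verts \<mu> \<Longrightarrow> corresponding_preotree P act \<mu> x (\<tau> x)"
    and framed: "x \<in> pt_verts \<mu> \<Longrightarrow> data_frame (Gr_at P \<mu> x) (\<tau> x) (gen x) (enum x)"
begin

abbreviation "\<Sigma> \<equiv> total_data_space P \<mu> \<tau>"
abbreviation "I \<equiv> data_coords P \<mu> \<tau>"
abbreviation "\<iota> p \<equiv> restrict (flatten_point p) I"
abbreviation "\<mu>p \<equiv> partree_at_point P act \<mu> \<tau> gen enum"
abbreviation "ptpre x q \<equiv> point_preorder (Gr_at P \<mu> x) (gr_act_at P act \<mu> x) (\<tau> x) (gen x) (enum x) q"
abbreviation "gs x \<equiv> gr_set_of (mon_at P \<mu> x) act (L x)"

text \<open>The first \<open>K\<close> integer variables hold the exponents for one element, the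
  last \<open>K\<close> those for the other.\<close>

sublocale definability I "{..<2 * K}" \<Sigma> \<iota>
  by unfold_locales auto

lemma framed_at:
  assumes "x \<in> T"
  shows "framed_preotree (Gr_at P \<mu> x) (gr_act_at P act \<mu> x) (gr_set_at P act \<mu> x) (\<tau> x) (gen x) (enum x)"
  using corr[OF assms] framed[OF assms] unfolding corresponding_preotree_def framed_preotree_def by blast

lemma point_in: "p \<in> \<Sigma> \<Longrightarrow> x \<in> T \<Longrightarrow> p x \<in> data_space (Gr_at P \<mu> x) (\<tau> x)"
  unfolding total_data_space_def by (rule PiE_mem)

lemma encoding_at:
  assumes "p \<in> \<Sigma>" "x \<in> T"
  shows "\<exists>f g. encoded_by (Gr_at P \<mu> x) (gr_act_at P act \<mu> x) (\<tau> x) (gen x) (enum x) (p x) f g"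
  using framed_preotree.encoded_exists[OF framed_at[OF assms(2)] point_in[OF assms]] by blast

lemma poly_on_coord:
  assumes "i \<in> I" shows "poly_on (\<lambda>p. flatten_point p i)"
  unfolding poly_on_def by (intro exI[of _ "\<lambda>y. y i"] conjI poly_fun_coord assms) (simp add: assms)

lemma family_at:
  assumes x: "x \<in> T"
  shows "\<exists>F H. preotree_family (Gr_at P \<mu> x) (gr_act_at P act \<mu> x) (gr_set_at P act \<mu> x) (\<tau> x) (gen x) (enum x)
    I {..<2 * K} \<Sigma> \<iota> (\<lambda>p. p x) F H"
proof -
  define E where "E p = (SOME fg. encoded_by (Gr_at P \<mu> x) (gr_act_at P act \<mu> x) (\<tau> x) (gen x) (enum x) (p x) (fst fg) (snd fg))" for p
  have E: "encoded_by (Gr_at P \<mu> x) (gr_act_at P act \<mu> x) (\<tau> x) (gen x) (enum x) (p x) (fst (E p)) (snd (E p))"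
    if p: "p \<in> \<Sigma>" for p
  proof -
    have "\<exists>fg. encoded_by (Gr_at P \<mu> x) (gr_act_at P act \<mu> x) (\<tau> x) (gen x) (enum x) (p x) (fst fg) (snd fg)"
      using encoding_at[OF p x] by auto
    then show ?thesis unfolding E_def by (rule someI_ex)
  qed
  have "preotree_family (Gr_at P \<mu> x) (gr_act_at P act \<mu> x) (gr_set_at P act \<mu> x) (\<tau> x) (gen x) (enum x)
    I {..<2 * K} \<Sigma> \<iota> (\<lambda>p. p x) (\<lambda>p. fst (E p)) (\<lambda>p. snd (E p))"
  proof (intro preotree_family.intro preotree_family_axioms.intro framed_at[OF x] E point_in)
    show "definability I {..<2 * K} \<Sigma> \<iota>" by (rule definability_axioms)
    fix v i assume v: "v \<in> po_nonleaves (\<tau> x)"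
    show "poly_on (\<lambda>p. fst (p x v) i)" if "i < fst (po_dims (Gr_at P \<mu> x) (\<tau> x) v)"
    proof -
      have "(x, v, Inl i) \<in> I" using x v that by (auto simp: data_coords_def)
      note coord = poly_on_coord[OF this]
      have "flatten_point p (x, v, Inl i) = fst (p x v) i" for p :: "('v, 'w) data_point"
        by (simp add: flatten_point_def)
      then show ?thesis using coord by (simp only:)
    qed
    show "poly_on (\<lambda>p. snd (p x v) i)" if "i < snd (po_dims (Gr_at P \<mu> x) (\<tau> x) v)"
    proof -
      have "(x, v, Inr i) \<in> I" using x v that by (auto simp: data_coords_def)
      note coord = poly_on_coord[OF this]
      have "flatten_point p (x, v, Inr i) = snd (p x v) i" for p :: "('v, 'w) data_point"
        by (simp add: flatten_point_def)
      then show ?thesis using coord by (simp only:)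
    qed
  qed (use x in simp_all)
  then show ?thesis by (intro exI)
qed

lemma mon_comm_monoid:
  assumes "x \<in> T" shows "comm_monoid (mon_at P \<mu> x)"
  by (rule comm_monoidI) (auto simp: mon_simps mon_mult[OF assms] mon_one[OF assms] m_ac mon_closed[OF assms])

lemma Gr_at_comm_group: "x \<in> T \<Longrightarrow> comm_group (Gr_at P \<mu> x)"
  unfolding Gr_at_def by (rule comm_group_Gr[OF mon_comm_monoid])

lemma leq_point:
  "pt_leq (\<mu>p p) x = {(s, t). s \<in> L x \<and> t \<in> L x \<and> (gs x s, gs x t) \<in> ptpre x (p x)}"
  by (simp add: partree_at_point_def pullback_at_def pullback_rel_def)

lemma \<mu>p_simps: "pt_verts (\<mu>p p) = T" "pt_root (\<mu>p p) = pt_root \<mu>" "pt_children (\<mu>p p) = ch"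
  "pt_label (\<mu>p p) = L" "pt_chord (\<mu>p p) = pt_chord \<mu>" "mp_mon (\<mu>p p) = \<Pi>m" "mp_act (\<mu>p p) = mp_act \<mu>"
  by (simp_all add: partree_at_point_def)

lemma ptpre_good:
  assumes "p \<in> \<Sigma>" "x \<in> T"
  shows "total_preorder_on (gr_set_at P act \<mu> x) (ptpre x (p x))"
    and "compatible_rel (Gr_at P \<mu> x) (gr_act_at P act \<mu> x) (ptpre x (p x))"
proof -
  interpret FP: framed_preotree "Gr_at P \<mu> x" "gr_act_at P act \<mu> x" "gr_set_at P act \<mu> x" "\<tau> x" "gen x" "enum x"
    by (rule framed_at[OF assms(2)])
  obtain f g where enc: "encoded_by (Gr_at P \<mu> x) (gr_act_at P act \<mu> x) (\<tau> x) (gen x) (enum x) (p x) f g"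
    using encoding_at[OF assms] by blast
  show "total_preorder_on (gr_set_at P act \<mu> x) (ptpre x (p x))"
    unfolding FP.point_preorder_eq[OF enc] by (rule FP.preotree_preorder_total[OF FP.enc_nd[OF enc]])
  show "compatible_rel (Gr_at P \<mu> x) (gr_act_at P act \<mu> x) (ptpre x (p x))"
    unfolding FP.point_preorder_eq[OF enc] by (rule FP.preotree_preorder_compatible[OF FP.enc_nd[OF enc]])
qed

lemma gs_in: "x \<in> T \<Longrightarrow> s \<in> L x \<Longrightarrow> gs x s \<in> gr_set_at P act \<mu> x"
  unfolding gr_set_at_def by (rule gr_set_of_in[OF mon_comm_monoid])

lemma leq_total:
  assumes "p \<in> \<Sigma>" "x \<in> T" shows "total_preorder_on (L x) (pt_leq (\<mu>p p) x)"
proof -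
  have r: "refl_on (gr_set_at P act \<mu> x) (ptpre x (p x))" "trans (ptpre x (p x))"
    "total_on (gr_set_at P act \<mu> x) (ptpre x (p x))"
    using ptpre_good(1)[OF assms] unfolding total_preorder_on_def preorder_on_def by auto
  have "refl_on (L x) (pt_leq (\<mu>p p) x)"
    unfolding leq_point using refl_onD[OF r(1) gs_in[OF assms(2)]] by (auto simp: refl_on_def)
  moreover have "trans (pt_leq (\<mu>p p) x)"
    unfolding leq_point by (rule transI) (use transD[OF r(2)] in blast)
  moreover have "total_on (L x) (pt_leq (\<mu>p p) x)"
  proof (rule total_onI)
    fix s t assume st: "s \<in> L x" "t \<in> L x"
    have "(gs x s, gs x t) \<in> ptpre x (p x) \<or> (gs x t, gs x s) \<in> ptpre x (p x)"
      using r(3) refl_onD[OF r(1)] gs_in[OF assms(2)] st unfolding total_on_def by metis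
    then show "(s, t) \<in> pt_leq (\<mu>p p) x \<or> (t, s) \<in> pt_leq (\<mu>p p) x"
      using st unfolding leq_point by blast
  qed
  moreover have "pt_leq (\<mu>p p) x \<subseteq> L x \<times> L x" unfolding leq_point by blast
  ultimately show ?thesis unfolding total_preorder_on_def preorder_on_def by blast
qed

text \<open>Transports the condition on comparable children of a partree from \<open>\<mu>\<close>
  to any point.\<close>

lemma leq_equiv:
  assumes "p \<in> \<Sigma>" "x \<in> T" "rel_equiv (pt_leq (\<mu>p p) x) s t" shows "rel_equiv (pt_leq \<mu> x) s t"
proof -
  interpret FP: framed_preotree "Gr_at P \<mu> x" "gr_act_at P act \<mu> x" "gr_set_at P act \<mu> x" "\<tau> x" "gen x" "enum x"
    by (rule framed_at[OF assms(2)])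
  obtain f g where enc: "encoded_by (Gr_at P \<mu> x) (gr_act_at P act \<mu> x) (\<tau> x) (gen x) (enum x) (p x) f g"
    using encoding_at[OF assms(1,2)] by blast
  obtain f' g' where nd: "numerical_data (Gr_at P \<mu> x) (gr_act_at P act \<mu> x) (\<tau> x) f' g'"
    and leq: "pt_leq \<mu> x = pullback_at P act \<mu> x (preotree_preorder (\<tau> x) (gr_act_at P act \<mu> x) f' g')"
    using corr[OF assms(2)] unfolding corresponding_preotree_def by blast
  have *: "s \<in> L x" "t \<in> L x" "(gs x s, gs x t) \<in> preotree_preorder (\<tau> x) (gr_act_at P act \<mu> x) f g"
    "(gs x t, gs x s) \<in> preotree_preorder (\<tau> x) (gr_act_at P act \<mu> x) f g"
    using assms(3) unfolding rel_equiv_def leq_point FP.point_preorder_eq[OF enc] by blast+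
  have "(gs x s, gs x t) \<in> preotree_preorder (\<tau> x) (gr_act_at P act \<mu> x) f' g'"
    "(gs x t, gs x s) \<in> preotree_preorder (\<tau> x) (gr_act_at P act \<mu> x) f' g'"
    using FP.equiv_independent[OF FP.enc_nd[OF enc] nd FP.root_vert] *(3,4) unfolding preotree_preorder_def by blast+
  then show ?thesis using *(1,2) unfolding rel_equiv_def leq pullback_at_def pullback_rel_def by blast
qed

definition refines :: "('v, 'w) data_point \<Rightarrow> bool" where
  "refines p \<longleftrightarrow> (\<forall>x\<in>T. \<forall>y\<in>ch x. \<forall>s\<in>L y. \<forall>t\<in>L y. (s, t) \<in> pt_leq (\<mu>p p) y \<longrightarrow> (s, t) \<in> pt_leq (\<mu>p p) x)"

text \<open>The other axioms either do not involve \<open>pt_leq\<close> or hold at every point: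
  totality and compatibility come from the encoded numerical data, and the condition on comparable
  children from \<open>leq_equiv\<close>.\<close>

lemma monoid_partree_point:
  assumes p: "p \<in> \<Sigma>"
  shows "monoid_partree P act S (\<mu>p p) \<longleftrightarrow> refines p"
proof
  assume "monoid_partree P act S (\<mu>p p)"
  then show "refines p" unfolding monoid_partree_def \<mu>p_simps refines_def by (elim conjE)
next
  assume r: "refines p"
  note ax = partree_mu[unfolded monoid_partree_def] and pax = partree[unfolded partree_on_def]
  have "partree_on S (\<mu>p p)"
    unfolding partree_on_def \<mu>p_simps
  proof (intro conjI)
    show "\<forall>x\<in>T. total_preorder_on (L x) (pt_leq (\<mu>p p) x)" using leq_total[OF p] by blast
    from pax have *: "\<forall>x\<in>T. \<forall>s\<in>L x. \<forall>t\<in>L x. rel_equiv (pt_leq \<mu> x) s t \<longrightarrow> ch x = {} \<or>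
      (\<forall>y\<in>ch x. \<forall>z\<in>ch x. s \<in> L y \<and> t \<in> L z \<longrightarrow> (y, z) \<in> pt_chord \<mu> x \<or> (z, y) \<in> pt_chord \<mu> x)" by (elim conjE)
    show "\<forall>x\<in>T. \<forall>s\<in>L x. \<forall>t\<in>L x. rel_equiv (pt_leq (\<mu>p p) x) s t \<longrightarrow> ch x = {} \<or>
      (\<forall>y\<in>ch x. \<forall>z\<in>ch x. s \<in> L y \<and> t \<in> L z \<longrightarrow> (y, z) \<in> pt_chord \<mu> x \<or> (z, y) \<in> pt_chord \<mu> x)"
    proof (intro ballI impI)
      fix x s t assume h: "x \<in> T" "s \<in> L x" "t \<in> L x" "rel_equiv (pt_leq (\<mu>p p) x) s t"
      from *[THEN bspec, OF h(1), THEN bspec, OF h(2), THEN bspec, OF h(3), THEN mp, OF leq_equiv[OF p h(1,4)]]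
      show "ch x = {} \<or> (\<forall>y\<in>ch x. \<forall>z\<in>ch x. s \<in> L y \<and> t \<in> L z \<longrightarrow> (y, z) \<in> pt_chord \<mu> x \<or> (z, y) \<in> pt_chord \<mu> x)" .
    qed
    from pax show "finite_rooted_tree T (pt_root \<mu>) ch" by (elim conjE)
    from pax show "\<forall>x\<in>T. partial_order_on (ch x) (pt_chord \<mu> x)" by (elim conjE)
    from pax show "L (pt_root \<mu>) = S" by (elim conjE)
    from pax show "\<forall>x\<in>T. ch x \<noteq> {} \<longrightarrow> L x = (\<Union>y\<in>ch x. L y) \<and> disjoint_family_on L (ch x)" by (elim conjE)
  qed
  moreover have "\<forall>x\<in>T. \<exists>r. total_preorder_on (gr_set (mon_at P \<mu> x) act (L x)) r \<and>
      compatible_rel (Gr (mon_at P \<mu> x)) (gr_act (mon_at P \<mu> x) act (L x)) r \<and>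
      pt_leq (\<mu>p p) x = pullback_rel (gs x) (L x) r"
  proof
    fix x assume x: "x \<in> T"
    show "\<exists>r. total_preorder_on (gr_set (mon_at P \<mu> x) act (L x)) r \<and>
      compatible_rel (Gr (mon_at P \<mu> x)) (gr_act (mon_at P \<mu> x) act (L x)) r \<and>
      pt_leq (\<mu>p p) x = pullback_rel (gs x) (L x) r"
      using ptpre_good[OF p x] unfolding gr_set_at_def Gr_at_def gr_act_at_def
      by (intro exI[of _ "ptpre x (p x)"] conjI)
        (simp_all add: leq_point pullback_rel_def Gr_at_def gr_act_at_def)
  qed
  ultimately show "monoid_partree P act S (\<mu>p p)"
    unfolding monoid_partree_def \<mu>p_simps
    using r[unfolded refines_def] ax by (elim conjE) (intro conjI; assumption)
qed

text \<open>The decision about integer solutions concerns all integer tuples, so being a genuine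
  exponent vector has to be part of the predicate. \<open>d\<close> is the offset of the block of
  \<open>K\<close> variables.\<close>

definition guard :: "nat set \<Rightarrow> nat \<Rightarrow> (nat \<Rightarrow> int) \<Rightarrow> bool" where
  "guard J d N \<longleftrightarrow> (\<forall>i\<in>{..<K}. N (d + i) \<ge> 0 \<and> (i \<in> J \<or> N (d + i) = 0))"

text \<open>Here \<open>nat\<close> truncates negative entries; the link with \<open>gr_elt\<close>
  is made only under \<open>guard\<close>.\<close>

definition elt :: "nat \<Rightarrow> (nat \<Rightarrow> int) \<Rightarrow> 'u" where
  "elt d N = pw (\<lambda>i. nat (N (d + i)))"

text \<open>The counterpart in the group completion, where negative exponents make sense, so that it
  is affine in \<open>N\<close> without restriction. Outside \<open>J\<close> the factor is one,
  since \<open>a i\<close> need not lie in the monoid at \<open>x\<close>.\<close>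

definition gr_elt :: "'v \<Rightarrow> nat set \<Rightarrow> nat \<Rightarrow> (nat \<Rightarrow> int) \<Rightarrow> ('u \<times> 'u) set" where
  "gr_elt x J d N = finprod (Gr_at P \<mu> x)
     (\<lambda>i. if i \<in> J then gr_of (mon_at P \<mu> x) (a i) [^]\<^bsub>Gr_at P \<mu> x\<^esub> N (d + i) else \<one>\<^bsub>Gr_at P \<mu> x\<^esub>) {..<K}"

definition gens_in :: "'v \<Rightarrow> nat set" where
  "gens_in x = {i. i < K \<and> a i \<in> \<Pi>m x}"

lemma elt_closed: "elt d N \<in> carrier P"
  unfolding elt_def by (rule pw_closed)

lemma elt_mon: "x \<in> T \<Longrightarrow> J \<subseteq> gens_in x \<Longrightarrow> guard J d N \<Longrightarrow> elt d N \<in> \<Pi>m x"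
  unfolding elt_def pw_mon_iff guard_def gens_in_def by auto

lemma coord_affine: "d \<le> K \<Longrightarrow> i < K \<Longrightarrow> int_affine {..<2 * K} (\<lambda>N. N (d + i))"
  by (rule int_affine_coord) auto

lemma guard_definable: "d \<le> K \<Longrightarrow> definable (\<lambda>p N. guard J d N)"
  unfolding guard_def
  by (intro definable_ball definable_conj definable_disj definable_const definable_int_nonneg
      definable_int_eq int_affine_const coord_affine) auto

lemma gr_of_gen:
  assumes "x \<in> T" "i \<in> gens_in x"
  shows "gr_of (mon_at P \<mu> x) (a i) \<in> carrier (Gr_at P \<mu> x)"
  unfolding Gr_at_def by (rule gr_of_closed[OF mon_comm_monoid[OF assms(1)]]) (use assms(2) in \<open>simp add: gens_in_def mon_simps\<close>)

lemma gr_elt_affine: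
  assumes x: "x \<in> T" and J: "J \<subseteq> gens_in x" and d: "d \<le> K"
  shows "affine_map (Gr_at P \<mu> x) {..<2 * K} (gr_elt x J d)"
proof -
  interpret G: comm_group "Gr_at P \<mu> x" by (rule Gr_at_comm_group[OF x])
  show ?thesis
    unfolding gr_elt_def
  proof (rule G.affine_map_finprod)
    fix i assume "i \<in> {..<K}"
    then show "affine_map (Gr_at P \<mu> x) {..<2 * K} (\<lambda>N. if i \<in> J
      then gr_of (mon_at P \<mu> x) (a i) [^]\<^bsub>Gr_at P \<mu> x\<^esub> N (d + i) else \<one>\<^bsub>Gr_at P \<mu> x\<^esub>)"
      using G.affine_map_pow[OF coord_affine[OF d, of i] gr_of_gen[OF x, of i]] J
        G.affine_map_const[OF G.one_closed] by (cases "i \<in> J") auto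
  qed simp
qed

lemma gr_of_elt:
  assumes x: "x \<in> T" and J: "J \<subseteq> gens_in x" and g: "guard J d N"
  shows "gr_of (mon_at P \<mu> x) (elt d N) = gr_elt x J d N"
proof -
  interpret G: comm_group "Gr_at P \<mu> x" by (rule Gr_at_comm_group[OF x])
  let ?gr = "gr_of (mon_at P \<mu> x)" and ?n = "\<lambda>i. nat (N (d + i))"
  let ?h = "\<lambda>i. if i \<in> J then ?gr (a i) [^]\<^bsub>Gr_at P \<mu> x\<^esub> N (d + i) else \<one>\<^bsub>Gr_at P \<mu> x\<^esub>"
  have mult: "?gr (u \<otimes> v) = ?gr u \<otimes>\<^bsub>Gr_at P \<mu> x\<^esub> ?gr v" if "u \<in> \<Pi>m x" "v \<in> \<Pi>m x" for u v
    using gr_of_mult[OF mon_comm_monoid[OF x], of u v] that by (simp add: mon_simps Gr_at_def)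
  have one: "?gr \<one> = \<one>\<^bsub>Gr_at P \<mu> x\<^esub>"
    using gr_of_one[of "mon_at P \<mu> x"] by (simp add: mon_simps Gr_at_def)
  have pow_in: "u [^] (m :: nat) \<in> \<Pi>m x" if "u \<in> \<Pi>m x" for u m
    using that by (induction m) (auto simp: mon_one[OF x] intro: mon_mult[OF x])
  have pow: "?gr (u [^] (m :: nat)) = ?gr u [^]\<^bsub>Gr_at P \<mu> x\<^esub> m" if "u \<in> \<Pi>m x" for u m
    using that by (induction m) (simp_all add: one mult pow_in)
  have h: "?h i \<in> carrier (Gr_at P \<mu> x)" for i
    using gr_of_gen[OF x, of i] J by (auto intro: G.int_pow_closed)
  have "k \<le> K \<Longrightarrow> ?gr (pow_prod k a ?n) = finprod (Gr_at P \<mu> x) ?h {..<k}" for k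
  proof (induction k)
    case 0
    then show ?case by (simp add: pow_prod_0 one)
  next
    case (Suc k)
    have k: "k < K" using Suc.prems by simp
    have J_k: "?n k > 0 \<Longrightarrow> k \<in> J" using g k unfolding guard_def by auto
    have fac: "a k [^] ?n k \<in> \<Pi>m x \<and> ?gr (a k [^] ?n k) = ?h k"
    proof (cases "k \<in> J")
      case True
      then have ak: "a k \<in> \<Pi>m x" using J by (auto simp: gens_in_def)
      have "N (d + k) \<ge> 0" using g k unfolding guard_def by auto
      then have "?gr (a k) [^]\<^bsub>Gr_at P \<mu> x\<^esub> N (d + k) = ?gr (a k) [^]\<^bsub>Gr_at P \<mu> x\<^esub> ?n k"
        by (metis int_pow_int nat_0_le)
      then show ?thesis using True ak pow pow_in by simp
    next
      case False
      then have "?n k = 0" using J_k by blast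
      then show ?thesis using False one mon_one[OF x] by simp
    qed
    have rest: "pow_prod k a ?n \<in> \<Pi>m x"
      by (rule pow_prod_mon[OF x]) (use k g J in \<open>auto simp: guard_def gens_in_def\<close>)
    have "pow_prod (Suc k) a ?n = a k [^] ?n k \<otimes> pow_prod k a ?n"
      by (rule pow_prod_Suc) (use a_closed Suc.prems in auto)
    then have "?gr (pow_prod (Suc k) a ?n) = ?h k \<otimes>\<^bsub>Gr_at P \<mu> x\<^esub> finprod (Gr_at P \<mu> x) ?h {..<k}"
      using mult[of "a k [^] ?n k", OF _ rest] fac Suc by simp
    also have "\<dots> = finprod (Gr_at P \<mu> x) ?h {..<Suc k}"
      unfolding lessThan_Suc by (rule G.finprod_insert[symmetric]) (use h in auto)
    finally show ?case .
  qed
  then show ?thesis unfolding elt_def gr_elt_def by simp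
qed

text \<open>Moves a comparison in \<open>L x\<close> to the group completion, where the members of
  the family are affine translates of one fixed element.\<close>

lemma gs_elt:
  assumes "x \<in> T" "J \<subseteq> gens_in x" "guard J d N" "s \<in> L x"
  shows "gs x (act (elt d N) s) = gr_act_at P act \<mu> x (gr_elt x J d N) (gs x s)"
  unfolding gr_of_elt[OF assms(1-3), symmetric] gr_act_at_def
  by (rule gr_set_of_act[OF mon_comm_monoid[OF assms(1)] _ assms(4)]) (simp add: mon_simps elt_mon[OF assms(1-3)])

text \<open>Definability where only tuples satisfying \<open>G\<close> count. The predicates about
  \<open>elt\<close> are controlled only there.\<close>

definition gdef :: "((nat \<Rightarrow> int) \<Rightarrow> bool) \<Rightarrow> (('v, 'w) data_point \<Rightarrow> (nat \<Rightarrow> int) \<Rightarrow> bool) \<Rightarrow> bool" where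
  "gdef G R \<longleftrightarrow> definable (\<lambda>p N. G N \<and> R p N)"

lemma gdef_cong:
  assumes "gdef G R" "\<And>p N. p \<in> \<Sigma> \<Longrightarrow> G N \<Longrightarrow> R' p N \<longleftrightarrow> R p N" shows "gdef G R'"
  using assms(1) unfolding gdef_def by (rule definable_cong) (use assms(2) in blast)

lemma gdef_conj:
  assumes "gdef G R" "gdef G R'" shows "gdef G (\<lambda>p N. R p N \<and> R' p N)"
  unfolding gdef_def
  by (rule definable_cong[OF definable_conj[OF assms[unfolded gdef_def]]]) blast

context
  fixes G assumes G: "definable (\<lambda>p N. G N)"
begin

lemma gdef_const: "gdef G (\<lambda>p N. b)"
  unfolding gdef_def by (intro definable_conj G definable_const)

lemma gdef_not:
  assumes "gdef G R" shows "gdef G (\<lambda>p N. \<not> R p N)"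
  unfolding gdef_def
  by (rule definable_cong[OF definable_conj[OF G definable_not[OF assms[unfolded gdef_def]]]]) blast

lemma gdef_disj:
  assumes "gdef G R" "gdef G R'" shows "gdef G (\<lambda>p N. R p N \<or> R' p N)"
  by (rule gdef_cong[OF gdef_not[OF gdef_conj[OF gdef_not[OF assms(1)] gdef_not[OF assms(2)]]]]) blast

lemma gdef_ball:
  assumes "finite A" "\<And>x. x \<in> A \<Longrightarrow> gdef G (R x)" shows "gdef G (\<lambda>p N. \<forall>x\<in>A. R x p N)"
  using assms by (induction A) (simp_all add: gdef_const gdef_conj)

lemma gdef_bex:
  assumes "finite A" "\<And>x. x \<in> A \<Longrightarrow> gdef G (R x)" shows "gdef G (\<lambda>p N. \<exists>x\<in>A. R x p N)"
  using assms by (induction A) (simp_all add: gdef_const gdef_disj)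

lemma leq_gdef:
  assumes x: "x \<in> T" and st: "s \<in> L x" "t \<in> L x" and J: "J \<subseteq> gens_in x" "J' \<subseteq> gens_in x"
    and d: "d \<le> K" "d' \<le> K" and g: "\<And>N. G N \<Longrightarrow> guard J d N" "\<And>N. G N \<Longrightarrow> guard J' d' N"
  shows "gdef G (\<lambda>p N. (act (elt d N) s, act (elt d' N) t) \<in> pt_leq (\<mu>p p) x)"
proof -
  obtain F H where fam: "preotree_family (Gr_at P \<mu> x) (gr_act_at P act \<mu> x) (gr_set_at P act \<mu> x) (\<tau> x)
    (gen x) (enum x) I {..<2 * K} \<Sigma> \<iota> (\<lambda>p. p x) F H"
    using family_at[OF x] by blast
  have "definable (\<lambda>p N. (gr_act_at P act \<mu> x (gr_elt x J d N) (gs x s),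
      gr_act_at P act \<mu> x (gr_elt x J' d' N) (gs x t)) \<in> ptpre x (p x))"
    by (rule preotree_family.preorder_definable[OF fam gs_in[OF x st(1)] gs_in[OF x st(2)]
          gr_elt_affine[OF x J(1) d(1)] gr_elt_affine[OF x J(2) d(2)]])
  then show ?thesis
    unfolding gdef_def
  proof (rule definable_cong[OF definable_conj[OF G]])
    fix p N
    show "G N \<and> (act (elt d N) s, act (elt d' N) t) \<in> pt_leq (\<mu>p p) x \<longleftrightarrow> G N \<and>
        (gr_act_at P act \<mu> x (gr_elt x J d N) (gs x s), gr_act_at P act \<mu> x (gr_elt x J' d' N) (gs x t)) \<in> ptpre x (p x)"
    proof (cases "G N")
      case True
      note g' = g[OF True]
      have "act (elt d N) s \<in> L x" "act (elt d' N) t \<in> L x"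
        using label_act[OF x elt_mon[OF x J(1) g'(1)] st(1)] label_act[OF x elt_mon[OF x J(2) g'(2)] st(2)] by blast+
      then show ?thesis
        unfolding leq_point gs_elt[OF x J(1) g'(1) st(1), symmetric] gs_elt[OF x J(2) g'(2) st(2), symmetric] by simp
    qed simp
  qed
qed

end

section \<open>The preorder of the partree along families\<close>

lemma common_path_\<mu>p: "common_path (\<mu>p p) s t xs \<longleftrightarrow> common_path \<mu> s t xs"
  unfolding common_path_def \<mu>p_simps ..

text \<open>The outcome at the end of the path is passed as the truth value \<open>b\<close>,
  because it depends on positions alone and is constant along a family.\<close>

definition path_order :: "('v, 'w) data_point \<Rightarrow> 's \<Rightarrow> 's \<Rightarrow> 'v list \<Rightarrow> bool \<Rightarrow> bool" where
  "path_order p s t xs b \<longleftrightarrow> ((\<forall>x\<in>set xs. rel_equiv (pt_leq (\<mu>p p) x) s t) \<and> b) \<or>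
     (\<exists>i\<in>{..<length xs}. (\<forall>j\<in>{..<i}. rel_equiv (pt_leq (\<mu>p p) (xs ! j)) s t) \<and> rel_strict (pt_leq (\<mu>p p) (xs ! i)) s t)"

definition fork_less :: "'v \<Rightarrow> 's \<Rightarrow> 's \<Rightarrow> bool" where
  "fork_less x s t \<longleftrightarrow> ch x = {} \<or>
     (\<exists>y\<in>ch x. \<exists>z\<in>ch x. s \<in> L y \<and> t \<in> L z \<and> rel_strict (pt_chord \<mu> x) y z)"

lemma partree_preorder_path:
  assumes "common_path \<mu> s t xs"
  shows "(s, t) \<in> partree_preorder (\<mu>p p) \<longleftrightarrow> path_order p s t xs (fork_less (last xs) s t)"
proof -
  have "(s, t) \<in> partree_preorder (\<mu>p p) \<longleftrightarrow>
      (\<exists>xs. common_path \<mu> s t xs \<and> path_order p s t xs (fork_less (last xs) s t))"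
    unfolding partree_preorder_def path_order_def fork_less_def \<mu>p_simps common_path_\<mu>p
    by (simp add: Bex_def Ball_def)
  then show ?thesis using assms common_path_unique by blast
qed

lemma partree_preorder_no_path:
  assumes "\<nexists>xs. common_path \<mu> s t xs" shows "(s, t) \<notin> partree_preorder (\<mu>p p)"
  using assms unfolding partree_preorder_def common_path_\<mu>p by blast

lemma fork_less_cong:
  assumes "x \<in> T" "prof s = prof s'" "prof t = prof t'"
  shows "fork_less x s t \<longleftrightarrow> fork_less x s' t'"
  unfolding fork_less_def
  using prof_label[OF assms(2) child_T[OF assms(1)]] prof_label[OF assms(3) child_T[OF assms(1)]] by blast

lemma partree_preorder_S: "(s, t) \<in> partree_preorder (\<mu>p p) \<Longrightarrow> s \<in> S \<and> t \<in> S"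
proof -
  assume "(s, t) \<in> partree_preorder (\<mu>p p)"
  then obtain xs where "common_path \<mu> s t xs" using partree_preorder_no_path by blast
  then show "s \<in> S \<and> t \<in> S"
    using common_path_set[of s t xs "last xs"] common_path_hd[of \<mu> s t xs] label_S by (metis last_in_set)
qed

lemma prof_elt:
  assumes "s \<in> S" "\<And>x. x \<in> prof s \<Longrightarrow> J \<subseteq> gens_in x" "guard J d N"
  shows "prof (act (elt d N) s) = prof s"
proof (rule prof_act[OF assms(1)])
  show "elt d N \<in> \<Pi>m x" if "x \<in> prof s" for x
    using elt_mon[OF _ assms(2)[OF that] assms(3)] that by (simp add: prof_def)
qed

lemma path_gdef:
  assumes G: "definable (\<lambda>p N. G N)" and xs: "common_path \<mu> s t xs"
    and J: "\<And>x. x \<in> prof s \<Longrightarrow> J \<subseteq> gens_in x" "\<And>x. x \<in> prof t \<Longrightarrow> J' \<subseteq> gens_in x"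
    and d: "d \<le> K" "d' \<le> K" and g: "\<And>N. G N \<Longrightarrow> guard J d N" "\<And>N. G N \<Longrightarrow> guard J' d' N"
  shows "gdef G (\<lambda>p N. path_order p (act (elt d N) s) (act (elt d' N) t) xs b)"
proof -
  have atom: "gdef G (\<lambda>p N. (act (elt d N) s, act (elt d' N) t) \<in> pt_leq (\<mu>p p) x)"
    "gdef G (\<lambda>p N. (act (elt d' N) t, act (elt d N) s) \<in> pt_leq (\<mu>p p) x)" if "x \<in> set xs" for x
  proof -
    have x: "x \<in> T" "s \<in> L x" "t \<in> L x" using common_path_set[OF xs that] by blast+
    then have JJ: "J \<subseteq> gens_in x" "J' \<subseteq> gens_in x" using J by (simp_all add: prof_def)
    show "gdef G (\<lambda>p N. (act (elt d N) s, act (elt d' N) t) \<in> pt_leq (\<mu>p p) x)"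
      by (rule leq_gdef[OF G x JJ d g])
    show "gdef G (\<lambda>p N. (act (elt d' N) t, act (elt d N) s) \<in> pt_leq (\<mu>p p) x)"
      by (rule leq_gdef[OF G x(1,3,2) JJ(2,1) d(2,1) g(2,1)])
  qed
  show ?thesis
    unfolding path_order_def rel_equiv_def rel_strict_def
    by (intro gdef_disj[OF G] gdef_conj gdef_ball[OF G] gdef_bex[OF G] gdef_not[OF G] gdef_const[OF G] atom) auto
qed

text \<open>Constant positions leave two cases: the path of the base elements serves every member of
  the family, or no member has a path and the predicate is constantly false.\<close>

lemma preorder_gdef:
  assumes G: "definable (\<lambda>p N. G N)" and st: "s \<in> S" "t \<in> S"
    and J: "\<And>x. x \<in> prof s \<Longrightarrow> J \<subseteq> gens_in x" "\<And>x. x \<in> prof t \<Longrightarrow> J' \<subseteq> gens_in x"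
    and d: "d \<le> K" "d' \<le> K" and g: "\<And>N. G N \<Longrightarrow> guard J d N" "\<And>N. G N \<Longrightarrow> guard J' d' N"
  shows "gdef G (\<lambda>p N. (act (elt d N) s, act (elt d' N) t) \<in> partree_preorder (\<mu>p p))"
proof -
  have prof: "prof (act (elt d N) s) = prof s" "prof (act (elt d' N) t) = prof t" if "G N" for N
    using prof_elt[OF st(1) J(1) g(1)[OF that]] prof_elt[OF st(2) J(2) g(2)[OF that]] by blast+
  show ?thesis
  proof (cases "\<exists>xs. common_path \<mu> s t xs")
    case True
    then obtain xs where xs: "common_path \<mu> s t xs" by blast
    show ?thesis
    proof (rule gdef_cong[OF path_gdef[OF G xs J d g]])
      fix p N assume "G N"
      note pr = prof[OF this]
      have "common_path \<mu> (act (elt d N) s) (act (elt d' N) t) xs"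
        by (rule common_path_cong[OF pr[symmetric] xs])
      from partree_preorder_path[OF this] show "(act (elt d N) s, act (elt d' N) t) \<in> partree_preorder (\<mu>p p) \<longleftrightarrow>
          path_order p (act (elt d N) s) (act (elt d' N) t) xs (fork_less (last xs) s t)"
        unfolding fork_less_cong[OF common_path_last_T[OF xs] pr] .
    qed
  next
    case False
    show ?thesis
    proof (rule gdef_cong[OF gdef_const[OF G, of False]])
      fix p N assume "G N"
      note pr = prof[OF this]
      have "\<nexists>xs. common_path \<mu> (act (elt d N) s) (act (elt d' N) t) xs"
        using False common_path_cong[OF pr] by blast
      then show "(act (elt d N) s, act (elt d' N) t) \<in> partree_preorder (\<mu>p p) \<longleftrightarrow> False"
        using partree_preorder_no_path by blast
    qed
  qed
qed

section \<open>Loci in the data space\<close>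

definition sdef :: "(('v, 'w) data_point \<Rightarrow> bool) \<Rightarrow> bool" where
  "sdef R \<longleftrightarrow> (\<exists>C. sigma_semialg I C \<and> {p \<in> \<Sigma>. R p} = {p \<in> \<Sigma>. \<iota> p \<in> C})"

lemma sdef_cong: "sdef R \<Longrightarrow> (\<And>p. p \<in> \<Sigma> \<Longrightarrow> R' p \<longleftrightarrow> R p) \<Longrightarrow> sdef R'"
  unfolding sdef_def by (simp cong: conj_cong)

lemma sdef_True: "sdef (\<lambda>p. True)"
  unfolding sdef_def
  by (intro exI[of _ "aff_space I"] conjI sigma_semialg_base semialgebraic_Q_space) auto

lemma sdef_conj:
  assumes "sdef R" "sdef R'" shows "sdef (\<lambda>p. R p \<and> R' p)"
proof -
  obtain C C' where C: "sigma_semialg I C" "{p \<in> \<Sigma>. R p} = {p \<in> \<Sigma>. \<iota> p \<in> C}"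
    "sigma_semialg I C'" "{p \<in> \<Sigma>. R' p} = {p \<in> \<Sigma>. \<iota> p \<in> C'}"
    using assms unfolding sdef_def by (elim exE conjE)
  have "{p \<in> \<Sigma>. R p \<and> R' p} = {p \<in> \<Sigma>. R p} \<inter> {p \<in> \<Sigma>. R' p}" by blast
  also have "\<dots> = {p \<in> \<Sigma>. \<iota> p \<in> C \<inter> C'}" unfolding C(2,4) by blast
  finally show ?thesis unfolding sdef_def using sigma_semialg_Int[OF C(1,3)] by blast
qed

lemma sdef_ball:
  assumes "finite A" "\<And>x. x \<in> A \<Longrightarrow> sdef (R x)" shows "sdef (\<lambda>p. \<forall>x\<in>A. R x p)"
  using assms by (induction A) (simp_all add: sdef_True sdef_conj)

lemma sdef_gdef:
  assumes "gdef G R" "gdef G R'" shows "sdef (\<lambda>p. \<forall>N. G N \<longrightarrow> R p N \<longrightarrow> R' p N)"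
proof -
  have "definable (\<lambda>p N. (G N \<and> R p N) \<longrightarrow> (G N \<and> R' p N))"
    using assms unfolding gdef_def by (rule definable_imp)
  then have "definable (\<lambda>p N. G N \<longrightarrow> R p N \<longrightarrow> R' p N)" by (rule definable_cong) blast
  then show ?thesis unfolding sdef_def by (rule sigma_semialg_definable)
qed

definition base :: "'u \<Rightarrow> 's set" where
  "base u = (SOME B. finite B \<and> B \<subseteq> S \<and>
     (\<forall>s\<in>S. \<exists>s0\<in>B. \<exists>n. s = act (pw n) s0 \<and> (\<forall>i<K. n i > 0 \<longrightarrow> i \<in> allowed u s0)))"

lemma base:
  assumes "u \<in> carrier P"
  shows "finite (base u)" "base u \<subseteq> S"
    "\<forall>s\<in>S. \<exists>s0\<in>base u. \<exists>n. s = act (pw n) s0 \<and> (\<forall>i<K. n i > 0 \<longrightarrow> i \<in> allowed u s0)"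
  using someI_ex[OF finite_base[OF assms]] unfolding base_def by simp_all

definition pair_guard :: "'u \<Rightarrow> 's \<Rightarrow> 's \<Rightarrow> (nat \<Rightarrow> int) \<Rightarrow> bool" where
  "pair_guard u s t N \<longleftrightarrow> guard (allowed u s) 0 N \<and> guard (allowed u t) K N"

lemma pair_guard_definable: "definable (\<lambda>p N. pair_guard u s t N)"
  unfolding pair_guard_def by (intro definable_conj guard_definable) auto

text \<open>Turns quantification over the infinite set \<open>S\<close> into finitely many base
  pairs and a universal quantifier over integer tuples.\<close>

lemma all_pairs:
  assumes u: "u \<in> carrier P"
  shows "(\<forall>s\<in>S. \<forall>t\<in>S. \<psi> s t) \<longleftrightarrow> (\<forall>s\<in>base u. \<forall>t\<in>base u. \<forall>N. pair_guard u s t N \<longrightarrow>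
    \<psi> (act (elt 0 N) s) (act (elt K N) t))"
proof
  assume "\<forall>s\<in>S. \<forall>t\<in>S. \<psi> s t"
  then show "\<forall>s\<in>base u. \<forall>t\<in>base u. \<forall>N. pair_guard u s t N \<longrightarrow> \<psi> (act (elt 0 N) s) (act (elt K N) t)"
    using base(2)[OF u] act_S[OF elt_closed] by blast
next
  assume h: "\<forall>s\<in>base u. \<forall>t\<in>base u. \<forall>N. pair_guard u s t N \<longrightarrow> \<psi> (act (elt 0 N) s) (act (elt K N) t)"
  show "\<forall>s\<in>S. \<forall>t\<in>S. \<psi> s t"
  proof (intro ballI)
    fix s t assume st: "s \<in> S" "t \<in> S"
    obtain s0 n where s: "s0 \<in> base u" "s = act (pw n) s0" "\<forall>i<K. n i > 0 \<longrightarrow> i \<in> allowed u s0"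
      using base(3)[OF u] st(1) by blast
    obtain t0 m where t: "t0 \<in> base u" "t = act (pw m) t0" "\<forall>i<K. m i > 0 \<longrightarrow> i \<in> allowed u t0"
      using base(3)[OF u] st(2) by blast
    \<comment> \<open>Both exponent vectors are packed into one tuple, the second shifted by
      \<open>K\<close>.\<close>
    define N where "N i = (if i < K then int (n i) else int (m (i - K)))" for i
    have "pair_guard u s0 t0 N"
      unfolding pair_guard_def guard_def using s(3) t(3) by (auto simp: N_def)
    moreover have "elt 0 N = pw n" "elt K N = pw m"
      unfolding elt_def by (rule pow_prod_cong; simp add: a_closed N_def)+
    ultimately show "\<psi> s t"
      using h[THEN bspec, OF s(1), THEN bspec, OF t(1), THEN spec, of N] s(2) t(2) by simp
  qed
qed

lemma allowed_gens: "x \<in> prof s \<Longrightarrow> allowed u s \<subseteq> gens_in x" "x \<in> prof (act u s) \<Longrightarrow> allowed u s \<subseteq> gens_in x"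
  by (auto simp: allowed_def gens_in_def)

text \<open>Respecting the preorder is closed under products. The base sets depend on the acting
  element, so the reduction to finitely many of them is essential.\<close>

lemma compatible_generators:
  "compatible_rel P act (partree_preorder (\<mu>p p)) \<longleftrightarrow> (\<forall>i\<in>{..<K}. \<forall>s\<in>S. \<forall>t\<in>S.
     (s, t) \<in> partree_preorder (\<mu>p p) \<longrightarrow> (act (a i) s, act (a i) t) \<in> partree_preorder (\<mu>p p))"
    (is "_ \<longleftrightarrow> ?gens")
proof
  assume "compatible_rel P act (partree_preorder (\<mu>p p))"
  then show ?gens unfolding compatible_rel_def using a_closed by blast
next
  assume gens: ?gens
  define ok where "ok u \<longleftrightarrow> (\<forall>s t. (s, t) \<in> partree_preorder (\<mu>p p) \<longrightarrow>
    (act u s, act u t) \<in> partree_preorder (\<mu>p p))" for u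
  have one: "ok \<one>" unfolding ok_def using partree_preorder_S act_one by metis
  have mult: "ok (u \<otimes> v)" if "ok u" "ok v" "u \<in> carrier P" "v \<in> carrier P" for u v
    unfolding ok_def
  proof (intro allI impI)
    fix s t assume st: "(s, t) \<in> partree_preorder (\<mu>p p)"
    then have "s \<in> S" "t \<in> S" using partree_preorder_S by blast+
    moreover have "(act u (act v s), act u (act v t)) \<in> partree_preorder (\<mu>p p)"
      using that(1,2) st unfolding ok_def by blast
    ultimately show "(act (u \<otimes> v) s, act (u \<otimes> v) t) \<in> partree_preorder (\<mu>p p)"
      using act_mult that(3,4) by simp
  qed
  have gen: "ok (a i)" if "i < K" for i
    unfolding ok_def using gens that partree_preorder_S by blast
  have pow: "ok (a i [^] (m :: nat))" if "i < K" for i m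
    using that by (induction m) (simp_all add: one mult gen a_closed)
  have "k \<le> K \<Longrightarrow> ok (pow_prod k a n)" for k n
  proof (induction k)
    case 0
    then show ?case by (simp add: pow_prod_0 one)
  next
    case (Suc k)
    have "pow_prod (Suc k) a n = a k [^] n k \<otimes> pow_prod k a n"
      by (rule pow_prod_Suc) (use a_closed Suc.prems in auto)
    moreover have "pow_prod k a n \<in> carrier P" by (rule pow_prod_closed) (use a_closed Suc.prems in auto)
    ultimately show ?case using Suc pow mult a_closed by simp
  qed
  then have "ok u" if "u \<in> carrier P" for u using a_gen[OF that] by auto
  then show "compatible_rel P act (partree_preorder (\<mu>p p))"
    unfolding compatible_rel_def ok_def by blast
qed

lemma sdef_compatible: "sdef (\<lambda>p. compatible_rel P act (partree_preorder (\<mu>p p)))"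
proof -
  have "sdef (\<lambda>p. \<forall>i\<in>{..<K}. \<forall>s\<in>base (a i). \<forall>t\<in>base (a i). \<forall>N. pair_guard (a i) s t N \<longrightarrow>
      (act (elt 0 N) s, act (elt K N) t) \<in> partree_preorder (\<mu>p p) \<longrightarrow>
      (act (a i) (act (elt 0 N) s), act (a i) (act (elt K N) t)) \<in> partree_preorder (\<mu>p p))"
  proof (intro sdef_ball sdef_gdef)
    fix i s t assume i: "i \<in> {..<K}" and st: "s \<in> base (a i)" "t \<in> base (a i)"
    have ai: "a i \<in> carrier P" using i a_closed by simp
    have S: "s \<in> S" "t \<in> S" using st base(2)[OF ai] by blast+
    note G = pair_guard_definable[of "a i" s t]
    have g: "\<And>N. pair_guard (a i) s t N \<Longrightarrow> guard (allowed (a i) s) 0 N"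
      "\<And>N. pair_guard (a i) s t N \<Longrightarrow> guard (allowed (a i) t) K N" unfolding pair_guard_def by blast+
    show "gdef (pair_guard (a i) s t) (\<lambda>p N. (act (elt 0 N) s, act (elt K N) t) \<in> partree_preorder (\<mu>p p))"
      by (rule preorder_gdef[OF G S allowed_gens(1) allowed_gens(1) _ _ g]) auto
    \<comment> \<open>By commutativity the image pair is the family with the same exponents based at
      \<open>act (a i) s\<close> and \<open>act (a i) t\<close>, whose positions
      \<open>allowed\<close> keeps constant too.\<close>
    have "gdef (pair_guard (a i) s t) (\<lambda>p N. (act (elt 0 N) (act (a i) s), act (elt K N) (act (a i) t)) \<in> partree_preorder (\<mu>p p))"
      by (rule preorder_gdef[OF G act_S[OF ai S(1)] act_S[OF ai S(2)] allowed_gens(2) allowed_gens(2) _ _ g]) auto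
    then show "gdef (pair_guard (a i) s t) (\<lambda>p N. (act (a i) (act (elt 0 N) s), act (a i) (act (elt K N) t)) \<in> partree_preorder (\<mu>p p))"
      by (simp only: act_commute[OF ai elt_closed S(1)] act_commute[OF ai elt_closed S(2)])
  qed (use base(1) a_closed in auto)
  then show ?thesis
    by (rule sdef_cong) (simp add: compatible_generators all_pairs[OF a_closed])
qed

text \<open>Only the positions of the elements themselves matter here, so the families for
  \<open>u = \<one>\<close> are used; membership in \<open>L y\<close> is then decided at the base
  elements.\<close>

lemma sdef_refines: "sdef refines"
proof -
  have step: "sdef (\<lambda>p. \<forall>s\<in>S. \<forall>t\<in>S. s \<in> L y \<longrightarrow> t \<in> L y \<longrightarrow> (s, t) \<in> pt_leq (\<mu>p p) y \<longrightarrow> (s, t) \<in> pt_leq (\<mu>p p) x)"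
    if x: "x \<in> T" and y: "y \<in> ch x" for x y
    unfolding all_pairs[OF one_closed]
  proof (intro sdef_ball)
    fix s t assume "s \<in> base \<one>" "t \<in> base \<one>"
    then have S: "s \<in> S" "t \<in> S" using base(2)[OF one_closed] by blast+
    have g: "guard (allowed \<one> s) 0 N" "guard (allowed \<one> t) K N" if "pair_guard \<one> s t N" for N
      using that unfolding pair_guard_def by blast+
    have lab: "act (elt 0 N) s \<in> L y \<longleftrightarrow> s \<in> L y" "act (elt K N) t \<in> L y \<longleftrightarrow> t \<in> L y"
      if "pair_guard \<one> s t N" for N
      using prof_label[OF prof_elt[OF S(1) allowed_gens(1) g(1)[OF that]] child_T[OF x y]]
        prof_label[OF prof_elt[OF S(2) allowed_gens(1) g(2)[OF that]] child_T[OF x y]] by blast+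
    note G = pair_guard_definable[of \<one> s t]
    show "sdef (\<lambda>p. \<forall>N. pair_guard \<one> s t N \<longrightarrow> act (elt 0 N) s \<in> L y \<longrightarrow> act (elt K N) t \<in> L y \<longrightarrow>
        (act (elt 0 N) s, act (elt K N) t) \<in> pt_leq (\<mu>p p) y \<longrightarrow> (act (elt 0 N) s, act (elt K N) t) \<in> pt_leq (\<mu>p p) x)"
    proof (cases "s \<in> L y \<and> t \<in> L y")
      case True
      have atom: "gdef (pair_guard \<one> s t) (\<lambda>p N. (act (elt 0 N) s, act (elt K N) t) \<in> pt_leq (\<mu>p p) z)"
        if z: "z \<in> T" "s \<in> L z" "t \<in> L z" for z
        by (rule leq_gdef[OF G z allowed_gens(1) allowed_gens(1) _ _ g]) (use z in \<open>auto simp: prof_def\<close>)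
      have "sdef (\<lambda>p. \<forall>N. pair_guard \<one> s t N \<longrightarrow>
        (act (elt 0 N) s, act (elt K N) t) \<in> pt_leq (\<mu>p p) y \<longrightarrow> (act (elt 0 N) s, act (elt K N) t) \<in> pt_leq (\<mu>p p) x)"
        by (intro sdef_gdef atom) (use True child_T[OF x y] x child_label[OF x y] in auto)
      then show ?thesis by (rule sdef_cong) (use lab True in blast)
    next
      case False
      show ?thesis by (rule sdef_cong[OF sdef_True]) (use lab False in blast)
    qed
  qed (use base(1)[OF one_closed] in auto)
  have "finite (ch x)" if "x \<in> T" for x
    using finite_subset[OF _ finite_T] child_T[OF that] by blast
  then have "sdef (\<lambda>p. \<forall>x\<in>T. \<forall>y\<in>ch x. \<forall>s\<in>S. \<forall>t\<in>S. s \<in> L y \<longrightarrow> t \<in> L y \<longrightarrow>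
      (s, t) \<in> pt_leq (\<mu>p p) y \<longrightarrow> (s, t) \<in> pt_leq (\<mu>p p) x)"
    by (intro sdef_ball step finite_T)
  then show ?thesis
  proof (rule sdef_cong)
    fix p
    show "refines p \<longleftrightarrow> (\<forall>x\<in>T. \<forall>y\<in>ch x. \<forall>s\<in>S. \<forall>t\<in>S. s \<in> L y \<longrightarrow> t \<in> L y \<longrightarrow>
      (s, t) \<in> pt_leq (\<mu>p p) y \<longrightarrow> (s, t) \<in> pt_leq (\<mu>p p) x)"
      unfolding refines_def using label_S child_T by blast
  qed
qed

lemma locus_countable_union:
  "\<exists>F. countable F \<and> (\<forall>Z\<in>F. semialgebraic_Q_in_data_space P \<mu> \<tau> Z) \<and>
     {p \<in> \<Sigma>. monoid_partree P act S (\<mu>p p) \<and> compatible_rel P act (partree_preorder (\<mu>p p))} = \<Union>F"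
proof -
  have "sdef (\<lambda>p. monoid_partree P act S (\<mu>p p) \<and> compatible_rel P act (partree_preorder (\<mu>p p)))"
    by (rule sdef_cong[OF sdef_conj[OF sdef_refines sdef_compatible]]) (simp add: monoid_partree_point)
  then obtain C where "sigma_semialg I C" and
    C: "{p \<in> \<Sigma>. monoid_partree P act S (\<mu>p p) \<and> compatible_rel P act (partree_preorder (\<mu>p p))} = {p \<in> \<Sigma>. \<iota> p \<in> C}"
    unfolding sdef_def by blast
  then obtain F where F: "countable F" "F \<subseteq> semialgebraic_Q I" "C = \<Union>F"
    unfolding sigma_semialg_def by blast
  show ?thesis
  proof (intro exI[of _ "(\<lambda>A. {p \<in> \<Sigma>. \<iota> p \<in> A}) ` F"] conjI ballI)
    show "countable ((\<lambda>A. {p \<in> \<Sigma>. \<iota> p \<in> A}) ` F)" using F(1) by (rule countable_image)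
    fix Z assume "Z \<in> (\<lambda>A. {p \<in> \<Sigma>. \<iota> p \<in> A}) ` F"
    then obtain A where "A \<in> F" "Z = {p \<in> \<Sigma>. \<iota> p \<in> A}" by (rule imageE)
    then show "semialgebraic_Q_in_data_space P \<mu> \<tau> Z"
      unfolding semialgebraic_Q_in_data_space_def using F(2) by (intro bexI[of _ A]) auto
  next
    show "{p \<in> \<Sigma>. monoid_partree P act S (\<mu>p p) \<and> compatible_rel P act (partree_preorder (\<mu>p p))} =
        \<Union>((\<lambda>A. {p \<in> \<Sigma>. \<iota> p \<in> A}) ` F)"
      unfolding C F(3) by auto
  qed
qed

end

theorem theorem6p16:
  fixes P :: "('u, 'c) monoid_scheme"
    and act :: "'u \<Rightarrow> 's \<Rightarrow> 's"
    and S :: "'s set"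
    and \<mu> :: "('v, 's, 'u) mpartree"
    and \<tau> :: "'v \<Rightarrow> ('w, ('u \<times> 'u) set, (('u \<times> 'u) set \<times> 's) set) preotree"
    and gen :: "'v \<Rightarrow> 'w \<Rightarrow> nat \<Rightarrow> ('u \<times> 'u) set set"
    and enum :: "'v \<Rightarrow> 'w \<Rightarrow> nat \<Rightarrow> 'w"
    and \<Sigma> \<Gamma> :: "('v, 'w) data_point set"
  assumes "comm_monoid P" and "fg_monoid P"
    and "fg_action P act S"
    and "monoid_partree P act S \<mu>"
    and "\<And>x. x \<in> pt_verts \<mu> \<Longrightarrow> corresponding_preotree P act \<mu> x (\<tau> x)"
    and "\<And>x. x \<in> pt_verts \<mu> \<Longrightarrow> data_frame (Gr_at P \<mu> x) (\<tau> x) (gen x) (enum x)"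
  defines "\<Sigma> \<equiv> total_data_space P \<mu> \<tau>"
    and "\<Gamma> \<equiv> {p \<in> \<Sigma>. monoid_partree P act S (partree_at_point P act \<mu> \<tau> gen enum p) \<and>
                compatible_rel P act (partree_preorder (partree_at_point P act \<mu> \<tau> gen enum p))}"
  shows "\<exists>F. countable F \<and> (\<forall>Z\<in>F. semialgebraic_Q_in_data_space P \<mu> \<tau> Z) \<and> \<Gamma> = \<Union>F"
proof -
  obtain K a where "\<forall>i<K. a i \<in> carrier P" "\<forall>v\<in>carrier P. \<exists>n. v = comm_monoid.pow_prod P K a n"
    using comm_monoid.fg_monoid_pow_prod[OF assms(1,2)] by blast
  then interpret varied_partree P act S \<mu> K a \<tau> gen enum
    using assms(1-6) by (intro varied_partree.intro generated_partree.intro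
        generated_partree_axioms.intro varied_partree_axioms.intro) auto
  show ?thesis unfolding \<Gamma>_def \<Sigma>_def by (rule locus_countable_union)
qed

end
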